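(* Let $(\phi_t)$ be a parabolic holomorphic semigroup, not a group, in $\mathbb{D}$, with Denjoy-Wolff point $\tau\in\partial\mathbb{D}$. Let $h$ be the Königs function of $(\phi_t)$. If $\Delta$ is a parabolic petal for $(\phi_t)$ then $h(\Delta)$ is a maximal half-plane in $h(\mathbb{D})$. Conversely, if $H\subset h(\mathbb{D})$ is a maximal half-plane in $h(\mathbb{D})$ then $h^{-1}(H)$ is a parabolic petal for $(\phi_t)$. Moreover, $(\phi_t)$ can have at most two parabolic petals and, if it has two parabolic petals, then $(\phi_t)$ has zero hyperbolic step.
   Context: $\mathbb{D}$ is the open unit disc in $\mathbb{C}$. A holomorphic semigroup in $\mathbb{D}$ is a family $(\phi_t)_{t\ge0}$ of holomorphic self-maps of $\mathbb{D}$ with $\phi_0=\mathrm{id}$, $\phi_{t+s}=\phi_t\circ\phi_s$, continuous in $t$ for uniform convergence on compacta. It is a group if $\phi_t$ is an automorphism of $\mathbb{D}$ for some (equivalently all) $t>0$. If it is not a group, the Denjoy-Wolff point is the unique $\tau\in\overline{\mathbb{D}}$ with $\phi_t\to\tau$ uniformly on compacta as $t\to+\infty$. The semigroup is parabolic if $\tau\in\partial\mathbb{D}$ and $\angle\lim_{z\to\tau}\phi_t'(z)=1$ for all $t\ge0$ ($\angle\lim$ is the non-tangential limit). A parabolic semigroup has zero hyperbolic step if $\lim_{t\to+\infty}\omega(\phi_{t+1}(0),\phi_t(0))=0$, $\omega$ being the hyperbolic distance of $\mathbb{D}$; otherwise it has positive hyperbolic step. $\sigma\in\partial\mathbb{D}$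 is a repelling fixed point if $\angle\lim_{z\to\sigma}\phi_t(z)=\sigma$ and $\angle\lim_{z\to\sigma}\phi_t'(z)=e^{-\lambda t}$ for all $t\ge0$, with some $\lambda<0$. Petals are the connected components of the interior of $\bigcap_{t\ge0}\phi_t(\mathbb{D})$. A petal $\Delta$ is hyperbolic if $\partial\Delta$ contains a repelling fixed point of $(\phi_t)$, parabolic otherwise. The Königs function of a parabolic semigroup is the univalent map $h:\mathbb{D}\to\mathbb{C}$ of its canonical model $(\Omega,h,z\mapsto z+it)$: $h\circ\phi_t=h+it$ and $\bigcup_{t\ge0}(h(\mathbb{D})-it)=\Omega$, where $\Omega=\mathbb{C}$ if $(\phi_t)$ has zero hyperbolic step and $\Omega$ is $\{\operatorname{Re}\zeta>0\}$ or $\{\operatorname{Re}\zeta<0\}$ if it has positive hyperbolic step (such a model exists and is unique up to isomorphism of models). For $a\in\mathbb{R}$, a half-plane $\{\operatorname{Re}w>a\}\subset h(\mathbb{D})$ (respectively $\{\operatorname{Re}w<a\}\subset h(\mathbb{D})$) is maximal if $\{\operatorname{Re}w>b\}\not\subset h(\mathbb{D})$ for every $b<a$ (respectively $\{\operatorname{Re}w<b\}\not\subset h(\mathbb{D})$ for every $b>a$). Maximal half-planes are always of one of these two forms. *)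

theory Defs
  imports "HOL-Complex_Analysis.Complex_Analysis"
begin

abbreviation unit_disc :: "complex set" ("\<DD>") where
  "\<DD> \<equiv> ball 0 1"

text \<open>A family is a function of a real parameter and a complex argument; only its values for
  \<open>t \<ge> 0\<close> and \<open>z \<in> \<DD>\<close> are constrained or used anywhere below.\<close>

definition holomorphic_semigroup :: "(real \<Rightarrow> complex \<Rightarrow> complex) \<Rightarrow> bool" where
  "holomorphic_semigroup \<phi> \<longleftrightarrow>
     (\<forall>t\<ge>0. \<phi> t holomorphic_on \<DD> \<and> \<phi> t ` \<DD> \<subseteq> \<DD>) \<and>
     (\<forall>z\<in>\<DD>. \<phi> 0 z = z) \<and>
     (\<forall>t\<ge>0. \<forall>s\<ge>0. \<forall>z\<in>\<DD>. \<phi> (t + s) z = \<phi> t (\<phi> s z)) \<and>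
     (\<forall>t0\<ge>0. \<forall>K. compact K \<longrightarrow> K \<subseteq> \<DD> \<longrightarrow> uniform_limit K \<phi> (\<phi> t0) (at t0 within {0..}))"

definition disc_automorphism :: "(complex \<Rightarrow> complex) \<Rightarrow> bool" where
  "disc_automorphism f \<longleftrightarrow> f holomorphic_on \<DD> \<and> bij_betw f \<DD> \<DD>"

definition is_holomorphic_group :: "(real \<Rightarrow> complex \<Rightarrow> complex) \<Rightarrow> bool" where
  "is_holomorphic_group \<phi> \<longleftrightarrow> (\<exists>t>0. disc_automorphism (\<phi> t))"

definition denjoy_wolff_point :: "(real \<Rightarrow> complex \<Rightarrow> complex) \<Rightarrow> complex \<Rightarrow> bool" where
  "denjoy_wolff_point \<phi> \<tau> \<longleftrightarrow> \<tau> \<in> closure \<DD> \<and>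
     (\<forall>K. compact K \<longrightarrow> K \<subseteq> \<DD> \<longrightarrow> uniform_limit K \<phi> (\<lambda>_. \<tau>) at_top)"

definition stolz_region :: "complex \<Rightarrow> real \<Rightarrow> complex set" where
  "stolz_region \<sigma> M = {z \<in> \<DD>. cmod (\<sigma> - z) < M * (1 - cmod z)}"

definition nontangential_limit :: "(complex \<Rightarrow> complex) \<Rightarrow> complex \<Rightarrow> complex \<Rightarrow> bool" where
  "nontangential_limit f \<sigma> l \<longleftrightarrow> (\<forall>M>1. (f \<longlongrightarrow> l) (at \<sigma> within stolz_region \<sigma> M))"

definition parabolic_semigroup :: "(real \<Rightarrow> complex \<Rightarrow> complex) \<Rightarrow> complex \<Rightarrow> bool" where
  "parabolic_semigroup \<phi> \<tau> \<longleftrightarrow>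
     denjoy_wolff_point \<phi> \<tau> \<and> \<tau> \<in> frontier \<DD> \<and>
     (\<forall>t\<ge>0. nontangential_limit (deriv (\<phi> t)) \<tau> 1)"

text \<open>\<open>Moebius_function 0 w z = (z - w) / (1 - cnj w * z)\<close>; the normalisation is that of
  curvature \<open>-4\<close>.\<close>

definition hyperbolic_distance :: "complex \<Rightarrow> complex \<Rightarrow> real" where
  "hyperbolic_distance z w = artanh (cmod (Moebius_function 0 w z))"

definition zero_hyperbolic_step :: "(real \<Rightarrow> complex \<Rightarrow> complex) \<Rightarrow> bool" where
  "zero_hyperbolic_step \<phi> \<longleftrightarrow>
     ((\<lambda>t. hyperbolic_distance (\<phi> (t + 1) 0) (\<phi> t 0)) \<longlongrightarrow> 0) at_top"

text \<open>The spectral value \<open>\<mu>\<close> does not depend on \<open>t\<close>.\<close>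

definition repelling_fixed_point :: "(real \<Rightarrow> complex \<Rightarrow> complex) \<Rightarrow> complex \<Rightarrow> bool" where
  "repelling_fixed_point \<phi> \<sigma> \<longleftrightarrow> \<sigma> \<in> frontier \<DD> \<and>
     (\<exists>\<mu><0. \<forall>t\<ge>0. nontangential_limit (\<phi> t) \<sigma> \<sigma> \<and>
        nontangential_limit (deriv (\<phi> t)) \<sigma> (of_real (exp (- \<mu> * t))))"

definition petal :: "(real \<Rightarrow> complex \<Rightarrow> complex) \<Rightarrow> complex set \<Rightarrow> bool" where
  "petal \<phi> \<Delta> \<longleftrightarrow> \<Delta> \<in> components (interior (\<Inter>t\<in>{0..}. \<phi> t ` \<DD>))"

definition hyperbolic_petal :: "(real \<Rightarrow> complex \<Rightarrow> complex) \<Rightarrow> complex set \<Rightarrow> bool" where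
  "hyperbolic_petal \<phi> \<Delta> \<longleftrightarrow> petal \<phi> \<Delta> \<and> (\<exists>\<sigma>\<in>frontier \<Delta>. repelling_fixed_point \<phi> \<sigma>)"

definition parabolic_petal :: "(real \<Rightarrow> complex \<Rightarrow> complex) \<Rightarrow> complex set \<Rightarrow> bool" where
  "parabolic_petal \<phi> \<Delta> \<longleftrightarrow> petal \<phi> \<Delta> \<and> \<not> hyperbolic_petal \<phi> \<Delta>"

text \<open>The canonical model \<open>(\<Omega>, h, z \<mapsto> z + \<i> t)\<close> of a parabolic semigroup. It is unique only up to
  isomorphism of models, so being a Koenigs function is a predicate on \<open>h\<close>.\<close>

definition parabolic_canonical_model ::
  "(real \<Rightarrow> complex \<Rightarrow> complex) \<Rightarrow> complex set \<Rightarrow> (complex \<Rightarrow> complex) \<Rightarrow> bool" where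
  "parabolic_canonical_model \<phi> \<Omega> h \<longleftrightarrow>
     (if zero_hyperbolic_step \<phi> then \<Omega> = UNIV
      else \<Omega> = {\<zeta>. Re \<zeta> > 0} \<or> \<Omega> = {\<zeta>. Re \<zeta> < 0}) \<and>
     h holomorphic_on \<DD> \<and> inj_on h \<DD> \<and>
     (\<forall>t\<ge>0. \<forall>z\<in>\<DD>. h (\<phi> t z) = h z + \<i> * of_real t) \<and>
     (\<Union>t\<in>{0..}. (\<lambda>w. w - \<i> * of_real t) ` h ` \<DD>) = \<Omega>"

definition koenigs_function ::
  "(real \<Rightarrow> complex \<Rightarrow> complex) \<Rightarrow> (complex \<Rightarrow> complex) \<Rightarrow> bool" where
  "koenigs_function \<phi> h \<longleftrightarrow> (\<exists>\<Omega>. parabolic_canonical_model \<phi> \<Omega> h)"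

definition maximal_half_plane :: "complex set \<Rightarrow> complex set \<Rightarrow> bool" where
  "maximal_half_plane U H \<longleftrightarrow>
     (\<exists>a. H = {w. Re w > a} \<and> H \<subseteq> U \<and> (\<forall>b<a. \<not> {w. Re w > b} \<subseteq> U)) \<or>
     (\<exists>a. H = {w. Re w < a} \<and> H \<subseteq> U \<and> (\<forall>b>a. \<not> {w. Re w < b} \<subseteq> U))"

end

theory Submission
  imports Defs "HOL-Real_Asymp.Real_Asymp"
begin

text \<open>Put \<open>U = h(\<DD>)\<close>. Since \<open>\<phi>\<^sub>t\<close> is conjugate to the vertical translation by \<open>t\<close>, the set
  \<open>\<Inter>\<^sub>t \<phi>\<^sub>t(\<DD>)\<close> corresponds to the union of the vertical lines contained in \<open>U\<close>, so petals correspond to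
  maximal open vertical strips, half-planes included. It remains to see that strips of finite width
  give hyperbolic petals and half-planes parabolic ones.

  Finite width \<open>R\<close>: let \<open>\<gamma>(t)\<close> be the preimage of the downward motion along the middle line. The
  strip is maximal, so rays missing from \<open>U\<close> confine \<open>U\<close> near \<open>-\<i>\<infinity>\<close> to a strip of width less than
  \<open>6R/5\<close>, and a Phragmen-Lindelof argument gives \<open>1 - |\<gamma>(t)| = O(e^(-\<kappa>t))\<close> with \<open>\<kappa> = 5/(2R)\<close>. The
  Schwarz-Pick lemma on discs of radius \<open>R/2\<close> bounds the speed of \<open>\<gamma>\<close> by a multiple of
  \<open>1 - |\<gamma>|\<close>, so \<open>\<gamma>\<close> converges to some \<open>\<sigma>\<close>, and bounds \<open>1 - |\<gamma>(t)|\<^sup>2\<close> below by a multiple of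
  \<open>e^(-4t/R)\<close>. Hence the Poisson kernel at \<open>\<sigma>\<close> grows at least like \<open>e^(t/R)\<close> along \<open>\<gamma>\<close>; by
  Julia-Wolff-Caratheodory, \<open>\<sigma>\<close> is a repelling fixed point.

  Half-plane: suppose \<open>\<sigma>\<close> is repelling and lies on the boundary of the petal. Use the right
  half-plane with \<open>\<tau>\<close> at infinity and \<open>\<sigma>\<close> at \<open>0\<close>, and let \<open>f\<close> be \<open>h\<close> in this coordinate. Let \<open>u\<close> be
  the signed distance of \<open>f\<close> from the boundary line, positive on the petal. Backward orbits far
  inside the half-plane have arbitrarily small hyperbolic steps and therefore accumulate only at
  \<open>\<tau>\<close>; so the positive part of \<open>u\<close> vanishes on the finite boundary and \<open>u(\<zeta>) = O(Re \<zeta>)\<close>. On the other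
  hand \<open>-\<i>f'\<close> has non-negative real part, and the repelling point forces a point mass at \<open>0\<close> in its
  Herglotz measure: \<open>Re (-\<i>f'(\<zeta>)) \<ge> c Re (1/\<zeta>)\<close>. Integrating along vertical segments near \<open>0\<close>
  contradicts the linear bound.\<close>

section \<open>Schwarz-Pick and Julia inequalities\<close>

text \<open>The Poisson kernel of the disc with pole \<sigma>, for |\<sigma>| = 1. Its superlevel
  sets are the horodiscs at \<sigma>, so Julia's lemma becomes an inequality between values of
  \<open>poisson\<close>.\<close>

definition poisson :: "complex \<Rightarrow> complex \<Rightarrow> real" where
  "poisson \<sigma> z = (1 - (cmod z)\<^sup>2) / (cmod (\<sigma> - z))\<^sup>2"

lemma norm_less_1_of_image:
  assumes "f ` A \<subseteq> \<DD>" "x \<in> A"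
  shows "cmod (f x) < 1"
  using assms by (metis image_subset_iff mem_ball_0)

lemma disc_depth_pos: "x \<in> \<DD> \<Longrightarrow> 0 < 1 - (cmod x)\<^sup>2"
  by (simp add: abs_square_less_1)

lemma Moebius_norm_identity:
  assumes "cmod w < 1" "cmod z < 1"
  shows "1 - (cmod (Moebius_function 0 w z))\<^sup>2
       = (1 - (cmod w)\<^sup>2) * (1 - (cmod z)\<^sup>2) / (cmod (1 - cnj w * z))\<^sup>2"
proof -
  have "cmod (cnj w * z) < 1"
    using assms by (metis complex_mod_cnj norm_mult_less mult_1)
  then have ne: "1 - cnj w * z \<noteq> 0" by auto
  have "(cmod (1 - cnj w * z))\<^sup>2 - (cmod (z - w))\<^sup>2 = (1 - (cmod w)\<^sup>2) * (1 - (cmod z)\<^sup>2)"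
    unfolding cmod_power2 by (simp add: algebra_simps power2_eq_square)
  with ne show ?thesis
    by (simp add: Moebius_function_simple norm_divide power_divide divide_simps)
qed

text \<open>Moebius maps move \<open>w\<close> and \<open>f w\<close> to 0, and the Schwarz lemma
  applies. Writing it with 1 minus the squared pseudo-hyperbolic distance splits off the factor
  \<open>1 - (cmod w)\<^sup>2\<close>, so that \<open>w\<close> can later tend to the
  circle.\<close>

lemma Schwarz_Pick:
  assumes holf: "f holomorphic_on \<DD>" and im: "f ` \<DD> \<subseteq> \<DD>" and w: "w \<in> \<DD>" and z: "z \<in> \<DD>"
  shows "(1 - (cmod w)\<^sup>2) * (1 - (cmod z)\<^sup>2) / (cmod (1 - cnj w * z))\<^sup>2
       \<le> (1 - (cmod (f w))\<^sup>2) * (1 - (cmod (f z))\<^sup>2) / (cmod (1 - cnj (f w) * f z))\<^sup>2"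
proof -
  have w1: "cmod w < 1" and z1: "cmod z < 1" and fw: "cmod (f w) < 1" and fz: "cmod (f z) < 1"
    using w z im by (auto simp: image_subset_iff)
  define F where "F = Moebius_function 0 (f w) \<circ> f \<circ> Moebius_function 0 (-w)"
  have 1: "Moebius_function 0 (-w) ` \<DD> \<subseteq> \<DD>"
    using Moebius_function_norm_lt_1[of "-w"] w1 by auto
  have holF: "F holomorphic_on \<DD>"
    unfolding F_def
    by (rule holomorphic_on_compose_gen[OF Moebius_function_holomorphic
          holomorphic_on_compose_gen[OF holf Moebius_function_holomorphic[OF fw] im] 1])
       (use w1 in simp)
  have F0: "F 0 = 0"
    by (simp add: F_def Moebius_function_of_zero Moebius_function_eq_zero)
  have Fn: "cmod (F x) < 1" if "cmod x < 1" for x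
  proof -
    have "Moebius_function 0 (-w) x \<in> \<DD>" using 1 that by (auto simp: image_subset_iff)
    then have "cmod (f (Moebius_function 0 (-w) x)) < 1" by (rule norm_less_1_of_image[OF im])
    then show ?thesis unfolding F_def o_def by (rule Moebius_function_norm_lt_1[OF fw])
  qed
  have m1: "cmod (Moebius_function 0 w z) < 1" by (rule Moebius_function_norm_lt_1[OF w1 z1])
  have "cmod (F (Moebius_function 0 w z)) \<le> cmod (Moebius_function 0 w z)"
    by (rule Schwarz_Lemma(1)[OF holF F0 Fn m1])
  moreover have "F (Moebius_function 0 w z) = Moebius_function 0 (f w) (f z)"
    using Moebius_function_compose[of "-w" w z] w1 z1 by (simp add: F_def)
  ultimately have "(cmod (Moebius_function 0 (f w) (f z)))\<^sup>2 \<le> (cmod (Moebius_function 0 w z))\<^sup>2"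
    by (simp add: power_mono)
  then show ?thesis
    using Moebius_norm_identity[OF w1 z1] Moebius_norm_identity[OF fw fz] by linarith
qed

text \<open>Rescaling the ball to the unit disc and sending \<open>f c\<close> to 0 reduces this to
  |F'(0)| \<le> 1. It serves for the inverse Koenigs map on balls inside a strip or a
  half-plane.\<close>

lemma Schwarz_Pick_deriv_ball:
  assumes holf: "f holomorphic_on ball c r" and im: "f ` ball c r \<subseteq> \<DD>" and r: "r > 0"
  shows "cmod (deriv f c) \<le> (1 - (cmod (f c))\<^sup>2) / r"
proof -
  have fc: "cmod (f c) < 1" using norm_less_1_of_image[OF im] r by simp
  define F where "F = (\<lambda>z. (f (c + of_real r * z) - f c) / (1 - cnj (f c) * f (c + of_real r * z)))"
  have maps: "c + of_real r * z \<in> ball c r" if "cmod z < 1" for z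
    using that r by (simp add: dist_norm norm_mult)
  have hol: "(\<lambda>z. f (c + of_real r * z)) holomorphic_on \<DD>"
    using maps by (intro holomorphic_on_compose_gen[OF _ holf, unfolded o_def] holomorphic_intros) auto
  have lt: "cmod (f (c + of_real r * z)) < 1" if "cmod z < 1" for z
    by (rule norm_less_1_of_image[OF im maps[OF that]])
  have ne: "1 - cnj (f c) * f (c + of_real r * z) \<noteq> 0" if "cmod z < 1" for z
  proof -
    have "cmod (cnj (f c) * f (c + of_real r * z)) < 1"
      using fc lt[OF that] by (metis complex_mod_cnj norm_mult_less mult_1)
    then show ?thesis by auto
  qed
  have holF: "F holomorphic_on \<DD>"
    unfolding F_def using ne by (intro holomorphic_intros hol) auto
  have F0: "F 0 = 0" by (simp add: F_def)
  have Fn: "cmod (F z) < 1" if "cmod z < 1" for z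
    using Moebius_function_norm_lt_1[OF fc lt[OF that], of 0] by (simp add: F_def Moebius_function_simple)
  have le: "cmod (deriv F 0) \<le> 1"
    by (rule Schwarz_Lemma(2)[OF holF F0 Fn, of 0]) auto
  have "(f has_field_derivative deriv f c) (at c)"
    using holf r by (simp add: holomorphic_derivI)
  then have "(f has_field_derivative deriv f c) (at (c + of_real r * 0))" by simp
  then have d: "((\<lambda>z. f (c + of_real r * z)) has_field_derivative deriv f c * of_real r) (at 0)"
    by (rule DERIV_chain2) (auto intro!: derivative_eq_intros)
  have q: "1 - cnj (f c) * f c = of_real (1 - (cmod (f c))\<^sup>2)"
    using complex_norm_square[of "f c"] by (simp add: mult.commute)
  have pos: "0 < 1 - (cmod (f c))\<^sup>2" using fc by (simp add: abs_square_less_1)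
  have "(F has_field_derivative (deriv f c * of_real r) / (1 - cnj (f c) * f c)) (at 0)"
    unfolding F_def
    by (rule derivative_eq_intros d refl | use ne[of 0] in \<open>simp add: divide_simps\<close>)+
  then have "deriv F 0 = (deriv f c * of_real r) / (1 - cnj (f c) * f c)"
    by (rule DERIV_imp_deriv)
  then have "cmod (deriv F 0) = cmod (deriv f c) * r / (1 - (cmod (f c))\<^sup>2)"
    unfolding q using r pos by (simp only: norm_divide norm_mult norm_of_real) simp
  with le pos r show ?thesis by (simp add: field_simps)
qed

text \<open>\<open>Schwarz_Pick_deriv_ball\<close> bounds the logarithmic derivative of the depth 1
  - |f|^2 along the segment above by \<open>2 / r\<close>, so the depth times
  \<open>exp (- 2 * t / r)\<close> cannot increase.\<close>

lemma disc_depth_growth: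
  assumes holf: "f holomorphic_on V" and V: "open V" and im: "f ` V \<subseteq> \<DD>"
    and r: "r > 0" and v: "cmod v = 1" and T: "T \<ge> 0"
    and ball: "\<And>t. 0 \<le> t \<Longrightarrow> t \<le> T \<Longrightarrow> ball (w + of_real t * v) r \<subseteq> V"
  shows "1 - (cmod (f (w + of_real T * v)))\<^sup>2 \<le> exp (2 * T / r) * (1 - (cmod (f w))\<^sup>2)"
proof -
  define N where "N = (\<lambda>t. (1 - (cmod (f (w + of_real t * v)))\<^sup>2) * exp (- 2 * t / r))"
  have "N T \<le> N 0"
  proof (rule DERIV_nonpos_imp_nonincreasing[OF T])
    fix t assume t: "0 \<le> t" "t \<le> T"
    define p where "p = w + of_real t * v"
    have pb: "ball p r \<subseteq> V" using ball[OF t] by (simp add: p_def)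
    then have pV: "p \<in> V" using r by auto
    have le: "cmod (deriv f p) \<le> (1 - (cmod (f p))\<^sup>2) / r"
      using pb im by (intro Schwarz_Pick_deriv_ball[OF holomorphic_on_subset[OF holf pb] _ r]) auto
    have d1: "(f has_field_derivative deriv f p) (at p)"
      using holf V pV holomorphic_derivI by blast
    have d2: "((\<lambda>x. w + of_real x * v) has_vector_derivative v) (at t)"
      by (auto intro!: derivative_eq_intros)
    have d3: "((\<lambda>x. f (w + of_real x * v)) has_vector_derivative v * deriv f p) (at t)"
      using field_vector_diff_chain_at[OF d2, of f] d1 by (simp add: p_def o_def)
    have d4: "((\<lambda>x. (cmod (f (w + of_real x * v)))\<^sup>2) has_real_derivative 2 * (f p \<bullet> (v * deriv f p))) (at t)"
      using has_derivative_inner[OF d3[unfolded has_vector_derivative_def] d3[unfolded has_vector_derivative_def]]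
      by (simp add: has_field_derivative_def power2_norm_eq_inner p_def inner_commute mult_commute_abs algebra_simps)
    have "((\<lambda>x. exp (- 2 * x / r)) has_real_derivative exp (- 2 * t / r) * (- 2 / r)) (at t)"
      by (rule derivative_eq_intros refl | use r in simp)+
    from DERIV_mult[OF DERIV_diff[OF DERIV_const d4] this]
    have d5: "(N has_real_derivative (- 2 * (f p \<bullet> (v * deriv f p)) - (1 - (cmod (f p))\<^sup>2) * (2 / r)) * exp (- 2 * t / r)) (at t)"
      unfolding N_def by (rule DERIV_cong) (use r in \<open>simp add: p_def field_simps\<close>)
    have "- (f p \<bullet> (v * deriv f p)) \<le> cmod (f p) * cmod (v * deriv f p)"
      using norm_cauchy_schwarz[of "- f p" "v * deriv f p"] by simp
    also have "\<dots> \<le> 1 * cmod (deriv f p)"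
      using v im pV by (intro mult_mono) (auto simp: norm_mult image_subset_iff less_imp_le)
    also have "\<dots> \<le> (1 - (cmod (f p))\<^sup>2) / r" using le by simp
    finally have "- 2 * (f p \<bullet> (v * deriv f p)) - (1 - (cmod (f p))\<^sup>2) * (2 / r) \<le> 0"
      using r by (simp add: divide_simps)
    then show "\<exists>y. (N has_real_derivative y) (at t) \<and> y \<le> 0"
      using d5 by (intro exI conjI) (auto intro: mult_nonpos_nonneg)
  qed
  then show ?thesis
    by (simp add: N_def exp_minus field_simps)
qed

text \<open>Mean value inequality: the derivative is at most the depth over \<open>r\<close>, and
  \<open>disc_depth_growth\<close> controls the depth on the segment from its starting point. The
  displacement is thus of the order of the depth, so a sequence tending to the circle keeps its
  limit.\<close>

lemma disc_displacement:
  assumes holf: "f holomorphic_on V" and V: "open V" and im: "f ` V \<subseteq> \<DD>"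
    and r: "r > 0" and v: "cmod v = 1" and T: "T \<ge> 0"
    and ball: "\<And>t. 0 \<le> t \<Longrightarrow> t \<le> T \<Longrightarrow> ball (w + of_real t * v) r \<subseteq> V"
  shows "cmod (f (w + of_real T * v) - f w) \<le> T / r * exp (2 * T / r) * (1 - (cmod (f w))\<^sup>2)"
proof -
  define B where "B = exp (2 * T / r) * (1 - (cmod (f w))\<^sup>2) / r"
  have wV: "w \<in> V" using ball[of 0] T r by auto
  have dw: "1 - (cmod (f w))\<^sup>2 > 0" using disc_depth_pos im wV by blast
  have "cmod (f (w + of_real T * v) - f w) \<le> B * cmod (w + of_real T * v - w)"
  proof (rule field_differentiable_bound[of "closed_segment w (w + of_real T * v)" f "deriv f"])
    fix u assume "u \<in> closed_segment w (w + of_real T * v)"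
    then obtain x where x: "0 \<le> x" "x \<le> 1" "u = (1 - x) *\<^sub>R w + x *\<^sub>R (w + of_real T * v)"
      by (auto simp: closed_segment_def)
    define t where "t = x * T"
    have u: "u = w + of_real t * v" by (simp add: x(3) t_def scaleR_conv_of_real algebra_simps)
    have t: "0 \<le> t" "t \<le> T" using x T by (auto simp: t_def mult_left_le_one_le)
    have sub: "ball u r \<subseteq> V" unfolding u by (rule ball[OF t])
    then have uV: "u \<in> V" using r by auto
    show "(f has_field_derivative deriv f u) (at u within closed_segment w (w + of_real T * v))"
      by (rule has_field_derivative_at_within[OF holomorphic_derivI[OF holf V uV]])
    have "cmod (deriv f u) \<le> (1 - (cmod (f u))\<^sup>2) / r"
      using sub im by (intro Schwarz_Pick_deriv_ball[OF holomorphic_on_subset[OF holf sub] _ r]) auto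
    also have "1 - (cmod (f u))\<^sup>2 \<le> exp (2 * t / r) * (1 - (cmod (f w))\<^sup>2)"
      unfolding u using t ball by (intro disc_depth_growth[OF holf V im r v]) auto
    also have "\<dots> \<le> exp (2 * T / r) * (1 - (cmod (f w))\<^sup>2)"
      using t r dw by (intro mult_right_mono) (auto simp: divide_right_mono)
    finally show "cmod (deriv f u) \<le> B" using r by (simp add: B_def divide_right_mono)
  qed auto
  also have "cmod (w + of_real T * v - w) = T" using v T by (simp add: norm_mult)
  finally show ?thesis by (simp add: B_def mult_ac)
qed

text \<open>Schwarz-Pick for \<open>zs n\<close> and \<open>z\<close>, divided by the depth of
  \<open>zs n\<close>, becomes the claim in the limit. A depth bound along a subsequence is enough:
  if the claim failed, \<open>a n > b n\<close> would hold for all large \<open>n\<close>, and a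
  single index with both properties is contradictory.\<close>

lemma Julia_inequality:
  fixes zs :: "nat \<Rightarrow> complex"
  assumes holf: "f holomorphic_on \<DD>" and im: "f ` \<DD> \<subseteq> \<DD>" and s: "cmod \<sigma> = 1"
    and zD: "\<And>n. zs n \<in> \<DD>" and lim: "zs \<longlonglongrightarrow> \<sigma>" and flim: "(\<lambda>n. f (zs n)) \<longlonglongrightarrow> \<sigma>"
    and freq: "\<exists>\<^sub>F n in sequentially. 1 - (cmod (f (zs n)))\<^sup>2 \<le> A * (1 - (cmod (zs n))\<^sup>2)"
    and z: "z \<in> \<DD>"
  shows "poisson \<sigma> z \<le> A * poisson \<sigma> (f z)"
proof (rule ccontr)
  assume "\<not> ?thesis"
  then have less: "A * poisson \<sigma> (f z) < poisson \<sigma> z" by simp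
  have cm: "cmod (1 - cnj \<sigma> * x) = cmod (\<sigma> - x)" for x
  proof -
    have "\<sigma> * (1 - cnj \<sigma> * x) = \<sigma> - x"
      using s complex_norm_square[of \<sigma>] by (simp add: right_diff_distrib flip: mult.assoc)
    then show ?thesis using s by (metis mult_1 norm_mult)
  qed
  have fz: "f z \<in> \<DD>" using norm_less_1_of_image[OF im z] by simp
  have ne: "cmod (1 - cnj \<sigma> * x) \<noteq> 0" if "x \<in> \<DD>" for x
    using that s by (auto simp: cm)
  define a where "a = (\<lambda>n. (1 - (cmod z)\<^sup>2) / (cmod (1 - cnj (zs n) * z))\<^sup>2)"
  define b where "b = (\<lambda>n. A * ((1 - (cmod (f z))\<^sup>2) / (cmod (1 - cnj (f (zs n)) * f z))\<^sup>2))"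
  have "a \<longlonglongrightarrow> (1 - (cmod z)\<^sup>2) / (cmod (1 - cnj \<sigma> * z))\<^sup>2"
    unfolding a_def using ne[OF z] by (intro tendsto_intros lim) auto
  moreover have "b \<longlonglongrightarrow> A * ((1 - (cmod (f z))\<^sup>2) / (cmod (1 - cnj \<sigma> * f z))\<^sup>2)"
    unfolding b_def using ne[OF fz] by (intro tendsto_intros flim) auto
  ultimately have "(\<lambda>n. a n - b n) \<longlonglongrightarrow> poisson \<sigma> z - A * poisson \<sigma> (f z)"
    unfolding poisson_def cm by (rule tendsto_diff)
  then have "\<forall>\<^sub>F n in sequentially. a n - b n > 0"
    using less by (intro order_tendstoD) auto
  with freq have "\<exists>\<^sub>F n in sequentially. 1 - (cmod (f (zs n)))\<^sup>2 \<le> A * (1 - (cmod (zs n))\<^sup>2) \<and> a n - b n > 0"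
    by (rule frequently_eventually_frequently)
  then obtain n where n: "1 - (cmod (f (zs n)))\<^sup>2 \<le> A * (1 - (cmod (zs n))\<^sup>2)" "a n - b n > 0"
    by (auto dest: frequently_ex)
  have pos: "1 - (cmod (zs n))\<^sup>2 > 0" using zD[of n] by (simp add: abs_square_less_1)
  have posf: "1 - (cmod (f z))\<^sup>2 \<ge> 0" using fz by (simp add: abs_square_le_1 less_imp_le)
  have "(1 - (cmod (zs n))\<^sup>2) * a n = (1 - (cmod (zs n))\<^sup>2) * (1 - (cmod z)\<^sup>2) / (cmod (1 - cnj (zs n) * z))\<^sup>2"
    by (simp add: a_def)
  also have "\<dots> \<le> (1 - (cmod (f (zs n)))\<^sup>2) * (1 - (cmod (f z))\<^sup>2) / (cmod (1 - cnj (f (zs n)) * f z))\<^sup>2"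
    by (rule Schwarz_Pick[OF holf im zD z])
  also have "\<dots> \<le> (A * (1 - (cmod (zs n))\<^sup>2)) * (1 - (cmod (f z))\<^sup>2) / (cmod (1 - cnj (f (zs n)) * f z))\<^sup>2"
    using n(1) posf by (intro divide_right_mono mult_right_mono) auto
  also have "\<dots> = (1 - (cmod (zs n))\<^sup>2) * b n" by (simp add: b_def)
  finally show False using pos n(2) by simp
qed

section \<open>Angular slopes in the right half-plane\<close>

abbreviation RHP :: "complex set" ("\<H>") where
  "\<H> \<equiv> {z. Re z > 0}"

lemma open_RHP: "open \<H>"
  using open_halfspace_Re_gt by simp

text \<open>Cayley maps centred at \<open>z0\<close> and \<open>G z0\<close> reduce this to the
  Schwarz lemma, with \<open>\<rho> = cmod w\<close>. It gives |A| \<le> Re (G z0) (1 + \<rho>) / (1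
  - \<rho>), which is at most 4 Re (G z0) / (1 - \<rho>^2); the 4 cancels against the one in the
  formula for 1 - \<rho>^2. Strict positivity keeps the denominator of \<open>f\<close> from
  vanishing.\<close>

lemma Caratheodory_bound_strict:
  assumes hol: "G holomorphic_on \<H>" and pos: "\<And>z. z \<in> \<H> \<Longrightarrow> Re (G z) > 0"
    and z: "z \<in> \<H>" and z0: "z0 \<in> \<H>"
  shows "cmod (G z - \<i> * of_real (Im (G z0)))
       \<le> Re (G z0) * ((cmod (z + cnj z0))\<^sup>2 / (Re z * Re z0))"
proof -
  define Z where "Z = (\<lambda>w. (z0 + cnj z0 * w) / (1 - w))"
  define f where "f = (\<lambda>w. (G (Z w) - G z0) / (G (Z w) + cnj (G z0)))"
  have ZH: "Z w \<in> \<H>" if "cmod w < 1" for w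
  proof -
    have ne: "1 - w \<noteq> 0" using that by auto
    have "Re (Z w) = Re ((z0 + cnj z0 * w) * cnj (1 - w)) / (cmod (1 - w))\<^sup>2"
      by (simp add: Z_def Re_divide_Reals complex_div_cnj[of _ "1 - w"] flip: of_real_power)
    also have "Re ((z0 + cnj z0 * w) * cnj (1 - w)) = Re z0 * (1 - (cmod w)\<^sup>2)"
      unfolding cmod_power2 by (simp add: algebra_simps power2_eq_square)
    also have "\<dots> / (cmod (1 - w))\<^sup>2 > 0"
      using z0 ne that by (simp add: abs_square_less_1)
    finally show ?thesis by simp
  qed
  have ne: "G y + cnj (G z0) \<noteq> 0" if "y \<in> \<H>" for y
  proof -
    have "Re (G y + cnj (G z0)) > 0" using pos[OF that] pos[OF z0] by simp
    then show ?thesis by (metis less_irrefl zero_complex.simps(1))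
  qed
  have holZ: "Z holomorphic_on \<DD>"
    unfolding Z_def by (intro holomorphic_intros) auto
  have holGZ: "(\<lambda>w. G (Z w)) holomorphic_on \<DD>"
    using ZH by (intro holomorphic_on_compose_gen[OF holZ hol, unfolded o_def]) auto
  have holf: "f holomorphic_on \<DD>"
    unfolding f_def using ne ZH by (intro holomorphic_intros holGZ) auto
  have f0: "f 0 = 0" by (simp add: f_def Z_def)
  have lt: "cmod (u - w) < cmod (u + cnj w)" if "Re u > 0" "Re w > 0" for u w
  proof -
    have "(cmod (u + cnj w))\<^sup>2 - (cmod (u - w))\<^sup>2 = 4 * (Re u * Re w)"
      unfolding cmod_power2 by (simp add: power2_eq_square algebra_simps)
    then have "(cmod (u - w))\<^sup>2 < (cmod (u + cnj w))\<^sup>2"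
      using mult_pos_pos[OF that] by linarith
    then show ?thesis by (rule power_less_imp_less_base) simp
  qed
  have fn: "cmod (f w) < 1" if "cmod w < 1" for w
    using lt[OF pos[OF ZH[OF that]] pos[OF z0]] ne[OF ZH[OF that]]
    by (simp add: f_def norm_divide)
  define w where "w = (z - z0) / (z + cnj z0)"
  have zz: "cmod (z - z0) < cmod (z + cnj z0)" using lt z z0 by auto
  then have nz: "z + cnj z0 \<noteq> 0" by (metis norm_zero norm_not_less_zero)
  have w1: "cmod w < 1" using zz nz by (simp add: w_def norm_divide)
  have "Re (z0 + cnj z0) > 0" using z0 by simp
  then have nz0: "z0 + cnj z0 \<noteq> 0" by (metis less_irrefl zero_complex.simps(1))
  have Zw: "Z w = z"
  proof -
    have "1 - w = (z0 + cnj z0) / (z + cnj z0)" using nz by (simp add: w_def field_simps)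
    moreover have "z0 + cnj z0 * w = z * (z0 + cnj z0) / (z + cnj z0)" 
      using nz by (simp add: w_def field_simps)
    ultimately show ?thesis using nz nz0 by (simp add: Z_def)
  qed
  have le: "cmod (f w) \<le> cmod w" by (rule Schwarz_Lemma(1)[OF holf f0 fn w1])
  define A where "A = G z - \<i> * of_real (Im (G z0))"
  define g0 where "g0 = Re (G z0)"
  have g0: "g0 > 0" using pos[OF z0] by (simp add: g0_def)
  have e1: "G z - G z0 = A - of_real g0" and e2: "G z + cnj (G z0) = A + of_real g0"
    by (simp_all add: A_def g0_def complex_eq_iff)
  define \<rho> where "\<rho> = cmod w"
  have \<rho>: "0 \<le> \<rho>" "\<rho> < 1" using w1 by (auto simp: \<rho>_def)
  have "cmod (A - of_real g0) \<le> \<rho> * cmod (A + of_real g0)"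
    using le ne[OF z] by (simp add: f_def Zw norm_divide e1 e2 \<rho>_def divide_simps mult.commute)
  moreover have "cmod A - g0 \<le> cmod (A - of_real g0)"
    using norm_triangle_ineq2[of A "of_real g0"] g0 by simp
  moreover have "cmod (A + of_real g0) \<le> cmod A + g0"
    using norm_triangle_ineq[of A "of_real g0"] g0 by simp
  ultimately have "cmod A - g0 \<le> \<rho> * (cmod A + g0)"
    using \<rho>(1) mult_left_mono[of "cmod (A + of_real g0)" "cmod A + g0" \<rho>] by linarith
  then have "cmod A * (1 - \<rho>) \<le> g0 * (1 + \<rho>)" by (simp add: algebra_simps)
  then have "cmod A * (1 - \<rho>) * (1 + \<rho>) \<le> g0 * (1 + \<rho>) * (1 + \<rho>)"
    using \<rho> by (intro mult_right_mono) auto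
  also have "\<dots> \<le> g0 * 2 * 2"
    using \<rho> g0 by (intro mult_mono) auto
  finally have main: "cmod A * (1 - \<rho>\<^sup>2) \<le> g0 * 4"
    by (simp add: power2_eq_square algebra_simps)
  have "1 - \<rho>\<^sup>2 = 4 * (Re z * Re z0) / (cmod (z + cnj z0))\<^sup>2"
  proof -
    have "(cmod (z + cnj z0))\<^sup>2 - (cmod (z - z0))\<^sup>2 = 4 * (Re z * Re z0)"
      unfolding cmod_power2 by (simp add: power2_eq_square algebra_simps)
    moreover have "(cmod (z + cnj z0))\<^sup>2 > 0" using nz by simp
    ultimately show ?thesis
      by (simp add: \<rho>_def w_def norm_divide power_divide diff_divide_eq_iff divide_eq_eq eq_divide_eq)
  qed
  with main have "cmod A * (Re z * Re z0) \<le> g0 * (cmod (z + cnj z0))\<^sup>2"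
    using nz by (simp add: field_simps)
  moreover have "Re z * Re z0 > 0" using z z0 by simp
  ultimately show ?thesis by (simp add: A_def g0_def field_simps)
qed

text \<open>The strict version is applied to \<open>G + d\<close>, and then \<open>d\<close> tends
  to 0.\<close>

lemma Caratheodory_bound:
  assumes hol: "G holomorphic_on \<H>" and pos: "\<And>z. z \<in> \<H> \<Longrightarrow> Re (G z) \<ge> 0"
    and z: "z \<in> \<H>" and z0: "z0 \<in> \<H>"
  shows "cmod (G z - \<i> * of_real (Im (G z0)))
       \<le> Re (G z0) * ((cmod (z + cnj z0))\<^sup>2 / (Re z * Re z0))"
proof -
  define K where "K = (cmod (z + cnj z0))\<^sup>2 / (Re z * Re z0)"
  have K: "K \<ge> 0" using z z0 by (simp add: K_def)
  have bnd: "cmod (G z - \<i> * of_real (Im (G z0))) \<le> Re (G z0) * K + d * (K + 1)" if d: "d > 0" for d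
  proof -
    have "cmod ((G z + of_real d) - \<i> * of_real (Im (G z0 + of_real d))) \<le> Re (G z0 + of_real d) * K"
      unfolding K_def
      by (rule Caratheodory_bound_strict[of "\<lambda>z. G z + of_real d"])
         (use pos d z z0 in \<open>auto intro!: holomorphic_intros hol add_nonneg_pos\<close>)
    moreover have "cmod (G z - \<i> * of_real (Im (G z0)))
        \<le> cmod ((G z + of_real d) - \<i> * of_real (Im (G z0 + of_real d))) + d"
      using norm_triangle_ineq4[of "(G z + of_real d) - \<i> * of_real (Im (G z0))" "of_real d"] d by simp
    ultimately show ?thesis by (simp add: algebra_simps)
  qed
  have "cmod (G z - \<i> * of_real (Im (G z0))) \<le> Re (G z0) * K"
  proof (rule field_le_epsilon)
    fix e :: real assume "e > 0"
    then show "cmod (G z - \<i> * of_real (Im (G z0))) \<le> Re (G z0) * K + e"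
      using bnd[of "e / (K + 1)"] K by simp
  qed
  then show ?thesis by (simp add: K_def)
qed

text \<open>The half-plane counterpart of a Stolz region, with vertex at infinity: the Cayley map
  carries the region of aperture \<open>M\<close> at \<sigma> into
  \<open>sector (2 * M)\<close>.\<close>

definition sector :: "real \<Rightarrow> complex set" where
  "sector K = {z. 0 < Re z \<and> cmod z \<le> K * Re z}"

abbreviation at_infinity_sector :: "real \<Rightarrow> complex filter" where
  "at_infinity_sector K \<equiv> inf at_infinity (principal (sector K))"

lemma eventually_at_infinity_sector:
  "eventually P (at_infinity_sector K) \<longleftrightarrow> (\<exists>b. \<forall>z\<in>sector K. b \<le> cmod z \<longrightarrow> P z)"
  by (auto simp: eventually_inf_principal eventually_at_infinity)

text \<open>The angular derivative at infinity. The first clause is Julia's inequality at infinity;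
  together with the limit of \<open>G z / z\<close> it makes \<open>c\<close> the best constant
  there.\<close>

definition angular_slope :: "(complex \<Rightarrow> complex) \<Rightarrow> real \<Rightarrow> bool" where
  "angular_slope G c \<longleftrightarrow>
     (\<forall>z\<in>\<H>. c * Re z \<le> Re (G z)) \<and>
     (\<forall>K\<ge>1. ((\<lambda>z. G z / z) \<longlongrightarrow> of_real c) (at_infinity_sector K) \<and>
             (deriv G \<longlongrightarrow> of_real c) (at_infinity_sector K))"

text \<open>\<open>c\<close> is the infimum of Re G / Re z. The remainder \<open>B\<close> keeps a
  nonnegative real part, and at some \<open>z0\<close> this part is tiny relative to
  \<open>Re z0\<close>. \<open>Caratheodory_bound\<close> based at \<open>z0\<close> spreads this to
  B z = o(|z|) in every sector, and Cauchy's estimate then handles the derivative.\<close>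

lemma angular_slope_exists:
  assumes hol: "G holomorphic_on \<H>" and pos: "\<And>z. z \<in> \<H> \<Longrightarrow> Re (G z) \<ge> 0"
  obtains c where "c \<ge> 0" "angular_slope G c"
proof -
  define c where "c = (INF z\<in>\<H>. Re (G z) / Re z)"
  define B where "B = (\<lambda>z. G z - of_real c * z)"
  have bdd: "bdd_below ((\<lambda>z. Re (G z) / Re z) ` \<H>)"
    using pos by (intro bdd_belowI2[of _ 0]) auto
  have ne: "\<H> \<noteq> {}" by (metis (mono_tags) mem_Collect_eq empty_iff one_complex.simps(1) zero_less_one)
  have c0: "c \<ge> 0"
    unfolding c_def using pos by (intro cINF_greatest ne) auto
  have cle: "c * Re z \<le> Re (G z)" if "z \<in> \<H>" for z
    using cINF_lower[OF bdd that] that by (simp add: c_def pos_le_divide_eq)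
  have holB: "B holomorphic_on \<H>"
    unfolding B_def by (intro holomorphic_intros hol)
  have posB: "Re (B z) \<ge> 0" if "z \<in> \<H>" for z
    using cle[OF that] by (simp add: B_def)
  have small: "\<exists>b>0. \<forall>z\<in>sector K. b \<le> cmod z \<longrightarrow> cmod (B z) \<le> e * cmod z" if e: "e > 0" and K: "K \<ge> 1" for e K
  proof -
    \<comment> \<open>The Caratheodory term will cost \<open>4 * K * d\<close> and the imaginary
      part of \<open>B z0\<close> another \<open>d\<close>, each times |z|.\<close>
    define d where "d = e / (4 * K + 1)"
    have d: "d > 0" using e K by (simp add: d_def)
    have "\<exists>z\<in>\<H>. Re (G z) / Re z < c + d"
      using d ne bdd by (intro cINF_less_iff[THEN iffD1, of _ "\<lambda>z. Re (G z) / Re z"]) (simp_all add: c_def)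
    then obtain z0 where z0: "z0 \<in> \<H>" "Re (G z0) / Re z0 < c + d" by blast
    have Bz0: "Re (B z0) \<le> d * Re z0" 
      using z0 by (simp add: B_def pos_divide_less_eq algebra_simps)
    define b where "b = max (cmod z0) (\<bar>Im (B z0)\<bar> / d)"
    have z0pos: "cmod z0 > 0" using z0 by auto
    have "cmod (B z) \<le> e * cmod z" if z: "z \<in> sector K" "b \<le> cmod z" for z
    proof -
      have zH: "z \<in> \<H>" and zK: "cmod z \<le> K * Re z" using z by (auto simp: sector_def)
      have zp: "cmod z > 0" using z(2) z0pos by (auto simp: b_def)
      have "cmod (B z - \<i> * of_real (Im (B z0))) \<le> Re (B z0) * ((cmod (z + cnj z0))\<^sup>2 / (Re z * Re z0))"
        by (rule Caratheodory_bound[OF holB posB zH z0(1)])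
      also have "\<dots> \<le> (d * Re z0) * ((cmod (z + cnj z0))\<^sup>2 / (Re z * Re z0))"
        using Bz0 zH z0 by (intro mult_right_mono) auto
      also have "\<dots> = d * ((cmod (z + cnj z0))\<^sup>2 / Re z)" using z0 by simp
      also have "\<dots> \<le> d * ((2 * cmod z)\<^sup>2 / (cmod z / K))"
      proof -
        have "cmod (z + cnj z0) \<le> 2 * cmod z"
          using norm_triangle_ineq[of z "cnj z0"] z(2) by (simp add: b_def)
        moreover have "cmod z / K \<le> Re z" using zK K by (simp add: pos_divide_le_eq mult.commute)
        ultimately show ?thesis
          using d zp K by (intro mult_left_mono frac_le power_mono) auto
      qed
      also have "\<dots> = 4 * K * d * cmod z" using zp K by (simp add: power2_eq_square)
      finally have 1: "cmod (B z - \<i> * of_real (Im (B z0))) \<le> 4 * K * d * cmod z" .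
      have "\<bar>Im (B z0)\<bar> / d \<le> cmod z" using z(2) by (simp add: b_def)
      then have 2: "\<bar>Im (B z0)\<bar> \<le> d * cmod z" using d by (simp add: pos_divide_le_eq mult.commute)
      have "cmod (B z) \<le> cmod (B z - \<i> * of_real (Im (B z0))) + \<bar>Im (B z0)\<bar>"
        using norm_triangle_ineq[of "B z - \<i> * of_real (Im (B z0))" "\<i> * of_real (Im (B z0))"]
        by (simp add: norm_mult)
      also have "\<dots> \<le> (4 * K + 1) * d * cmod z" using 1 2 by (simp add: algebra_simps)
      also have "\<dots> = e * cmod z" using K by (simp add: d_def)
      finally show ?thesis .
    qed
    moreover have "b > 0" using z0pos unfolding b_def by linarith
    ultimately show ?thesis by blast
  qed
  have lim: "((\<lambda>z. G z / z) \<longlongrightarrow> of_real c) (at_infinity_sector K)" if K: "K \<ge> 1" for K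
  proof (rule tendstoI)
    fix e :: real assume e: "e > 0"
    obtain b where b: "b > 0" "\<forall>z\<in>sector K. b \<le> cmod z \<longrightarrow> cmod (B z) \<le> e / 2 * cmod z"
      using small[of "e / 2" K] e K by auto
    have "dist (G z / z) (of_real c) < e" if z: "z \<in> sector K" "b \<le> cmod z" for z
    proof -
      have nz: "z \<noteq> 0" using z b by auto
      have "G z / z - of_real c = B z / z" using nz by (simp add: B_def field_simps)
      then have "dist (G z / z) (of_real c) = cmod (B z) / cmod z"
        by (simp add: dist_norm norm_divide)
      also have "\<dots> \<le> e / 2" using b(2) z nz by (simp add: pos_divide_le_eq)
      finally show ?thesis using e by simp
    qed
    then show "\<forall>\<^sub>F z in at_infinity_sector K. dist (G z / z) (of_real c) < e"
      unfolding eventually_at_infinity_sector by blast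
  qed
  have dlim: "(deriv G \<longlongrightarrow> of_real c) (at_infinity_sector K)" if K: "K \<ge> 1" for K
  proof (rule tendstoI)
    fix e :: real assume e: "e > 0"
    \<comment> \<open>The disc about \<open>z\<close> of radius \<open>Re z / 2\<close>, used for
      Cauchy's estimate, may leave \<open>sector K\<close> but stays in
      \<open>sector (2 * K + 1)\<close>.\<close>
    obtain b where b: "b > 0" "\<forall>z\<in>sector (2 * K + 1). b \<le> cmod z \<longrightarrow> cmod (B z) \<le> e / (8 * K) * cmod z"
      using small[of "e / (8 * K)" "2 * K + 1"] e K by auto
    have "dist (deriv G z) (of_real c) < e" if z: "z \<in> sector K" "2 * b \<le> cmod z" for z
    proof -
      have zH: "z \<in> \<H>" and zK: "cmod z \<le> K * Re z" using z by (auto simp: sector_def)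
      have Rez: "Re z \<le> cmod z" by (rule complex_Re_le_cmod)
      have sub: "y \<in> sector (2 * K + 1) \<and> b \<le> cmod y \<and> cmod y \<le> 2 * cmod z" if y: "cmod (y - z) \<le> Re z / 2" for y
      proof -
        have "\<bar>Re y - Re z\<bar> \<le> Re z / 2" using abs_Re_le_cmod[of "y - z"] y by simp
        then have Rey: "Re z / 2 \<le> Re y" by linarith
        have cy: "cmod y \<le> cmod z + Re z / 2" using norm_triangle_ineq[of "y - z" z] y by simp
        have "cmod y \<le> (K + 1/2) * Re z" using cy zK by (simp add: algebra_simps)
        also have "\<dots> \<le> (K + 1/2) * (2 * Re y)" using Rey K by (intro mult_left_mono) auto
        finally have "cmod y \<le> (2 * K + 1) * Re y" by (simp add: algebra_simps)
        moreover have "cmod z \<le> cmod y + Re z / 2" using norm_triangle_ineq[of "z - y" y] y by (simp add: norm_minus_commute)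
        ultimately show ?thesis using Rey zH cy Rez z(2) by (auto simp: sector_def)
      qed
      have subH: "cball z (Re z / 2) \<subseteq> \<H>"
        using sub by (auto simp: dist_norm norm_minus_commute sector_def)
      have "cmod ((deriv ^^ 1) B z) \<le> fact 1 * (e / (8 * K) * (2 * cmod z)) / (Re z / 2) ^ 1"
      proof (rule Cauchy_inequality)
        show "B holomorphic_on ball z (Re z / 2)"
          using holB subH ball_subset_cball by (meson holomorphic_on_subset subset_trans)
        show "continuous_on (cball z (Re z / 2)) B"
          using holB subH by (meson holomorphic_on_imp_continuous_on holomorphic_on_subset)
        show "cmod (B y) \<le> e / (8 * K) * (2 * cmod z)" if "cmod (z - y) = Re z / 2" for y
        proof -
          have s: "y \<in> sector (2 * K + 1)" "b \<le> cmod y" "cmod y \<le> 2 * cmod z"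
            using sub[of y] that by (auto simp: norm_minus_commute)
          have "cmod (B y) \<le> e / (8 * K) * cmod y" using b(2) s by blast
          also have "\<dots> \<le> e / (8 * K) * (2 * cmod z)" using s e K by (intro mult_left_mono) auto
          finally show ?thesis .
        qed
      qed (use zH in auto)
      also have "\<dots> = e / (2 * K) * (cmod z / Re z)" using zH K by (simp add: field_simps)
      also have "\<dots> \<le> e / (2 * K) * K" using zK zH e K by (intro mult_left_mono) (auto simp: pos_divide_le_eq)
      also have "\<dots> < e" using e K by simp
      finally have "cmod (deriv B z) < e" by simp
      moreover have "deriv B z = deriv G z - of_real c"
        unfolding B_def using holomorphic_on_imp_differentiable_at[OF hol open_RHP zH]
        by (subst deriv_diff) auto
      ultimately show ?thesis by (simp add: dist_norm)
    qed
    then show "\<forall>\<^sub>F z in at_infinity_sector K. dist (deriv G z) (of_real c) < e"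
      unfolding eventually_at_infinity_sector by blast
  qed
  show ?thesis
    by (rule that[OF c0]) (use lim dlim cle in \<open>auto simp: angular_slope_def\<close>)
qed

lemma filterlim_of_real_sector: "filterlim complex_of_real (at_infinity_sector 1) at_top"
proof -
  have "filterlim complex_of_real at_infinity at_top" by (rule filterlim_of_real_at_infinity)
  moreover have "filterlim complex_of_real (principal (sector 1)) at_top"
    unfolding filterlim_principal
    using eventually_gt_at_top[of 0] by eventually_elim (simp add: sector_def)
  ultimately show ?thesis by (simp add: filterlim_inf)
qed

lemma angular_slope_radial:
  assumes "angular_slope G c"
  shows "((\<lambda>x. G (of_real x) / of_real x) \<longlongrightarrow> of_real c) at_top"
  using assms filterlim_compose[OF _ filterlim_of_real_sector, of "\<lambda>z. G z / z"]
  by (auto simp: angular_slope_def)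

lemma angular_slope_ge:
  assumes sl: "angular_slope G c" and k: "\<And>z. z \<in> \<H> \<Longrightarrow> k * Re z \<le> Re (G z)"
  shows "k \<le> c"
proof -
  have "((\<lambda>x. Re (G (of_real x) / of_real x)) \<longlongrightarrow> Re (of_real c)) at_top"
    by (intro tendsto_Re angular_slope_radial sl)
  moreover have "\<forall>\<^sub>F x::real in at_top. k \<le> Re (G (of_real x) / of_real x)"
    using eventually_gt_at_top[of 0]
  proof eventually_elim
    fix x :: real assume "0 < x"
    with k[of "of_real x"] show "k \<le> Re (G (of_real x) / of_real x)"
      by (simp add: pos_le_divide_eq)
  qed
  ultimately have "k \<le> Re (of_real c)"
    by (rule tendsto_lowerbound) simp
  then show ?thesis by simp
qed

text \<open>On the positive axis \<open>F2 x\<close> is asymptotic to \<open>c2 * x\<close>, hence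
  tends to infinity inside a sector, where the slope of \<open>F1\<close> applies. This boundary
  chain rule later yields the exponential law for the dilations of the semigroup.\<close>

lemma angular_slope_compose:
  assumes s1: "angular_slope F1 c1" and s2: "angular_slope F2 c2" and c2: "c2 > 0"
    and s: "angular_slope G c" and G: "\<And>z. z \<in> \<H> \<Longrightarrow> G z = F1 (F2 z)"
  shows "c = c1 * c2"
proof -
  note r2 = angular_slope_radial[OF s2]
  \<comment> \<open>An error below a quarter of \<open>c2 * x\<close> gives |F2| \<le> 5/4 c2 x
    \<le> 2 (3/4 c2 x) \<le> 2 Re F2, hence the aperture 2 below.\<close>
  have ev: "\<forall>\<^sub>F x::real in at_top. x > 0 \<and> cmod (F2 (of_real x) - of_real (c2 * x)) < c2 / 4 * x"
    using tendstoD[OF r2 divide_pos_pos[OF c2 zero_less_numeral]] eventually_gt_at_top[of 0]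
  proof eventually_elim
    fix x :: real assume a: "dist (F2 (of_real x) / of_real x) (of_real c2) < c2 / 4" and x: "0 < x"
    have "F2 (of_real x) / of_real x - of_real c2 = (F2 (of_real x) - of_real (c2 * x)) / of_real x"
      using x by (simp add: field_simps)
    then have "cmod (F2 (of_real x) - of_real (c2 * x)) / x < c2 / 4"
      using a x by (simp add: dist_norm norm_divide)
    then show "0 < x \<and> cmod (F2 (of_real x) - of_real (c2 * x)) < c2 / 4 * x"
      using x by (simp add: pos_divide_less_eq)
  qed
  have bnds: "3 / 4 * c2 * x \<le> Re (F2 (of_real x)) \<and> cmod (F2 (of_real x)) \<le> 5 / 4 * c2 * x"
    if "cmod (F2 (of_real x) - of_real (c2 * x)) < c2 / 4 * x" "x > 0" for x
  proof -
    have "\<bar>Re (F2 (of_real x)) - c2 * x\<bar> < c2 / 4 * x"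
      using abs_Re_le_cmod[of "F2 (of_real x) - of_real (c2 * x)"] that by simp
    moreover have "cmod (F2 (of_real x)) \<le> cmod (F2 (of_real x) - of_real (c2 * x)) + c2 * x"
      using norm_triangle_ineq[of "F2 (of_real x) - of_real (c2 * x)" "of_real (c2 * x)"] c2 that
      by (simp add: norm_mult del: of_real_mult)
    ultimately show ?thesis using that unfolding abs_less_iff by linarith
  qed
  have "filterlim (\<lambda>x. F2 (of_real x)) (at_infinity_sector 2) at_top"
    unfolding filterlim_inf filterlim_principal
  proof (intro conjI)
    show "filterlim (\<lambda>x. F2 (of_real x)) at_infinity at_top"
      unfolding filterlim_at_infinity[OF order.refl]
    proof (intro allI impI)
      fix r :: real assume "0 < r"
      show "\<forall>\<^sub>F x in at_top. r \<le> cmod (F2 (of_real x))"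
        using ev eventually_ge_at_top[of "4 / 3 * r / c2"]
      proof eventually_elim
        fix x assume a: "x > 0 \<and> cmod (F2 (of_real x) - of_real (c2 * x)) < c2 / 4 * x" "4 / 3 * r / c2 \<le> x"
        have "r \<le> 3 / 4 * c2 * x" using a(2) c2 by (simp add: field_simps)
        also have "\<dots> \<le> Re (F2 (of_real x))" using bnds a by blast
        also have "\<dots> \<le> cmod (F2 (of_real x))" by (rule complex_Re_le_cmod)
        finally show "r \<le> cmod (F2 (of_real x))" .
      qed
    qed
    show "\<forall>\<^sub>F x in at_top. F2 (of_real x) \<in> sector 2"
      using ev
    proof eventually_elim
      fix x assume a: "x > 0 \<and> cmod (F2 (of_real x) - of_real (c2 * x)) < c2 / 4 * x"
      have p: "c2 * x > 0" using a c2 by simp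
      show "F2 (of_real x) \<in> sector 2"
        using bnds[of x] a p by (auto simp: sector_def)
    qed
  qed
  then have "((\<lambda>x. F1 (F2 (of_real x)) / F2 (of_real x)) \<longlongrightarrow> of_real c1) at_top"
    by (rule filterlim_compose[rotated, where g = "\<lambda>z. F1 z / z"]) (use s1 in \<open>auto simp: angular_slope_def\<close>)
  from tendsto_mult[OF this r2]
  have "((\<lambda>x. F1 (F2 (of_real x)) / F2 (of_real x) * (F2 (of_real x) / of_real x)) \<longlongrightarrow> of_real c1 * of_real c2) at_top" .
  moreover have "\<forall>\<^sub>F x in at_top. F1 (F2 (of_real x)) / F2 (of_real x) * (F2 (of_real x) / of_real x)
      = G (of_real x) / of_real x"
    using ev
  proof eventually_elim
    fix x assume a: "x > 0 \<and> cmod (F2 (of_real x) - of_real (c2 * x)) < c2 / 4 * x"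
    have p: "c2 * x > 0" using a c2 by simp
    have "Re (F2 (of_real x)) > 0" using bnds[of x] a p by auto
    then have "F2 (of_real x) \<noteq> 0" by auto
    then show "F1 (F2 (of_real x)) / F2 (of_real x) * (F2 (of_real x) / of_real x)
      = G (of_real x) / of_real x" using G[of "of_real x"] a by simp
  qed
  ultimately have "((\<lambda>x. G (of_real x) / of_real x) \<longlongrightarrow> of_real c1 * of_real c2) at_top"
    by (rule Lim_transform_eventually)
  from tendsto_unique[OF _ this angular_slope_radial[OF s]]
  have "complex_of_real c = of_real (c1 * c2)" by simp
  then show ?thesis by (simp only: of_real_eq_iff)
qed

section \<open>The Julia-Wolff-Caratheodory theorem\<close>

text \<open>For |\<sigma>| = 1 it maps the disc to the right half-plane with \<sigma> going to
  infinity, and its real part is the Poisson kernel, by \<open>Re_cayley\<close>.\<close>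

definition cayley :: "complex \<Rightarrow> complex \<Rightarrow> complex" where
  "cayley \<sigma> z = (\<sigma> + z) / (\<sigma> - z)"

definition inv_cayley :: "complex \<Rightarrow> complex \<Rightarrow> complex" where
  "inv_cayley \<sigma> w = \<sigma> * (w - 1) / (w + 1)"

lemma Re_cayley:
  assumes "cmod \<sigma> = 1"
  shows "Re (cayley \<sigma> z) = poisson \<sigma> z"
proof -
  have "cayley \<sigma> z = ((\<sigma> + z) * cnj (\<sigma> - z)) / of_real ((cmod (\<sigma> - z))\<^sup>2)"
    unfolding cayley_def by (simp add: complex_div_cnj[of _ "\<sigma> - z"])
  then have "Re (cayley \<sigma> z) = Re ((\<sigma> + z) * cnj (\<sigma> - z)) / (cmod (\<sigma> - z))\<^sup>2"
    by (simp only: Re_divide_of_real)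
  also have "Re ((\<sigma> + z) * cnj (\<sigma> - z)) = (cmod \<sigma>)\<^sup>2 - (cmod z)\<^sup>2"
    unfolding cmod_power2 by (simp add: power2_eq_square algebra_simps)
  finally show ?thesis using assms by (simp add: poisson_def)
qed

lemma poisson_pos:
  assumes "cmod \<sigma> = 1" "z \<in> \<DD>"
  shows "poisson \<sigma> z > 0"
proof -
  have "\<sigma> \<noteq> z" using assms by auto
  then show ?thesis using assms by (simp add: poisson_def abs_square_less_1)
qed

lemma cayley_in_RHP: "cmod \<sigma> = 1 \<Longrightarrow> z \<in> \<DD> \<Longrightarrow> cayley \<sigma> z \<in> \<H>"
  using Re_cayley poisson_pos by simp

lemma cayley_plus_1:
  assumes "z \<noteq> \<sigma>"
  shows "cayley \<sigma> z + 1 = 2 * \<sigma> / (\<sigma> - z)"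
  using assms by (simp add: cayley_def field_simps)

lemma inv_cayley_in_disc:
  assumes "cmod \<sigma> = 1" "w \<in> \<H>"
  shows "inv_cayley \<sigma> w \<in> \<DD>"
proof -
  have "(cmod (w + 1))\<^sup>2 - (cmod (w - 1))\<^sup>2 = 4 * Re w"
    unfolding cmod_power2 by (simp add: power2_eq_square algebra_simps)
  then have "(cmod (w - 1))\<^sup>2 < (cmod (w + 1))\<^sup>2" using assms by simp
  then have "cmod (w - 1) < cmod (w + 1)" by (rule power_less_imp_less_base) simp
  moreover have "0 < cmod (w + 1)"
    using calculation norm_ge_zero[of "w - 1"] by linarith
  ultimately show ?thesis using assms by (simp add: inv_cayley_def norm_mult norm_divide)
qed

lemma RHP_plus_1_nonzero: "w \<in> \<H> \<Longrightarrow> w + 1 \<noteq> 0"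
  by (auto simp: complex_eq_iff)

lemma inv_cayley_cayley:
  assumes "\<sigma> \<noteq> 0" "z \<noteq> \<sigma>"
  shows "inv_cayley \<sigma> (cayley \<sigma> z) = z"
proof -
  have "cayley \<sigma> z - 1 = 2 * z / (\<sigma> - z)" using assms by (simp add: cayley_def field_simps)
  then show ?thesis using assms cayley_plus_1[of z \<sigma>] by (simp add: inv_cayley_def)
qed

lemma cayley_inv_cayley:
  assumes "\<sigma> \<noteq> 0" "w + 1 \<noteq> 0"
  shows "cayley \<sigma> (inv_cayley \<sigma> w) = w"
proof -
  have "\<sigma> + inv_cayley \<sigma> w = 2 * \<sigma> * w / (w + 1)" "\<sigma> - inv_cayley \<sigma> w = 2 * \<sigma> / (w + 1)"
    using assms by (simp_all add: inv_cayley_def field_simps)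
  then show ?thesis using assms by (simp add: cayley_def)
qed

lemma cayley_has_field_derivative:
  assumes "\<sigma> \<noteq> 0" "z \<noteq> \<sigma>"
  shows "(cayley \<sigma> has_field_derivative (cayley \<sigma> z + 1)\<^sup>2 / (2 * \<sigma>)) (at z)"
proof -
  have "(cayley \<sigma> has_field_derivative 2 * \<sigma> / (\<sigma> - z)\<^sup>2) (at z)"
    unfolding cayley_def using assms
    by (auto intro!: derivative_eq_intros simp: power2_eq_square field_simps)
  moreover have "2 * \<sigma> / (\<sigma> - z)\<^sup>2 = (cayley \<sigma> z + 1)\<^sup>2 / (2 * \<sigma>)"
    unfolding cayley_plus_1[OF assms(2)] using assms by (simp add: power2_eq_square divide_simps)
  ultimately show ?thesis by simp
qed

lemma inv_cayley_has_field_derivative: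
  assumes "w + 1 \<noteq> 0"
  shows "(inv_cayley \<sigma> has_field_derivative 2 * \<sigma> / (w + 1)\<^sup>2) (at w)"
  unfolding inv_cayley_def using assms
  by (auto intro!: derivative_eq_intros simp: power2_eq_square field_simps)

lemma inv_cayley_holomorphic: "inv_cayley \<sigma> holomorphic_on \<H>"
  unfolding inv_cayley_def using RHP_plus_1_nonzero by (intro holomorphic_intros) auto

definition halfplane_conj :: "complex \<Rightarrow> (complex \<Rightarrow> complex) \<Rightarrow> complex \<Rightarrow> complex" where
  "halfplane_conj \<sigma> f w = cayley \<sigma> (f (inv_cayley \<sigma> w))"

lemma halfplane_conj_holomorphic:
  assumes "f holomorphic_on \<DD>" "f ` \<DD> \<subseteq> \<DD>" "cmod \<sigma> = 1"
  shows "halfplane_conj \<sigma> f holomorphic_on \<H>"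
proof -
  have 1: "inv_cayley \<sigma> ` \<H> \<subseteq> \<DD>" using inv_cayley_in_disc[OF assms(3)] by blast
  have 2: "(\<lambda>w. f (inv_cayley \<sigma> w)) holomorphic_on \<H>"
    by (rule holomorphic_on_compose_gen[OF inv_cayley_holomorphic assms(1) 1, unfolded o_def])
  have "\<sigma> \<noteq> f (inv_cayley \<sigma> w)" if "w \<in> \<H>" for w
    using norm_less_1_of_image[OF assms(2) inv_cayley_in_disc[OF assms(3) that]] assms(3) by auto
  then show ?thesis
    unfolding halfplane_conj_def cayley_def by (intro holomorphic_intros 2) auto
qed

lemma halfplane_conj_in_RHP:
  assumes "f ` \<DD> \<subseteq> \<DD>" "cmod \<sigma> = 1" "w \<in> \<H>"
  shows "halfplane_conj \<sigma> f w \<in> \<H>"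
  using cayley_in_RHP[OF assms(2), of "f (inv_cayley \<sigma> w)"]
    norm_less_1_of_image[OF assms(1) inv_cayley_in_disc[OF assms(2,3)]]
  by (simp add: halfplane_conj_def)

lemma halfplane_conj_cayley:
  assumes "cmod \<sigma> = 1" "z \<in> \<DD>"
  shows "halfplane_conj \<sigma> f (cayley \<sigma> z) = cayley \<sigma> (f z)"
  using inv_cayley_cayley[of \<sigma> z] assms by (force simp: halfplane_conj_def)

lemma filterlim_cayley_stolz:
  assumes s: "cmod \<sigma> = 1" and M: "M > 1"
  shows "filterlim (cayley \<sigma>) (at_infinity_sector (2 * M)) (at \<sigma> within stolz_region \<sigma> M)"
  unfolding filterlim_inf filterlim_principal
proof (intro conjI)
  show "\<forall>\<^sub>F z in at \<sigma> within stolz_region \<sigma> M. cayley \<sigma> z \<in> sector (2 * M)"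
    unfolding eventually_at_topological
  proof (intro exI[of _ UNIV] conjI ballI impI)
    fix z assume "z \<noteq> \<sigma>" and zs: "z \<in> stolz_region \<sigma> M"
    then have z: "z \<in> \<DD>" "cmod (\<sigma> - z) < M * (1 - cmod z)" "cmod z < 1" by (auto simp: stolz_region_def)
    have d: "cmod (\<sigma> - z) > 0" using \<open>z \<noteq> \<sigma>\<close> by simp
    have "cmod (cayley \<sigma> z) = cmod (\<sigma> + z) / cmod (\<sigma> - z)" by (simp add: cayley_def norm_divide)
    also have "\<dots> \<le> 2 / cmod (\<sigma> - z)"
      using norm_triangle_ineq[of \<sigma> z] s z(3) by (intro divide_right_mono) auto
    also have "\<dots> = 2 * cmod (\<sigma> - z) / (cmod (\<sigma> - z))\<^sup>2" using d by (simp add: power2_eq_square)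
    also have "\<dots> \<le> 2 * (M * (1 - (cmod z)\<^sup>2)) / (cmod (\<sigma> - z))\<^sup>2"
    proof -
      have "1 - cmod z \<le> 1 - (cmod z)\<^sup>2" using z(3) by (simp add: power2_eq_square mult_left_le_one_le)
      then have "M * (1 - cmod z) \<le> M * (1 - (cmod z)\<^sup>2)" using M by (intro mult_left_mono) auto
      then show ?thesis using z(2) by (intro divide_right_mono) auto
    qed
    also have "\<dots> = 2 * M * Re (cayley \<sigma> z)" using Re_cayley[OF s, of z] by (simp add: poisson_def)
    finally show "cayley \<sigma> z \<in> sector (2 * M)"
      using cayley_in_RHP[OF s z(1)] by (simp add: sector_def)
  qed auto
  show "filterlim (cayley \<sigma>) at_infinity (at \<sigma> within stolz_region \<sigma> M)"
    unfolding filterlim_at_infinity[OF order.refl]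
  proof (intro allI impI)
    fix r :: real assume r: "0 < r"
    show "\<forall>\<^sub>F z in at \<sigma> within stolz_region \<sigma> M. r \<le> cmod (cayley \<sigma> z)"
      unfolding eventually_at
    proof (intro exI[of _ "2 / (r + 1)"] conjI ballI impI)
      fix z assume "z \<noteq> \<sigma> \<and> dist z \<sigma> < 2 / (r + 1)"
      then have d: "cmod (\<sigma> - z) > 0" "cmod (\<sigma> - z) < 2 / (r + 1)" and ne: "z \<noteq> \<sigma>"
        by (auto simp: dist_norm norm_minus_commute)
      have "r + 1 \<le> 2 / cmod (\<sigma> - z)" using d r by (simp add: field_simps)
      also have "\<dots> = cmod (cayley \<sigma> z + 1)" using s by (simp add: cayley_plus_1[OF ne] norm_divide norm_mult)
      also have "\<dots> \<le> cmod (cayley \<sigma> z) + 1" using norm_triangle_ineq[of "cayley \<sigma> z" 1] by simp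
      finally show "r \<le> cmod (cayley \<sigma> z)" by simp
    qed (use r in auto)
  qed
qed

text \<open>In the half-plane the hypothesis reads Re (F w) \<ge> k Re w, so the angular slope
  \<open>c\<close> of \<open>F\<close> is at least \<open>k\<close> and thus positive. The limits of
  \<open>F w / w\<close> and of \<open>F'\<close> translate back into those of \<open>f\<close> and
  \<open>f'\<close>; the crude \<open>k\<close> is replaced with the sharp \<open>c\<close>.\<close>

lemma Julia_Wolff_Caratheodory:
  assumes holf: "f holomorphic_on \<DD>" and im: "f ` \<DD> \<subseteq> \<DD>" and s: "cmod \<sigma> = 1"
    and k: "k > 0" and Julia: "\<And>z. z \<in> \<DD> \<Longrightarrow> k * poisson \<sigma> z \<le> poisson \<sigma> (f z)"
  obtains c where "k \<le> c" "angular_slope (halfplane_conj \<sigma> f) c"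
    "\<And>z. z \<in> \<DD> \<Longrightarrow> c * poisson \<sigma> z \<le> poisson \<sigma> (f z)"
    "nontangential_limit f \<sigma> \<sigma>" "nontangential_limit (deriv f) \<sigma> (of_real (1 / c))"
proof -
  define F where "F = halfplane_conj \<sigma> f"
  have s0: "\<sigma> \<noteq> 0" using s by auto
  have holF: "F holomorphic_on \<H>" unfolding F_def by (rule halfplane_conj_holomorphic[OF holf im s])
  have FH: "F w \<in> \<H>" if "w \<in> \<H>" for w unfolding F_def by (rule halfplane_conj_in_RHP[OF im s that])
  obtain c where c0: "c \<ge> 0" and sl: "angular_slope F c"
    using angular_slope_exists[OF holF] FH less_imp_le by blast
  have kF: "k * Re w \<le> Re (F w)" if w: "w \<in> \<H>" for w
  proof -
    have "k * poisson \<sigma> (inv_cayley \<sigma> w) \<le> poisson \<sigma> (f (inv_cayley \<sigma> w))"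
      by (rule Julia[OF inv_cayley_in_disc[OF s w]])
    then show ?thesis
      using cayley_inv_cayley[OF s0 RHP_plus_1_nonzero[OF w]]
      by (simp add: F_def halfplane_conj_def flip: Re_cayley[OF s])
  qed
  have kc: "k \<le> c" by (rule angular_slope_ge[OF sl kF])
  have c: "c > 0" using k kc by simp
  have J: "c * poisson \<sigma> z \<le> poisson \<sigma> (f z)" if "z \<in> \<DD>" for z
    using sl cayley_in_RHP[OF s that] halfplane_conj_cayley[OF s that, of f]
    by (auto simp: angular_slope_def F_def simp flip: Re_cayley[OF s])
  have Flim: "((\<lambda>w. (w + 1) / (F w + 1)) \<longlongrightarrow> 1 / of_real c) (at_infinity_sector K)" if K: "K \<ge> 1" for K
  proof -
    have inv: "((\<lambda>w. 1 / w) \<longlongrightarrow> (0::complex)) (at_infinity_sector K)"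
      by (rule tendsto_mono[OF inf_le1]) (rule tendsto_divide_0[OF tendsto_const filterlim_ident])
    have "((\<lambda>w. F w / w) \<longlongrightarrow> of_real c) (at_infinity_sector K)"
      using sl K by (auto simp: angular_slope_def)
    then have "((\<lambda>w. (1 + 1 / w) / (F w / w + 1 / w)) \<longlongrightarrow> (1 + 0) / (of_real c + 0)) (at_infinity_sector K)"
      using c by (intro tendsto_intros inv) auto
    moreover have "\<forall>\<^sub>F w in at_infinity_sector K. (1 + 1 / w) / (F w / w + 1 / w) = (w + 1) / (F w + 1)"
      unfolding eventually_at_infinity_sector
    proof (intro exI ballI impI)
      fix w :: complex assume "w \<in> sector K"
      then have "w \<noteq> 0" by (auto simp: sector_def)
      then have "1 + 1 / w = (w + 1) / w" "F w / w + 1 / w = (F w + 1) / w"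
        by (simp_all add: field_simps)
      then show "(1 + 1 / w) / (F w / w + 1 / w) = (w + 1) / (F w + 1)" using \<open>w \<noteq> 0\<close> by simp
    qed
    ultimately show ?thesis by (simp add: Lim_transform_eventually)
  qed
  have ineq: "z \<noteq> \<sigma>" "f z \<noteq> \<sigma>" if "z \<in> \<DD>" for z
    using that norm_less_1_of_image[OF im that] s by auto
  have evD: "\<forall>\<^sub>F z in at \<sigma> within stolz_region \<sigma> M. z \<in> \<DD>" for M
    unfolding eventually_at_topological by (intro exI[of _ UNIV]) (auto simp: stolz_region_def)
  \<comment> \<open>By \<open>cayley_plus_1\<close> this quotient is
    \<open>(\<sigma> - f z) / (\<sigma> - z)\<close> on the disc. Its limit yields that of
    \<open>f\<close>, and its square is the factor between \<open>F'\<close> and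
    \<open>f'\<close>.\<close>
  have ratio: "((\<lambda>z. (cayley \<sigma> z + 1) / (F (cayley \<sigma> z) + 1)) \<longlongrightarrow> 1 / of_real c)
      (at \<sigma> within stolz_region \<sigma> M)" if M: "M > 1" for M
    by (rule filterlim_compose[OF Flim filterlim_cayley_stolz[OF s M]]) (use M in simp)
  have lim1: "nontangential_limit f \<sigma> \<sigma>"
    unfolding nontangential_limit_def
  proof (intro allI impI)
    fix M :: real assume M: "M > 1"
    have "((\<lambda>z. \<sigma> - (\<sigma> - z) * ((cayley \<sigma> z + 1) / (F (cayley \<sigma> z) + 1))) \<longlongrightarrow> \<sigma> - (\<sigma> - \<sigma>) * (1 / of_real c))
        (at \<sigma> within stolz_region \<sigma> M)"
      by (intro tendsto_intros ratio M)
    moreover have "\<forall>\<^sub>F z in at \<sigma> within stolz_region \<sigma> M.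
        \<sigma> - (\<sigma> - z) * ((cayley \<sigma> z + 1) / (F (cayley \<sigma> z) + 1)) = f z"
      using evD
    proof eventually_elim
      fix z assume z: "z \<in> \<DD>"
      show "\<sigma> - (\<sigma> - z) * ((cayley \<sigma> z + 1) / (F (cayley \<sigma> z) + 1)) = f z"
        using ineq[OF z] s0 halfplane_conj_cayley[OF s z, of f]
        by (simp add: F_def cayley_plus_1)
    qed
    ultimately show "(f \<longlongrightarrow> \<sigma>) (at \<sigma> within stolz_region \<sigma> M)"
      by (simp add: Lim_transform_eventually)
  qed
  have lim2: "nontangential_limit (deriv f) \<sigma> (of_real (1 / c))"
    unfolding nontangential_limit_def
  proof (intro allI impI)
    fix M :: real assume M: "M > 1"
    have "((\<lambda>z. deriv F (cayley \<sigma> z)) \<longlongrightarrow> of_real c) (at \<sigma> within stolz_region \<sigma> M)"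
      by (rule filterlim_compose[OF _ filterlim_cayley_stolz[OF s M]]) (use sl M in \<open>auto simp: angular_slope_def\<close>)
    then have "((\<lambda>z. deriv F (cayley \<sigma> z) * ((cayley \<sigma> z + 1) / (F (cayley \<sigma> z) + 1))\<^sup>2) \<longlongrightarrow> of_real c * (1 / of_real c)\<^sup>2)
        (at \<sigma> within stolz_region \<sigma> M)"
      by (intro tendsto_intros ratio M)
    moreover have "\<forall>\<^sub>F z in at \<sigma> within stolz_region \<sigma> M.
        deriv F (cayley \<sigma> z) * ((cayley \<sigma> z + 1) / (F (cayley \<sigma> z) + 1))\<^sup>2 = deriv f z"
      using evD
    proof eventually_elim
      fix z assume z: "z \<in> \<DD>"
      let ?w = "cayley \<sigma> z"
      have wH: "?w \<in> \<H>" by (rule cayley_in_RHP[OF s z])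
      have ne: "F ?w + 1 \<noteq> 0" by (rule RHP_plus_1_nonzero[OF FH[OF wH]])
      have d1: "(F has_field_derivative deriv F ?w) (at ?w)"
        by (rule holomorphic_derivI[OF holF open_RHP wH])
      have d2: "((\<lambda>z. F (cayley \<sigma> z)) has_field_derivative deriv F ?w * ((?w + 1)\<^sup>2 / (2 * \<sigma>))) (at z)"
        by (rule DERIV_chain2[OF d1 cayley_has_field_derivative[OF s0 ineq(1)[OF z]]])
      have d3: "((\<lambda>z. inv_cayley \<sigma> (F (cayley \<sigma> z))) has_field_derivative
          2 * \<sigma> / (F ?w + 1)\<^sup>2 * (deriv F ?w * ((?w + 1)\<^sup>2 / (2 * \<sigma>)))) (at z)"
        by (rule DERIV_chain2[OF inv_cayley_has_field_derivative[OF ne] d2])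
      have d4: "(f has_field_derivative 2 * \<sigma> / (F ?w + 1)\<^sup>2 * (deriv F ?w * ((?w + 1)\<^sup>2 / (2 * \<sigma>)))) (at z)"
      proof (rule has_field_derivative_transform_within_open[OF d3 open_ball z])
        fix x assume x: "x \<in> \<DD>"
        show "inv_cayley \<sigma> (F (cayley \<sigma> x)) = f x"
          using inv_cayley_cayley[OF s0 ineq(2)[OF x]] halfplane_conj_cayley[OF s x, of f] by (simp add: F_def)
      qed
      then show "deriv F ?w * ((?w + 1) / (F ?w + 1))\<^sup>2 = deriv f z"
        using s0 by (simp add: DERIV_imp_deriv power_divide)
    qed
    ultimately have "(deriv f \<longlongrightarrow> of_real c * (1 / of_real c)\<^sup>2) (at \<sigma> within stolz_region \<sigma> M)"
      by (rule Lim_transform_eventually)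
    then show "(deriv f \<longlongrightarrow> of_real (1 / c)) (at \<sigma> within stolz_region \<sigma> M)"
      using c by (simp add: power2_eq_square)
  qed
  show ?thesis by (rule that[OF kc _ J lim1 lim2]) (use sl in \<open>simp_all add: F_def\<close>)
qed

lemma filterlim_radial_stolz:
  assumes s: "cmod \<sigma> = 1" and M: "M > 1"
  shows "filterlim (\<lambda>x. of_real x * \<sigma>) (at \<sigma> within stolz_region \<sigma> M) (at_left (1::real))"
  unfolding filterlim_at
proof
  have "((\<lambda>x. of_real x * \<sigma>) \<longlongrightarrow> of_real 1 * \<sigma>) (at_left (1::real))"
    by (intro tendsto_intros)
  then show "((\<lambda>x. of_real x * \<sigma>) \<longlongrightarrow> \<sigma>) (at_left (1::real))" by simp
  have "\<forall>\<^sub>F x in at_left 1. x \<in> {0<..<1::real}"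
    by (rule eventually_at_leftI[of 0]) auto
  then show "\<forall>\<^sub>F x in at_left 1. of_real x * \<sigma> \<in> stolz_region \<sigma> M \<and> of_real x * \<sigma> \<noteq> \<sigma>"
  proof eventually_elim
    fix x :: real assume x: "x \<in> {0<..<1}"
    have "\<sigma> - of_real x * \<sigma> = of_real (1 - x) * \<sigma>" by (simp add: algebra_simps)
    then have "cmod (\<sigma> - of_real x * \<sigma>) = 1 - x" using x s by (simp add: norm_mult del: of_real_diff)
    moreover have "1 - x < M * (1 - x)" using x M by simp
    ultimately show "of_real x * \<sigma> \<in> stolz_region \<sigma> M \<and> of_real x * \<sigma> \<noteq> \<sigma>"
      using x s by (auto simp: stolz_region_def norm_mult)
  qed
qed

lemma nontangential_limit_radial:
  assumes "cmod \<sigma> = 1" "nontangential_limit f \<sigma> l"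
  shows "((\<lambda>x. f (of_real x * \<sigma>)) \<longlongrightarrow> l) (at_left (1::real))"
  using filterlim_compose[OF _ filterlim_radial_stolz[OF assms(1), of 2], of f] assms(2)
  by (simp add: nontangential_limit_def)

lemma nontangential_limit_unique:
  assumes "cmod \<sigma> = 1" "nontangential_limit f \<sigma> l" "nontangential_limit f \<sigma> m"
  shows "l = m"
  using tendsto_unique[OF _ nontangential_limit_radial[OF assms(1,2)] nontangential_limit_radial[OF assms(1,3)]]
  by simp

text \<open>The bounded derivative makes \<open>f\<close> Lipschitz near the end of the radius with
  the crude constant \<open>\<alpha> + 1\<close>, which feeds \<open>Julia_inequality\<close>.
  \<open>Julia_Wolff_Caratheodory\<close> sharpens the result, and uniqueness of angular limits
  identifies the sharp constant with \<alpha>.\<close>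

lemma Julia_from_angular_derivative:
  assumes holf: "f holomorphic_on \<DD>" and im: "f ` \<DD> \<subseteq> \<DD>" and s: "cmod \<sigma> = 1"
    and l1: "nontangential_limit f \<sigma> \<sigma>" and l2: "nontangential_limit (deriv f) \<sigma> (of_real \<alpha>)"
    and \<alpha>: "\<alpha> > 0" and z: "z \<in> \<DD>"
  shows "poisson \<sigma> z \<le> \<alpha> * poisson \<sigma> (f z)"
proof -
  note r1 = nontangential_limit_radial[OF s l1] and r2 = nontangential_limit_radial[OF s l2]
  define B where "B = \<alpha> + 1"
  have B: "B > 0" using \<alpha> by (simp add: B_def)
  have "\<forall>\<^sub>F x in at_left (1::real). dist (deriv f (of_real x * \<sigma>)) (of_real \<alpha>) < 1"
    using tendstoD[OF r2, of 1] by simp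
  then obtain b where b: "b < 1" and bd: "\<And>x. b < x \<Longrightarrow> x < 1 \<Longrightarrow> dist (deriv f (of_real x * \<sigma>)) (of_real \<alpha>) < 1"
    using eventually_at_left[of 0 "1::real"] by auto
  define b0 where "b0 = max b 0"
  have Lip: "cmod (f (of_real y * \<sigma>) - f (of_real x * \<sigma>)) \<le> B * (y - x)" if xy: "b0 < x" "x < y" "y < 1" for x y
  proof -
    have "norm (f (of_real y * \<sigma>) - f (of_real x * \<sigma>)) \<le> B * norm (of_real y * \<sigma> - of_real x * \<sigma>)"
    proof (rule field_differentiable_bound[of "closed_segment (of_real x * \<sigma>) (of_real y * \<sigma>)" f "deriv f"])
      fix u assume "u \<in> closed_segment (of_real x * \<sigma>) (of_real y * \<sigma>)"
      then obtain t where t: "0 \<le> t" "t \<le> 1" "u = (1 - t) *\<^sub>R (of_real x * \<sigma>) + t *\<^sub>R (of_real y * \<sigma>)"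
        by (auto simp: closed_segment_def)
      define v where "v = (1 - t) * x + t * y"
      have u: "u = of_real v * \<sigma>" by (simp add: t v_def scaleR_conv_of_real algebra_simps)
      have v: "v = x + t * (y - x)" by (simp add: v_def algebra_simps)
      have "t * (y - x) \<le> 1 * (y - x)" using t xy by (intro mult_right_mono) auto
      moreover have "0 \<le> t * (y - x)" using t xy by simp
      ultimately have "x \<le> v" "v \<le> y" unfolding v by simp_all
      then have v1: "b0 < v" "v < 1" using xy by auto
      have uD: "u \<in> \<DD>" using v1 s by (simp add: u norm_mult b0_def)
      show "(f has_field_derivative deriv f u) (at u within closed_segment (of_real x * \<sigma>) (of_real y * \<sigma>))"
        by (rule has_field_derivative_at_within[OF holomorphic_derivI[OF holf open_ball uD]])
      have "dist (deriv f u) (of_real \<alpha>) < 1" unfolding u using v1 by (intro bd) (auto simp: b0_def)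
      then show "norm (deriv f u) \<le> B"
        using norm_triangle_ineq[of "deriv f u - of_real \<alpha>" "of_real \<alpha>"] \<alpha> by (simp add: B_def dist_norm)
    qed auto
    also have "norm (of_real y * \<sigma> - of_real x * \<sigma>) = y - x"
    proof -
      have "of_real y * \<sigma> - of_real x * \<sigma> = of_real (y - x) * \<sigma>" by (simp add: algebra_simps)
      then show ?thesis using s xy by (simp add: norm_mult del: of_real_diff)
    qed
    finally show ?thesis .
  qed
  have bnd: "1 - (cmod (f (of_real x * \<sigma>)))\<^sup>2 \<le> 2 * B * (1 - (cmod (of_real x * \<sigma>))\<^sup>2)" if x: "b0 < x" "x < 1" for x
  proof -
    have "((\<lambda>y. cmod (f (of_real y * \<sigma>) - f (of_real x * \<sigma>))) \<longlongrightarrow> cmod (\<sigma> - f (of_real x * \<sigma>))) (at_left (1::real))"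
      by (intro tendsto_intros r1)
    moreover have "((\<lambda>y. B * (y - x)) \<longlongrightarrow> B * (1 - x)) (at_left (1::real))"
      by (intro tendsto_intros)
    moreover have "\<forall>\<^sub>F y in at_left (1::real). cmod (f (of_real y * \<sigma>) - f (of_real x * \<sigma>)) \<le> B * (y - x)"
      using x by (intro eventually_at_leftI[of x]) (auto intro: Lip)
    ultimately have le: "cmod (\<sigma> - f (of_real x * \<sigma>)) \<le> B * (1 - x)"
      using tendsto_le trivial_limit_at_left_real by blast
    have xD: "of_real x * \<sigma> \<in> \<DD>" using x s by (simp add: norm_mult b0_def)
    have f1: "cmod (f (of_real x * \<sigma>)) < 1" by (rule norm_less_1_of_image[OF im xD])
    have "1 - (cmod (f (of_real x * \<sigma>)))\<^sup>2 = (1 + cmod (f (of_real x * \<sigma>))) * (1 - cmod (f (of_real x * \<sigma>)))"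
      by (simp add: power2_eq_square algebra_simps)
    also have "\<dots> \<le> 2 * (B * (1 - x))"
    proof (rule mult_mono)
      show "1 - cmod (f (of_real x * \<sigma>)) \<le> B * (1 - x)"
        using le norm_triangle_ineq2[of \<sigma> "f (of_real x * \<sigma>)"] s by linarith
    qed (use f1 in auto)
    also have "\<dots> \<le> 2 * (B * (1 - x\<^sup>2))"
    proof -
      have "x\<^sup>2 \<le> x" using x by (simp add: power2_eq_square b0_def mult_left_le_one_le)
      then show ?thesis using B by (intro mult_left_mono) auto
    qed
    also have "\<dots> = 2 * B * (1 - (cmod (of_real x * \<sigma>))\<^sup>2)" using s by (simp add: norm_mult)
    finally show ?thesis .
  qed
  \<comment> \<open>Radii tending to 1; the shift by 2 keeps even \<open>xs 0\<close> strictly above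
    \<open>b0\<close>.\<close>
  define xs where "xs = (\<lambda>n. 1 - (1 - b0) / (real n + 2))"
  have xs: "b0 < xs n" "xs n < 1" for n
  proof -
    have "1 - b0 > 0" using b by (simp add: b0_def)
    then have "(1 - b0) / (real n + 2) < 1 - b0" "(1 - b0) / (real n + 2) > 0"
      by (auto simp: divide_simps)
    then show "b0 < xs n" "xs n < 1" by (auto simp: xs_def)
  qed
  have "xs \<longlonglongrightarrow> 1"
    unfolding xs_def by real_asymp
  then have xlim: "filterlim xs (at_left 1) sequentially"
    using xs by (auto simp: filterlim_at less_imp_neq)
  have J: "poisson \<sigma> x \<le> 2 * B * poisson \<sigma> (f x)" if "x \<in> \<DD>" for x
  proof (rule Julia_inequality[OF holf im s _ _ _ _ that])
    show "of_real (xs n) * \<sigma> \<in> \<DD>" for n using xs[of n] s by (simp add: norm_mult b0_def)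
    show "(\<lambda>n. of_real (xs n) * \<sigma>) \<longlonglongrightarrow> \<sigma>"
      using tendsto_mult[OF tendsto_of_real[OF \<open>xs \<longlonglongrightarrow> 1\<close>] tendsto_const, of \<sigma>] by simp
    show "(\<lambda>n. f (of_real (xs n) * \<sigma>)) \<longlonglongrightarrow> \<sigma>"
      by (rule filterlim_compose[OF r1 xlim])
    show "\<exists>\<^sub>F n in sequentially. 1 - (cmod (f (of_real (xs n) * \<sigma>)))\<^sup>2 \<le> 2 * B * (1 - (cmod (of_real (xs n) * \<sigma>))\<^sup>2)"
      using bnd xs by (intro eventually_frequently) auto
  qed
  obtain c where c: "1 / (2 * B) \<le> c" "\<And>z. z \<in> \<DD> \<Longrightarrow> c * poisson \<sigma> z \<le> poisson \<sigma> (f z)"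
    "nontangential_limit (deriv f) \<sigma> (of_real (1 / c))"
    using J B by (rule_tac Julia_Wolff_Caratheodory[OF holf im s, of "1 / (2 * B)"]) (auto simp: field_simps)
  have "\<alpha> = 1 / c" using nontangential_limit_unique[OF s l2 c(3)] by (simp only: of_real_eq_iff)
  moreover have "c > 0" using c(1) B by (smt (verit) divide_pos_pos)
  ultimately show ?thesis using mult_left_mono[OF c(2)[OF z], of \<alpha>] by simp
qed

section \<open>Petals and vertical strips\<close>

lemma open_connected_real_cases:
  fixes J :: "real set"
  assumes op: "open J" and con: "connected J" and ne: "J \<noteq> {}"
  obtains "J = UNIV" | a where "J = {a<..}" | b where "J = {..<b}" | a b where "a < b" "J = {a<..<b}"
proof -
  have conv: "z \<in> J" if "x \<in> J" "y \<in> J" "x \<le> z" "z \<le> y" for x y z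
    using connected_contains_Icc[OF con that(1,2)] that by auto
  have less: "\<exists>y\<in>J. y < x" and gr: "\<exists>y\<in>J. x < y" if x: "x \<in> J" for x
  proof -
    obtain e where e: "e > 0" "ball x e \<subseteq> J" using op x by (meson open_contains_ball)
    have "x - e / 2 \<in> J" "x + e / 2 \<in> J" using e by (auto simp: dist_real_def intro!: subsetD[OF e(2)])
    then show "\<exists>y\<in>J. y < x" "\<exists>y\<in>J. x < y"
      using e(1) by (auto intro: bexI[of _ "x - e / 2"] bexI[of _ "x + e / 2"])
  qed
  have inf: "Inf J < x" if "bdd_below J" "x \<in> J" for x
    using less[OF that(2)] cInf_lower[OF _ that(1)] by fastforce
  have sup: "x < Sup J" if "bdd_above J" "x \<in> J" for x
    using gr[OF that(2)] cSup_upper[OF _ that(1)] by fastforce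
  have lo: "\<exists>y\<in>J. y < x" if "bdd_below J \<Longrightarrow> Inf J < x" for x
  proof (cases "bdd_below J")
    case True then show ?thesis using that ne by (simp add: cInf_less_iff)
  next
    case False then show ?thesis unfolding bdd_below_def by (meson not_le)
  qed
  have hi: "\<exists>y\<in>J. x < y" if "bdd_above J \<Longrightarrow> x < Sup J" for x
  proof (cases "bdd_above J")
    case True then show ?thesis using that ne by (simp add: less_cSup_iff)
  next
    case False then show ?thesis unfolding bdd_above_def by (meson not_le)
  qed
  have J: "x \<in> J \<longleftrightarrow> (bdd_below J \<longrightarrow> Inf J < x) \<and> (bdd_above J \<longrightarrow> x < Sup J)" for x
    using inf sup lo[of x] hi[of x] conv less_imp_le by metis
  show ?thesis
  proof (cases "bdd_below J"; cases "bdd_above J")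
    assume b: "bdd_below J" "bdd_above J"
    obtain x where "x \<in> J" using ne by blast
    then have "Inf J < Sup J" using inf[of x] sup[of x] b by linarith
    moreover have "J = {Inf J<..<Sup J}" using J b by (intro set_eqI) simp
    ultimately show ?thesis by (rule that(4))
  next
    assume b: "bdd_below J" "\<not> bdd_above J"
    have "J = {Inf J<..}" using J b by (intro set_eqI) simp
    then show ?thesis by (rule that(2))
  next
    assume b: "\<not> bdd_below J" "bdd_above J"
    have "J = {..<Sup J}" using J b by (intro set_eqI) simp
    then show ?thesis by (rule that(3))
  next
    assume b: "\<not> bdd_below J" "\<not> bdd_above J"
    have "J = UNIV" using J b by (intro set_eqI) simp
    then show ?thesis by (rule that(1))
  qed
qed

lemma right_ray_component_iff:
  fixes S :: "real set"
  shows "{a<..} \<in> components S \<longleftrightarrow> {a<..} \<subseteq> S \<and> a \<notin> S"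
proof (intro iffI conjI)
  assume C: "{a<..} \<in> components S"
  then show sub: "{a<..} \<subseteq> S" by (rule in_components_subset)
  show "a \<notin> S"
  proof
    assume "a \<in> S"
    then have "{a..} \<subseteq> S" using sub by (auto simp: le_less)
    then have "{a..} \<subseteq> {a<..}"
      by (intro components_maximal[OF C]) (auto simp: disjoint_iff intro: exI[of _ "a + 1"])
    then show False by auto
  qed
next
  assume *: "{a<..} \<subseteq> S \<and> a \<notin> S"
  show "{a<..} \<in> components S"
    unfolding in_components_maximal
  proof (intro conjI allI impI)
    fix D assume D: "D \<noteq> {} \<and> {a<..} \<subseteq> D \<and> D \<subseteq> S \<and> connected D"
    have "a < d" if d: "d \<in> D" for d
    proof (rule ccontr)
      assume "\<not> a < d"
      moreover have "a + 1 \<in> D" using D unfolding subset_iff by simp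
      then have "{d..a + 1} \<subseteq> D" using connected_contains_Icc D d by blast
      ultimately have "a \<in> D" by auto
      then show False using * D by blast
    qed
    then show "D = {a<..}" using D by blast
  qed (use * in auto)
qed

lemma left_ray_component_iff:
  fixes S :: "real set"
  shows "{..<a} \<in> components S \<longleftrightarrow> {..<a} \<subseteq> S \<and> a \<notin> S"
proof (intro iffI conjI)
  assume C: "{..<a} \<in> components S"
  then show sub: "{..<a} \<subseteq> S" by (rule in_components_subset)
  show "a \<notin> S"
  proof
    assume "a \<in> S"
    then have "{..a} \<subseteq> S" using sub by (auto simp: le_less)
    then have "{..a} \<subseteq> {..<a}"
      by (intro components_maximal[OF C]) (auto simp: disjoint_iff intro: exI[of _ "a - 1"])
    then show False by auto
  qed
next
  assume *: "{..<a} \<subseteq> S \<and> a \<notin> S"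
  show "{..<a} \<in> components S"
    unfolding in_components_maximal
  proof (intro conjI allI impI)
    fix D assume D: "D \<noteq> {} \<and> {..<a} \<subseteq> D \<and> D \<subseteq> S \<and> connected D"
    have "d < a" if d: "d \<in> D" for d
    proof (rule ccontr)
      assume "\<not> d < a"
      moreover have "a - 1 \<in> D" using D unfolding subset_iff by simp
      then have "{a - 1..d} \<subseteq> D" using connected_contains_Icc D d by blast
      ultimately have "a \<in> D" by auto
      then show False using * D by blast
    qed
    then show "D = {..<a}" using D by blast
  qed (use * in auto)
qed

section \<open>The vertical flow on the image of the Koenigs map\<close>

locale koenigs_model =
  fixes \<phi> :: "real \<Rightarrow> complex \<Rightarrow> complex" and h :: "complex \<Rightarrow> complex"
  assumes semigroup: "holomorphic_semigroup \<phi>"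
    and h_holomorphic: "h holomorphic_on \<DD>"
    and h_inj: "inj_on h \<DD>"
    and h_shift: "\<And>t z. t \<ge> 0 \<Longrightarrow> z \<in> \<DD> \<Longrightarrow> h (\<phi> t z) = h z + \<i> * of_real t"
begin

definition U :: "complex set" where "U = h ` \<DD>"

definition g :: "complex \<Rightarrow> complex" where "g = the_inv_into \<DD> h"

lemma phi_holomorphic: "t \<ge> 0 \<Longrightarrow> \<phi> t holomorphic_on \<DD>"
  and phi_image: "t \<ge> 0 \<Longrightarrow> \<phi> t ` \<DD> \<subseteq> \<DD>"
  using semigroup by (auto simp: holomorphic_semigroup_def)

lemma phi_in_disc: "t \<ge> 0 \<Longrightarrow> z \<in> \<DD> \<Longrightarrow> \<phi> t z \<in> \<DD>"
  using phi_image by blast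

lemma phi_add: "t \<ge> 0 \<Longrightarrow> s \<ge> 0 \<Longrightarrow> z \<in> \<DD> \<Longrightarrow> \<phi> (t + s) z = \<phi> t (\<phi> s z)"
  using semigroup by (auto simp: holomorphic_semigroup_def)

lemma phi_0: "z \<in> \<DD> \<Longrightarrow> \<phi> 0 z = z"
  using semigroup by (auto simp: holomorphic_semigroup_def)

lemma open_U: "open U"
  unfolding U_def by (rule open_mapping_thm3[OF h_holomorphic open_ball h_inj])

lemma h_in_U: "z \<in> \<DD> \<Longrightarrow> h z \<in> U"
  by (simp add: U_def)

lemma g_h: "z \<in> \<DD> \<Longrightarrow> g (h z) = z"
  unfolding g_def by (rule the_inv_into_f_f[OF h_inj])

lemma h_g: "w \<in> U \<Longrightarrow> h (g w) = w"
  unfolding g_def U_def by (rule f_the_inv_into_f[OF h_inj])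

lemma g_in_disc: "w \<in> U \<Longrightarrow> g w \<in> \<DD>"
  using g_h unfolding U_def by (metis imageE)

lemma g_image: "g ` U \<subseteq> \<DD>"
  using g_in_disc by blast

lemma g_holomorphic: "g holomorphic_on U"
proof -
  obtain k where "k holomorphic_on h ` \<DD>" "\<And>z. z \<in> \<DD> \<Longrightarrow> k (h z) = z"
    by (rule holomorphic_has_inverse[OF h_holomorphic open_ball h_inj]) blast
  then show ?thesis
    by (auto simp: U_def g_h intro: holomorphic_transform)
qed

lemma U_shift:
  assumes "w \<in> U" "t \<ge> 0"
  shows "w + \<i> * of_real t \<in> U"
  using h_in_U[OF phi_in_disc[OF assms(2) g_in_disc[OF assms(1)]]]
    h_shift[OF assms(2) g_in_disc[OF assms(1)]] h_g[OF assms(1)] by simp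

lemma phi_g:
  assumes "w \<in> U" "t \<ge> 0"
  shows "\<phi> t (g w) = g (w + \<i> * of_real t)"
  using g_h[OF phi_in_disc[OF assms(2) g_in_disc[OF assms(1)]]]
    h_shift[OF assms(2) g_in_disc[OF assms(1)]] h_g[OF assms(1)] by simp

text \<open>By Liouville, the bounded inverse \<open>g\<close> would be constant. This is what
  excludes the whole real line in \<open>component_cases\<close>.\<close>

lemma U_ne_UNIV: "U \<noteq> UNIV"
proof
  assume U: "U = UNIV"
  have "bounded (range g)"
    using bounded_subset[OF bounded_ball] g_image unfolding U by blast
  then have "g constant_on UNIV"
    using Liouville_theorem g_holomorphic unfolding U by blast
  then have "g (h 0) = g (h (1 / 2))" by (auto simp: constant_on_def)
  then show False by (simp add: g_h)
qed

definition full_lines :: "real set" where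
  "full_lines = {x. \<forall>y. Complex x y \<in> U}"

lemma full_lines_iff: "J \<subseteq> full_lines \<longleftrightarrow> {w. Re w \<in> J} \<subseteq> U"
proof
  assume J: "J \<subseteq> full_lines"
  show "{w. Re w \<in> J} \<subseteq> U"
  proof
    fix w assume "w \<in> {w. Re w \<in> J}"
    then have "Complex (Re w) (Im w) \<in> U" using J unfolding full_lines_def by blast
    then show "w \<in> U" by simp
  qed
next
  assume "{w. Re w \<in> J} \<subseteq> U"
  then show "J \<subseteq> full_lines" by (auto simp: full_lines_def)
qed

lemma full_lines_ne_UNIV: "full_lines \<noteq> UNIV"
  using full_lines_iff[of UNIV] U_ne_UNIV by auto

section \<open>Points with infinite backward orbits, and petals as preimages of strips\<close>

definition core :: "complex set" where
  "core = (\<Inter>t\<in>{0..}. \<phi> t ` \<DD>)"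

text \<open>A point lies in the image of \<open>\<phi> t\<close> when
  \<open>h z - \<i> * of_real t\<close> is in \<open>U\<close>; the upward translates are in
  \<open>U\<close> anyway, by \<open>U_shift\<close>.\<close>

lemma core_iff:
  "z \<in> core \<longleftrightarrow> z \<in> \<DD> \<and> Re (h z) \<in> full_lines"
proof
  assume z: "z \<in> core"
  then have zt: "z \<in> \<phi> t ` \<DD>" if "t \<ge> 0" for t using that by (simp add: core_def)
  have zD: "z \<in> \<DD>" using zt[of 0] phi_image[of 0] by blast
  have down: "h z - \<i> * of_real t \<in> U" if t: "t \<ge> 0" for t
  proof -
    obtain x where "x \<in> \<DD>" "z = \<phi> t x" using zt[OF t] by blast
    then show ?thesis using h_shift[OF t] h_in_U by simp
  qed
  have "Complex (Re (h z)) y \<in> U" for y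
  proof (cases "y \<ge> Im (h z)")
    case True
    have "Complex (Re (h z)) y = h z + \<i> * of_real (y - Im (h z))" by (simp add: complex_eq_iff)
    then show ?thesis using U_shift[OF h_in_U[OF zD], of "y - Im (h z)"] True by simp
  next
    case False
    have "Complex (Re (h z)) y = h z - \<i> * of_real (Im (h z) - y)" by (simp add: complex_eq_iff)
    then show ?thesis using down[of "Im (h z) - y"] False by simp
  qed
  then show "z \<in> \<DD> \<and> Re (h z) \<in> full_lines" using zD by (simp add: full_lines_def)
next
  assume z: "z \<in> \<DD> \<and> Re (h z) \<in> full_lines"
  show "z \<in> core"
    unfolding core_def
  proof
    fix t :: real assume "t \<in> {0..}"
    then have t: "t \<ge> 0" by simp
    have "h z - \<i> * of_real t = Complex (Re (h z)) (Im (h z) - t)" by (simp add: complex_eq_iff)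
    then have w: "h z - \<i> * of_real t \<in> U" using z by (simp add: full_lines_def)
    have "\<phi> t (g (h z - \<i> * of_real t)) = z"
      using phi_g[OF w t] g_h z by simp
    then show "z \<in> \<phi> t ` \<DD>" using g_in_disc[OF w] by force
  qed
qed

lemma open_Re_h_vimage:
  assumes "open J"
  shows "open {z \<in> \<DD>. Re (h z) \<in> J}"
proof -
  have "continuous_on \<DD> (\<lambda>z. Re (h z))"
    by (intro continuous_intros holomorphic_on_imp_continuous_on h_holomorphic)
  then have "open ((\<lambda>z. Re (h z)) -` J \<inter> \<DD>)"
    using assms open_ball by (metis continuous_on_open_vimage)
  then show ?thesis by (simp add: vimage_def Int_def conj_commute)
qed

text \<open>This is not formal, since \<open>full_lines\<close> is a set of reals and
  \<open>core\<close> is planar: openness of \<open>h\<close> gives a disc about \<open>h z\<close>,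
  and its horizontal diameter gives the interval.\<close>

lemma interior_core_iff:
  "z \<in> interior core \<longleftrightarrow> z \<in> \<DD> \<and> Re (h z) \<in> interior full_lines"
proof
  assume "z \<in> \<DD> \<and> Re (h z) \<in> interior full_lines"
  then have "z \<in> {z \<in> \<DD>. Re (h z) \<in> interior full_lines}" by simp
  moreover have "{z \<in> \<DD>. Re (h z) \<in> interior full_lines} \<subseteq> core"
    using core_iff interior_subset[of full_lines] by blast
  ultimately show "z \<in> interior core"
    using interiorI[OF open_Re_h_vimage[OF open_interior]] by blast
next
  assume z: "z \<in> interior core"
  then have zW: "z \<in> core" using interior_subset by blast
  then have zD: "z \<in> \<DD>" using core_iff by blast
  have sub: "interior core \<subseteq> \<DD>" using interior_subset[of core] core_iff by blast
  have "open (h ` interior core)"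
    by (rule open_mapping_thm3[OF holomorphic_on_subset[OF h_holomorphic sub] open_interior inj_on_subset[OF h_inj sub]])
  then obtain e where e: "e > 0" "ball (h z) e \<subseteq> h ` interior core"
    using z by (meson imageI open_contains_ball)
  have "ball (Re (h z)) e \<subseteq> full_lines"
  proof
    fix x assume x: "x \<in> ball (Re (h z)) e"
    have "h z - Complex x (Im (h z)) = of_real (Re (h z) - x)" by (simp add: complex_eq_iff)
    then have "dist (h z) (Complex x (Im (h z))) = dist (Re (h z)) x"
      by (simp add: dist_norm del: of_real_diff)
    then have "Complex x (Im (h z)) \<in> ball (h z) e" using x by simp
    then obtain y where "y \<in> interior core" "h y = Complex x (Im (h z))" using e by force
    then show "x \<in> full_lines" using core_iff[of y] interior_subset[of core] by auto
  qed
  then show "z \<in> \<DD> \<and> Re (h z) \<in> interior full_lines"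
    using zD e by (meson centre_in_ball interiorI open_ball)
qed

text \<open>A strip over an interval is convex, so its image under \<open>g\<close> is connected;
  conversely the projection of a component by \<open>Re (h z)\<close> is connected, hence stays in
  one component of the line.\<close>

lemma component_core:
  assumes z0: "z0 \<in> interior core"
  shows "connected_component_set (interior core) z0
       = {z \<in> \<DD>. Re (h z) \<in> connected_component_set (interior full_lines) (Re (h z0))}"
    (is "?C = ?T")
proof
  let ?J = "connected_component_set (interior full_lines) (Re (h z0))"
  have J: "?J \<subseteq> interior full_lines" by (rule connected_component_subset)
  then have strip: "{w. Re w \<in> ?J} \<subseteq> U"
    using full_lines_iff interior_subset by (meson subset_trans)
  have "?T = g ` {w. Re w \<in> ?J}"
  proof (intro equalityI subsetI)
    fix z assume "z \<in> ?T"
    then show "z \<in> g ` {w. Re w \<in> ?J}" using g_h by (intro image_eqI[of _ _ "h z"]) auto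
  next
    fix z assume "z \<in> g ` {w. Re w \<in> ?J}"
    then obtain w where w: "Re w \<in> ?J" "z = g w" by blast
    then have "w \<in> U" using strip by blast
    then show "z \<in> ?T" using w g_in_disc h_g by simp
  qed
  moreover have "connected {w. Re w \<in> ?J}"
  proof -
    have "convex ?J"
      using connected_connected_component is_interval_convex_1 is_interval_connected_1 by blast
    then have "convex (Re -` ?J)" by (intro convex_linear_vimage) (auto intro: linearI)
    then show ?thesis by (simp add: convex_connected vimage_def)
  qed
  ultimately have conT: "connected ?T"
    using connected_continuous_image holomorphic_on_imp_continuous_on[OF holomorphic_on_subset[OF g_holomorphic strip]]
    by metis
  have z0': "z0 \<in> \<DD>" "Re (h z0) \<in> interior full_lines" using z0 interior_core_iff by auto
  show "?T \<subseteq> ?C"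
  proof (rule connected_component_maximal[OF _ conT])
    show "z0 \<in> ?T" using z0' by simp
    show "?T \<subseteq> interior core" using J interior_core_iff by blast
  qed
  have C: "?C \<subseteq> interior core" by (rule connected_component_subset)
  then have CD: "?C \<subseteq> \<DD>" using interior_core_iff by blast
  have "(\<lambda>z. Re (h z)) ` ?C \<subseteq> ?J"
  proof (rule connected_component_maximal)
    show "Re (h z0) \<in> (\<lambda>z. Re (h z)) ` ?C" using z0 by simp
    show "connected ((\<lambda>z. Re (h z)) ` ?C)"
      by (intro connected_continuous_image continuous_intros connected_connected_component
          holomorphic_on_imp_continuous_on holomorphic_on_subset[OF h_holomorphic CD])
    show "(\<lambda>z. Re (h z)) ` ?C \<subseteq> interior full_lines" using C interior_core_iff by blast
  qed
  then show "?C \<subseteq> ?T" using CD by blast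
qed

lemma petal_iff:
  "petal \<phi> \<Delta> \<longleftrightarrow> (\<exists>J\<in>components (interior full_lines). \<Delta> = {z \<in> \<DD>. Re (h z) \<in> J})"
proof
  assume "petal \<phi> \<Delta>"
  then obtain z0 where z0: "z0 \<in> interior core"
    "\<Delta> = connected_component_set (interior core) z0"
    unfolding petal_def core_def[symmetric] components_iff by blast
  moreover have "Re (h z0) \<in> interior full_lines" using z0 interior_core_iff by blast
  ultimately show "\<exists>J\<in>components (interior full_lines). \<Delta> = {z \<in> \<DD>. Re (h z) \<in> J}"
    using component_core[OF z0(1)] by (auto intro!: bexI[OF _ componentsI])
next
  assume "\<exists>J\<in>components (interior full_lines). \<Delta> = {z \<in> \<DD>. Re (h z) \<in> J}"
  then obtain x where x: "x \<in> interior full_lines"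
    and \<Delta>: "\<Delta> = {z \<in> \<DD>. Re (h z) \<in> connected_component_set (interior full_lines) x}"
    by (auto simp: components_iff)
  have "x \<in> full_lines" using x interior_subset by blast
  then have w: "Complex x 0 \<in> U" by (simp add: full_lines_def)
  have z0: "g (Complex x 0) \<in> interior core"
    using interior_core_iff g_in_disc[OF w] h_g[OF w] x by simp
  show "petal \<phi> \<Delta>"
    unfolding petal_def core_def[symmetric] components_iff
    using component_core[OF z0] z0 \<Delta> h_g[OF w] by (intro exI[of _ "g (Complex x 0)"]) simp
qed

section \<open>Maximal half-planes as unbounded components\<close>

lemma strip_subset_U_iff:
  assumes "open J"
  shows "{w. Re w \<in> J} \<subseteq> U \<longleftrightarrow> J \<subseteq> interior full_lines"
  using full_lines_iff[of J] assms interior_maximal[of J full_lines] interior_subset[of full_lines] by blast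

text \<open>A half-plane in \<open>U\<close> can be enlarged exactly when its endpoint is interior
  to \<open>full_lines\<close>, which is the criterion in
  \<open>right_ray_component_iff\<close>.\<close>

lemma right_half_plane_maximal_iff:
  "{w. Re w > a} \<subseteq> U \<and> (\<forall>b<a. \<not> {w. Re w > b} \<subseteq> U) \<longleftrightarrow> {a<..} \<in> components (interior full_lines)"
proof -
  have iff: "{w. Re w > b} \<subseteq> U \<longleftrightarrow> {b<..} \<subseteq> interior full_lines" for b
    using strip_subset_U_iff[of "{b<..}"] by simp
  have "\<exists>b<a. {b<..} \<subseteq> interior full_lines" if a: "{a<..} \<subseteq> interior full_lines" "a \<in> interior full_lines"
  proof -
    obtain e where e: "e > 0" "ball a e \<subseteq> interior full_lines"
      using a(2) open_interior by (meson open_contains_ball)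
    have "x \<in> interior full_lines" if "x > a - e" for x
      using a(1) e(2) that by (cases "x > a") (auto simp: dist_real_def)
    then show ?thesis using e(1) by (intro exI[of _ "a - e"]) auto
  qed
  then show ?thesis
    unfolding iff right_ray_component_iff by blast
qed

lemma left_half_plane_maximal_iff:
  "{w. Re w < a} \<subseteq> U \<and> (\<forall>b>a. \<not> {w. Re w < b} \<subseteq> U) \<longleftrightarrow> {..<a} \<in> components (interior full_lines)"
proof -
  have iff: "{w. Re w < b} \<subseteq> U \<longleftrightarrow> {..<b} \<subseteq> interior full_lines" for b
    using strip_subset_U_iff[of "{..<b}"] by simp
  have "\<exists>b>a. {..<b} \<subseteq> interior full_lines" if a: "{..<a} \<subseteq> interior full_lines" "a \<in> interior full_lines"
  proof -
    obtain e where e: "e > 0" "ball a e \<subseteq> interior full_lines"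
      using a(2) open_interior by (meson open_contains_ball)
    have "x \<in> interior full_lines" if "x < a + e" for x
      using a(1) e(2) that by (cases "x < a") (auto simp: dist_real_def)
    then show ?thesis using e(1) by (intro exI[of _ "a + e"]) auto
  qed
  then show ?thesis
    unfolding iff left_ray_component_iff by blast
qed

lemma component_cases:
  assumes "J \<in> components (interior full_lines)"
  obtains a where "J = {a<..}" | b where "J = {..<b}" | a b where "a < b" "J = {a<..<b}"
proof -
  have "open J" "connected J" "J \<noteq> {}" "J \<subseteq> full_lines"
    using assms in_components_nonempty in_components_connected in_components_subset interior_subset
      open_components[OF open_interior] by (blast+)
  then show ?thesis
    using open_connected_real_cases[of J thesis] that full_lines_ne_UNIV by blast
qed

end

section \<open>Strips of finite width\<close>

text \<open>Cauchy's functional equation on a half-line. Nonnegativity gives monotonicity, and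
  squeezing \<open>n * s\<close> between consecutive integers bounds the defect by
  \<open>f 1 / n\<close>.\<close>

lemma additive_nonneg_imp_linear:
  fixes f :: "real \<Rightarrow> real"
  assumes add: "\<And>s t. s \<ge> 0 \<Longrightarrow> t \<ge> 0 \<Longrightarrow> f (s + t) = f s + f t"
    and nonneg: "\<And>s. s \<ge> 0 \<Longrightarrow> f s \<ge> 0" and s: "s \<ge> 0"
  shows "f s = s * f 1"
proof -
  have f0: "f 0 = 0" using add[of 0 0] by simp
  have mult: "f (real n * x) = real n * f x" if "x \<ge> 0" for n x
    using that by (induction n) (auto simp: f0 add distrib_right)
  have mono: "f x \<le> f y" if "0 \<le> x" "x \<le> y" for x y
    using add[of x "y - x"] nonneg[of "y - x"] that by simp
  have bnd: "\<bar>f s - s * f 1\<bar> * real n \<le> f 1" for n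
  proof -
    define m where "m = nat \<lfloor>real n * s\<rfloor>"
    have "real m = of_int \<lfloor>real n * s\<rfloor>" using s by (simp add: m_def)
    then have m: "real m \<le> real n * s" "real n * s \<le> real m + 1" by linarith+
    have "real m * f 1 \<le> real n * f s"
      using mono[of "real m" "real n * s"] mult[of 1 m] mult[of s n] m s by simp
    moreover have "real n * f s \<le> (real m + 1) * f 1"
      using mono[of "real n * s" "real (Suc m)"] mult[of 1 "Suc m"] mult[of s n] m s by (simp add: add.commute)
    moreover have "real m * f 1 \<le> real n * s * f 1" "real n * s * f 1 \<le> (real m + 1) * f 1"
      using m nonneg[of 1] by (auto intro!: mult_right_mono)
    ultimately have "\<bar>real n * f s - real n * s * f 1\<bar> \<le> f 1"
      by (simp add: abs_le_iff algebra_simps)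
    moreover have "\<bar>real n * f s - real n * s * f 1\<bar> = \<bar>f s - s * f 1\<bar> * real n"
    proof -
      have "real n * f s - real n * s * f 1 = (f s - s * f 1) * real n" by (simp add: algebra_simps)
      then show ?thesis by (simp only: abs_mult abs_of_nat)
    qed
    ultimately show ?thesis by simp
  qed
  show ?thesis
  proof (rule ccontr)
    assume "\<not> ?thesis"
    then have "\<bar>f s - s * f 1\<bar> > 0" by simp
    then obtain n where "f 1 < real n * \<bar>f s - s * f 1\<bar>" using reals_Archimedean3 by blast
    then show False using bnd[of n] by (simp add: mult.commute)
  qed
qed

context koenigs_model
begin

section \<open>Decay of \<open>g\<close> down a channel of bounded width\<close>

lemma missing_ray_below:
  assumes "x \<notin> full_lines"
  obtains y1 where "\<And>y. y \<le> y1 \<Longrightarrow> Complex x y \<notin> U"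
proof -
  obtain y1 where y1: "Complex x y1 \<notin> U" using assms by (auto simp: full_lines_def)
  have "Complex x y \<notin> U" if "y \<le> y1" for y
  proof
    assume "Complex x y \<in> U"
    then have "Complex x y + \<i> * of_real (y1 - y) \<in> U" by (rule U_shift) (use that in simp)
    moreover have "Complex x y + \<i> * of_real (y1 - y) = Complex x y1" by (simp add: complex_eq_iff)
    ultimately show False using y1 by simp
  qed
  then show ?thesis by (rule that)
qed

text \<open>Otherwise the component could be enlarged. Missing lines are found only arbitrarily
  close to the edges: an edge line may itself lie in \<open>U\<close>, because components are taken
  in the interior of \<open>full_lines\<close>.\<close>

lemma near_strip_not_full:
  assumes C: "{a<..<b} \<in> components (interior full_lines)" and ab: "a < b" and e: "e > 0"
  shows "\<exists>x. a - e < x \<and> x \<le> a \<and> x \<notin> full_lines" "\<exists>x. b \<le> x \<and> x < b + e \<and> x \<notin> full_lines"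
proof -
  have sub: "{a<..<b} \<subseteq> full_lines" using in_components_subset[OF C] interior_subset by blast
  show "\<exists>x. a - e < x \<and> x \<le> a \<and> x \<notin> full_lines"
  proof (rule ccontr)
    assume *: "\<not> ?thesis"
    have "{a - e<..<b} \<subseteq> full_lines"
    proof
      fix x assume "x \<in> {a - e<..<b}"
      then show "x \<in> full_lines" using * sub by (cases "x \<le> a") auto
    qed
    then have "{a - e<..<b} \<subseteq> interior full_lines" by (simp add: interior_maximal)
    moreover have "(a + b) / 2 \<in> {a<..<b} \<inter> {a - e<..<b}" using ab e by auto
    ultimately have "{a - e<..<b} \<subseteq> {a<..<b}"
      by (intro components_maximal[OF C]) auto
    moreover have "a \<in> {a - e<..<b}" using ab e by simp
    ultimately have "a \<in> {a<..<b}" by blast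
    then show False by simp
  qed
  show "\<exists>x. b \<le> x \<and> x < b + e \<and> x \<notin> full_lines"
  proof (rule ccontr)
    assume *: "\<not> ?thesis"
    have "{a<..<b + e} \<subseteq> full_lines"
    proof
      fix x assume "x \<in> {a<..<b + e}"
      then show "x \<in> full_lines" using * sub by (cases "b \<le> x") auto
    qed
    then have "{a<..<b + e} \<subseteq> interior full_lines" by (simp add: interior_maximal)
    moreover have "(a + b) / 2 \<in> {a<..<b} \<inter> {a<..<b + e}" using ab e by auto
    ultimately have "{a<..<b + e} \<subseteq> {a<..<b}"
      by (intro components_maximal[OF C]) auto
    moreover have "b \<in> {a<..<b + e}" using ab e by simp
    ultimately have "b \<in> {a<..<b}" by blast
    then show False by simp
  qed
qed

text \<open>A Phragmen-Lindelof estimate for -ln |g|, harmonic where \<open>g\<close> has no zero,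
  against \<open>B * exp (\<kappa> * Im w) * cos (\<kappa> * (Re w - m))\<close>. As \<kappa> times
  the width is below pi, the cosine is at least \<open>c0 > 0\<close> up to the walls. The walls are
  missing rays, so the compact sets used below do not meet them.\<close>

lemma channel_decay:
  assumes x12: "x1 < x2" and k: "\<kappa> > 0" "\<kappa> * (x2 - x1) < pi"
    and ray1: "\<And>y. y \<le> y1 \<Longrightarrow> Complex x1 y \<notin> U" and ray2: "\<And>y. y \<le> y1 \<Longrightarrow> Complex x2 y \<notin> U"
  obtains C y0 where "C > 0"
    "\<And>w. w \<in> U \<Longrightarrow> Im w \<le> y0 \<Longrightarrow> x1 < Re w \<Longrightarrow> Re w < x2 \<Longrightarrow> 1 - cmod (g w) \<le> C * exp (\<kappa> * Im w)"
proof -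
  \<comment> \<open>Staying below \<open>Im (h 0)\<close> keeps \<open>g w\<close> at distance
    \<open>r0\<close> from 0, so that dividing by \<open>g\<close> is harmless.\<close>
  define y0 where "y0 = min y1 (Im (h 0) - 1)"
  have cont: "continuous_on \<DD> (\<lambda>z. Im (h z))"
    by (intro continuous_intros holomorphic_on_imp_continuous_on h_holomorphic)
  have "open ((\<lambda>z. Im (h z)) -` {y0<..} \<inter> \<DD>)"
    using cont open_ball open_greaterThan by (metis continuous_on_open_vimage)
  moreover have "0 \<in> (\<lambda>z. Im (h z)) -` {y0<..} \<inter> \<DD>" by (simp add: y0_def)
  ultimately obtain r0 where r0: "r0 > 0" "ball 0 r0 \<subseteq> (\<lambda>z. Im (h z)) -` {y0<..} \<inter> \<DD>"
    by (meson open_contains_ball)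
  have "r0 \<le> 1"
  proof (rule ccontr)
    assume "\<not> r0 \<le> 1"
    then have "(1::complex) \<in> ball 0 r0" by simp
    then have "(1::complex) \<in> \<DD>" using r0(2) by blast
    then show False by simp
  qed
  have gr0: "r0 \<le> cmod (g w)" if "w \<in> U" "Im w \<le> y0" for w
  proof (rule ccontr)
    assume "\<not> r0 \<le> cmod (g w)"
    then have "g w \<in> ball 0 r0" by simp
    then have "Im (h (g w)) > y0" using r0(2) by auto
    then show False using h_g[OF that(1)] that(2) by simp
  qed
  define M where "M = - ln r0"
  have M: "M \<ge> 0" "exp (- M) = r0" using r0(1) \<open>r0 \<le> 1\<close> by (auto simp: M_def)
  define m where "m = (x1 + x2) / 2"
  define c0 where "c0 = cos (\<kappa> * ((x2 - x1) / 2))"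
  have c0: "c0 > 0"
    unfolding c0_def using k x12 by (intro cos_gt_zero_pi) (auto intro: less_le_trans[of _ 0])
  have cosge: "c0 \<le> cos (\<kappa> * (x - m))" if "x1 \<le> x" "x \<le> x2" for x
  proof -
    have "\<bar>x - m\<bar> \<le> (x2 - x1) / 2" using that by (auto simp: m_def abs_le_iff field_simps)
    then have "\<kappa> * \<bar>x - m\<bar> \<le> \<kappa> * ((x2 - x1) / 2)" using k by (intro mult_left_mono) auto
    then have le: "\<bar>\<kappa> * (x - m)\<bar> \<le> \<kappa> * ((x2 - x1) / 2)" using k by (simp add: abs_mult)
    have "c0 \<le> cos \<bar>\<kappa> * (x - m)\<bar>"
      unfolding c0_def using k le by (intro cos_monotone_0_pi_le) auto
    then show ?thesis by simp
  qed
  \<comment> \<open>Chosen so that \<open>B * exp (\<kappa> * y0) * c0 = M\<close>: on the top edge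
    the comparison function then dominates \<open>M\<close>, the bound for -ln |g| that
    \<open>gr0\<close> provides.\<close>
  define B where "B = M * exp (- \<kappa> * y0) / c0"
  have B: "B \<ge> 0" using M c0 by (simp add: B_def)
  have main: "1 - cmod (g w) \<le> B * exp (\<kappa> * Im w)"
    if w: "w \<in> U" "Im w \<le> y0" "x1 < Re w" "Re w < x2" for w
  proof -
    have gw: "cmod (g w) < 1" using g_in_disc[OF w(1)] by simp
    have gw0: "cmod (g w) > 0" using gr0[OF w(1,2)] r0(1) by linarith
    have est: "1 / cmod (g w) \<le> exp (B * exp (\<kappa> * Im w) * cos (\<kappa> * (Re w - m))
          + \<eta> * (exp (- \<kappa> * Im w) * cos (\<kappa> * (Re w - m)))) / r"
      if \<eta>: "\<eta> > 0" and r: "cmod (g w) < r" "r < 1" for \<eta> r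
    proof -
      define E where "E = (\<lambda>v. of_real B * exp (- \<i> * of_real \<kappa> * (v - of_real m))
                        + of_real \<eta> * exp (\<i> * of_real \<kappa> * (v - of_real m)))"
      have ReE: "Re (E v) = B * exp (\<kappa> * Im v) * cos (\<kappa> * (Re v - m))
          + \<eta> * (exp (- \<kappa> * Im v) * cos (\<kappa> * (Re v - m)))" for v
        by (simp add: E_def Re_exp)
      \<comment> \<open>The second summand of \<open>E\<close> makes \<open>f\<close> small on the bottom edge \<open>Im v = -N\<close>.\<close>
      define N where "N = max (1 - Im w) (ln (M / (\<eta> * c0) + 1) / \<kappa>)"
      have Nw: "- N < Im w" by (simp add: N_def)
      have NM: "M \<le> \<eta> * exp (\<kappa> * N) * c0"
      proof -
        have p: "M / (\<eta> * c0) + 1 > 0" using M \<eta> c0 by (intro add_nonneg_pos) auto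
        have "ln (M / (\<eta> * c0) + 1) / \<kappa> \<le> N" by (simp add: N_def)
        then have "ln (M / (\<eta> * c0) + 1) \<le> \<kappa> * N" using k by (simp add: pos_divide_le_eq mult.commute)
        then have "M / (\<eta> * c0) + 1 \<le> exp (\<kappa> * N)" using p by (metis exp_le_cancel_iff exp_ln)
        then have "M / (\<eta> * c0) \<le> exp (\<kappa> * N)" by simp
        then show ?thesis using \<eta> c0 by (simp add: pos_divide_le_eq algebra_simps)
      qed
      have r1: "0 < r" using r gw0 by linarith
      \<comment> \<open>The cut |g| \<le> r makes the region compact. As it misses the walls, a
        frontier point has |g| = r or lies on the top or bottom edge.\<close>
      define K where "K = h ` cball 0 r \<inter> {v. - N \<le> Im v \<and> Im v \<le> y0 \<and> x1 \<le> Re v \<and> Re v \<le> x2}"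
      have sub: "cball 0 r \<subseteq> \<DD>" using r by auto
      have KU: "v \<in> U" "cmod (g v) \<le> r" if vK: "v \<in> K" for v
      proof -
        obtain z where "z \<in> cball 0 r" and z2: "v = h z" using vK unfolding K_def by blast
        then have z: "cmod z \<le> r" "v = h z" by auto
        have "z \<in> \<DD>" using z(1) r by simp
        then show "v \<in> U" "cmod (g v) \<le> r" using h_in_U g_h z by auto
      qed
      have Kb: "- N \<le> Im v" "Im v \<le> y0" "x1 < Re v" "Re v < x2" if "v \<in> K" for v
      proof -
        have v: "- N \<le> Im v" "Im v \<le> y0" "x1 \<le> Re v" "Re v \<le> x2" using that by (auto simp: K_def)
        have "Im v \<le> y1" using v(2) by (simp add: y0_def)
        then have "Re v \<noteq> x1" "Re v \<noteq> x2" using ray1[of "Im v"] ray2[of "Im v"] KU(1)[OF that] by auto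
        with v show "- N \<le> Im v" "Im v \<le> y0" "x1 < Re v" "Re v < x2" by auto
      qed
      have Kin: "v \<in> K" if "v \<in> U" "cmod (g v) \<le> r" "- N \<le> Im v" "Im v \<le> y0" "x1 \<le> Re v" "Re v \<le> x2" for v
        using that h_g[OF that(1)] unfolding K_def by (auto intro!: image_eqI[of _ h "g v"])
      have compK: "compact K"
        unfolding K_def
      proof (rule compact_Int_closed)
        show "compact (h ` cball 0 r)"
          using holomorphic_on_imp_continuous_on[OF holomorphic_on_subset[OF h_holomorphic sub]]
          by (rule compact_continuous_image) simp
        have "{v. - N \<le> Im v \<and> Im v \<le> y0 \<and> x1 \<le> Re v \<and> Re v \<le> x2}
          = {v. - N \<le> Im v} \<inter> {v. Im v \<le> y0} \<inter> {v. x1 \<le> Re v} \<inter> {v. Re v \<le> x2}" by blast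
        then show "closed {v. - N \<le> Im v \<and> Im v \<le> y0 \<and> x1 \<le> Re v \<and> Re v \<le> x2}"
          by (simp add: closed_Int closed_halfspace_Im_ge closed_halfspace_Im_le
              closed_halfspace_Re_ge[of x1, unfolded] closed_halfspace_Re_le)
      qed
      define f where "f = (\<lambda>v. exp (- E v) / g v)"
      have holf: "f holomorphic_on K"
        unfolding f_def E_def
        using KU(1) gr0 Kb(2) r0(1)
        by (intro holomorphic_intros holomorphic_on_subset[OF g_holomorphic]) fastforce+
      have nf: "cmod (f v) = exp (- Re (E v)) / cmod (g v)" for v
        by (simp add: f_def norm_divide)
      have "cmod (f w) \<le> 1 / r"
      proof (rule maximum_modulus_frontier[of f K])
        show "f holomorphic_on interior K"
          using holf interior_subset by (rule holomorphic_on_subset)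
        show "continuous_on (closure K) f"
          using compK holf by (simp add: compact_imp_closed holomorphic_on_imp_continuous_on)
        show "bounded K" by (rule compact_imp_bounded[OF compK])
        show "w \<in> K" using Kin w r Nw by simp
        fix v assume "v \<in> frontier K"
        then have vK: "v \<in> K" and nint: "v \<notin> interior K"
          using compK by (auto simp: frontier_def compact_imp_closed)
        note b = Kb[OF vK] and u = KU[OF vK]
        have cp: "c0 \<le> cos (\<kappa> * (Re v - m))" using cosge b by simp
        have t1: "0 \<le> B * exp (\<kappa> * Im v) * cos (\<kappa> * (Re v - m))" using B cp c0 by simp
        have t2: "0 \<le> \<eta> * (exp (- \<kappa> * Im v) * cos (\<kappa> * (Re v - m)))" using \<eta> cp c0 by simp
        consider "cmod (g v) = r" | "Im v = - N" | "Im v = y0"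
        proof (rule ccontr)
          assume "\<not> thesis"
          note n = this
          define Z where "Z = g -` ball 0 r \<inter> U"
          define W where "W = {v. - N < Im v} \<inter> {v. Im v < y0} \<inter> {v. x1 < Re v} \<inter> {v. Re v < x2} \<inter> Z"
          have "open Z"
            unfolding Z_def using holomorphic_on_imp_continuous_on[OF g_holomorphic] open_U open_ball
            by (metis continuous_on_open_vimage)
          then have "open W"
            unfolding W_def
            by (intro open_Int open_halfspace_Im_gt open_halfspace_Im_lt open_halfspace_Re_gt open_halfspace_Re_lt)
          moreover have "v \<in> W" using n that b u unfolding W_def Z_def by (auto simp: less_le)
          moreover have "W \<subseteq> K" using Kin by (auto simp: W_def Z_def)
          ultimately show False using nint interiorI by blast
        qed
        then show "cmod (f v) \<le> 1 / r"
        proof cases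
          case 1
          have "exp (- Re (E v)) \<le> 1" using t1 t2 by (simp add: ReE)
          then show ?thesis unfolding nf 1 using r1 by (simp add: divide_right_mono)
        next
          case 2
          have "M \<le> \<eta> * exp (\<kappa> * N) * c0" by (rule NM)
          also have "\<dots> \<le> \<eta> * exp (\<kappa> * N) * cos (\<kappa> * (Re v - m))" using cp \<eta> by (intro mult_left_mono) auto
          finally have "M \<le> Re (E v)" using t1 by (simp add: ReE 2 mult.assoc)
          then have "exp (- Re (E v)) \<le> r0" using M(2) by (metis exp_le_cancel_iff neg_le_iff_le)
          then have "exp (- Re (E v)) \<le> cmod (g v)" using gr0[OF u(1) b(2)] by linarith
          then have "cmod (f v) \<le> 1" unfolding nf by (rule divide_le_eq_1[THEN iffD2, OF disjI1, OF conjI, rotated]) (use gr0[OF u(1) b(2)] r0(1) in linarith)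
          also have "1 \<le> 1 / r" using r r1 by simp
          finally show ?thesis .
        next
          case 3
          have "M = B * exp (\<kappa> * y0) * c0" using c0 by (simp add: B_def exp_minus field_simps)
          also have "\<dots> \<le> B * exp (\<kappa> * y0) * cos (\<kappa> * (Re v - m))" using cp B by (intro mult_left_mono) auto
          finally have "M \<le> Re (E v)" using t2 by (simp add: ReE 3)
          then have "exp (- Re (E v)) \<le> r0" using M(2) by (metis exp_le_cancel_iff neg_le_iff_le)
          then have "exp (- Re (E v)) \<le> cmod (g v)" using gr0[OF u(1) b(2)] by linarith
          then have "cmod (f v) \<le> 1" unfolding nf by (rule divide_le_eq_1[THEN iffD2, OF disjI1, OF conjI, rotated]) (use gr0[OF u(1) b(2)] r0(1) in linarith)
          also have "1 \<le> 1 / r" using r r1 by simp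
          finally show ?thesis .
        qed
      qed
      then have "exp (- Re (E w)) / cmod (g w) \<le> 1 / r" by (simp add: nf)
      then have "1 / cmod (g w) \<le> exp (Re (E w)) / r"
        using gw0 r1 by (simp add: exp_minus field_simps)
      then show ?thesis by (simp only: ReE)
    qed
    define q where "q = exp (- \<kappa> * Im w) * cos (\<kappa> * (Re w - m))"
    define B' where "B' = B * exp (\<kappa> * Im w) * cos (\<kappa> * (Re w - m))"
    define d where "d = 1 - cmod (g w)"
    have d: "0 < d" "d < 1" using gw gw0 by (auto simp: d_def)
    \<comment> \<open>Both parameters pass to the limit together: \<eta> = 1/(n+1) tends to 0 and r
      = 1 - d/(n+2) to 1. The shift by 2 keeps r strictly above |g w| = 1 - d when n = 0.\<close>
    have "1 / cmod (g w) \<le> exp B'"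
    proof (rule LIMSEQ_le_const)
      show "(\<lambda>n. exp (B' + 1 / (real n + 1) * q) / (1 - d / (real n + 2))) \<longlonglongrightarrow> exp B'"
        by real_asymp
      have "1 / cmod (g w) \<le> exp (B' + 1 / (real n + 1) * q) / (1 - d / (real n + 2))" for n
        unfolding B'_def q_def
      proof (rule est)
        have "d / (real n + 2) < d" using d by (simp add: divide_less_eq)
        then show "cmod (g w) < 1 - d / (real n + 2)" by (simp add: d_def)
        show "1 - d / (real n + 2) < 1" using d by simp
      qed simp
      then show "\<exists>N. \<forall>n\<ge>N. 1 / cmod (g w) \<le> exp (B' + 1 / (real n + 1) * q) / (1 - d / (real n + 2))"
        by blast
    qed
    then have "exp (- B') \<le> cmod (g w)" using gw0 by (simp add: exp_minus field_simps)
    moreover have "1 - B' \<le> exp (- B')" using exp_ge_add_one_self[of "- B'"] by simp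
    ultimately have "1 - cmod (g w) \<le> B'" by linarith
    also have "\<dots> \<le> B * exp (\<kappa> * Im w) * 1" unfolding B'_def using B by (intro mult_left_mono) auto
    finally show ?thesis by simp
  qed
  show ?thesis
  proof (rule that[of "B + 1" y0])
    fix w assume w: "w \<in> U" "Im w \<le> y0" "x1 < Re w" "Re w < x2"
    have "1 - cmod (g w) \<le> B * exp (\<kappa> * Im w)" by (rule main[OF w])
    also have "\<dots> \<le> (B + 1) * exp (\<kappa> * Im w)" by (intro mult_right_mono) auto
    finally show "1 - cmod (g w) \<le> (B + 1) * exp (\<kappa> * Im w)" .
  qed (use B in simp)
qed

text \<open>\<open>angular_slope_compose\<close> makes \<open>c\<close> multiplicative, so -ln c is
  additive; \<open>le1\<close> makes it nonnegative, and this takes the place of a continuity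
  argument in showing that it is linear.\<close>

lemma semigroup_boundary_dilation:
  assumes s: "cmod \<sigma> = 1"
    and slope: "\<And>t. t \<ge> 0 \<Longrightarrow> 0 < c t \<and> angular_slope (halfplane_conj \<sigma> (\<phi> t)) (c t)"
    and le1: "\<And>t. t \<ge> 0 \<Longrightarrow> c t \<le> 1" and t: "t \<ge> 0"
  shows "c t = exp (t * ln (c 1))"
proof -
  have mult: "c (s + t) = c s * c t" if st: "s \<ge> 0" "t \<ge> 0" for s t
  proof (rule angular_slope_compose)
    show "angular_slope (halfplane_conj \<sigma> (\<phi> s)) (c s)" "angular_slope (halfplane_conj \<sigma> (\<phi> t)) (c t)"
      "angular_slope (halfplane_conj \<sigma> (\<phi> (s + t))) (c (s + t))" "0 < c t"
      using slope st by auto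
    fix w assume w: "w \<in> \<H>"
    have z: "inv_cayley \<sigma> w \<in> \<DD>" by (rule inv_cayley_in_disc[OF s w])
    show "halfplane_conj \<sigma> (\<phi> (s + t)) w = halfplane_conj \<sigma> (\<phi> s) (halfplane_conj \<sigma> (\<phi> t) w)"
      using halfplane_conj_cayley[OF s phi_in_disc[OF st(2) z], of "\<phi> s"] phi_add[OF st z]
      by (simp add: halfplane_conj_def)
  qed
  have "- ln (c t) = t * (- ln (c 1))"
  proof (rule additive_nonneg_imp_linear[OF _ _ t])
    show "- ln (c (s + t)) = - ln (c s) + - ln (c t)" if "s \<ge> 0" "t \<ge> 0" for s t
      using mult[OF that] slope[OF that(1)] slope[OF that(2)] by (simp add: ln_mult)
    show "0 \<le> - ln (c s)" if "s \<ge> 0" for s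
      using le1[OF that] slope[OF that] by (simp add: ln_le_zero_iff)
  qed
  then show ?thesis using slope[OF t] by (metis exp_ln mult_minus_right neg_equal_iff_equal)
qed

section \<open>From the decay of \<open>g\<close> to a repelling fixed point\<close>

theorem strip_petal_is_hyperbolic:
  assumes C: "{a<..<b} \<in> components (interior full_lines)" and ab: "a < b"
  shows "\<exists>\<sigma>\<in>frontier {z \<in> \<DD>. Re (h z) \<in> {a<..<b}}. repelling_fixed_point \<phi> \<sigma>"
proof -
  define R where "R = b - a"
  have R: "R > 0" using ab by (simp add: R_def)
  \<comment> \<open>Two demands meet: \<open>\<kappa> * (6 / 5 * R) = 3\<close>, below pi, for
    \<open>channel_decay\<close>; and \<open>2 * \<kappa> - 4 / R = 1 / R\<close>, positive, for the
    growth of the Poisson kernel along \<gamma>.\<close>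
  define \<kappa> where "\<kappa> = 5 / (2 * R)"
  have kp: "\<kappa> > 0" using R by (simp add: \<kappa>_def)
  have strip: "w \<in> U" if "a < Re w" "Re w < b" for w
    using full_lines_iff[of "{a<..<b}"] in_components_subset[OF C] interior_subset that by force
  obtain x1 where x1: "a - R / 10 < x1" "x1 \<le> a" "x1 \<notin> full_lines"
    using near_strip_not_full(1)[OF C ab, of "R / 10"] R by auto
  obtain x2 where x2: "b \<le> x2" "x2 < b + R / 10" "x2 \<notin> full_lines"
    using near_strip_not_full(2)[OF C ab, of "R / 10"] R by auto
  obtain u1 where u1: "\<And>y. y \<le> u1 \<Longrightarrow> Complex x1 y \<notin> U" using missing_ray_below[OF x1(3)] by blast
  obtain u2 where u2: "\<And>y. y \<le> u2 \<Longrightarrow> Complex x2 y \<notin> U" using missing_ray_below[OF x2(3)] by blast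
  have "x2 - x1 < 6 / 5 * R" using x1 x2 R_def by linarith
  then have "\<kappa> * (x2 - x1) < \<kappa> * (6 / 5 * R)" using kp by (rule mult_strict_left_mono)
  also have "\<dots> = 3" using R by (simp add: \<kappa>_def)
  finally have kpi: "\<kappa> * (x2 - x1) < pi" using pi_gt3 by linarith
  have x12: "x1 < x2" using x1 x2 ab by linarith
  obtain C0 y0 where C0: "C0 > 0"
    and decay: "\<And>w. w \<in> U \<Longrightarrow> Im w \<le> y0 \<Longrightarrow> x1 < Re w \<Longrightarrow> Re w < x2 \<Longrightarrow> 1 - cmod (g w) \<le> C0 * exp (\<kappa> * Im w)"
    by (rule channel_decay[OF x12 kp kpi, of "min u1 u2"]) (use u1 u2 in auto)
  define p where "p = (\<lambda>t. Complex ((a + b) / 2) (y0 - t))"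
  define \<gamma> where "\<gamma> = (\<lambda>t. g (p t))"
  have pball: "ball (p t) (R / 2) \<subseteq> U" for t
  proof
    fix w assume "w \<in> ball (p t) (R / 2)"
    then have "\<bar>Re (w - p t)\<bar> < R / 2"
      using abs_Re_le_cmod[of "w - p t"] by (simp add: dist_norm norm_minus_commute)
    then show "w \<in> U" by (intro strip) (auto simp: p_def R_def abs_less_iff field_simps)
  qed
  have pU: "p t \<in> U" for t using pball[of t] R by auto
  have \<gamma>D: "\<gamma> t \<in> \<DD>" for t using g_in_disc[OF pU] by (simp add: \<gamma>_def)
  have p_up: "p (t + s) + \<i> * of_real s = p t" for t s by (simp add: p_def complex_eq_iff)
  have backward: "\<phi> s (\<gamma> (t + s)) = \<gamma> t" if "s \<ge> 0" for s t
    using phi_g[OF pU that] p_up by (simp add: \<gamma>_def)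
  \<comment> \<open>Normalised so that \<open>speed\<close> has the constant \<open>C1\<close>:
    there 1 - |\<gamma>| is doubled, to bound 1 - |\<gamma>|^2, and divided by the radius
    \<open>R / 2\<close>.\<close>
  define C1 where "C1 = 4 * C0 * exp (\<kappa> * y0) / R"
  have C1: "C1 > 0" using C0 R by (simp add: C1_def)
  have depth: "1 - cmod (\<gamma> t) \<le> C1 * R / 4 * exp (- \<kappa> * t)" if "t \<ge> 0" for t
  proof -
    have "1 - cmod (\<gamma> t) \<le> C0 * exp (\<kappa> * Im (p t))"
      unfolding \<gamma>_def using x1 x2 ab that by (intro decay pU) (auto simp: p_def)
    also have "exp (\<kappa> * Im (p t)) = exp (\<kappa> * y0) * exp (- \<kappa> * t)"
      by (simp add: p_def right_diff_distrib flip: exp_add)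
    finally show ?thesis using R by (simp add: C1_def)
  qed
  have speed: "cmod (deriv g (p t)) \<le> C1 * exp (- \<kappa> * t)" if t: "t \<ge> 0" for t
  proof -
    have "cmod (deriv g (p t)) \<le> (1 - (cmod (g (p t)))\<^sup>2) / (R / 2)"
      using pball[of t] g_image R
      by (intro Schwarz_Pick_deriv_ball holomorphic_on_subset[OF g_holomorphic]) auto
    also have "1 - (cmod (g (p t)))\<^sup>2 \<le> 2 * (1 - cmod (\<gamma> t))"
      using zero_le_power2[of "1 - cmod (\<gamma> t)"] unfolding \<gamma>_def by (simp add: power2_eq_square algebra_simps)
    also have "\<dots> \<le> 2 * (C1 * R / 4 * exp (- \<kappa> * t))" using depth[OF t] by simp
    finally show ?thesis using R by (simp add: divide_right_mono)
  qed
  \<comment> \<open>Integrating \<open>speed\<close> shows that \<gamma> has finite length, which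
    gives the limit \<sigma> and the rate of approach in \<open>near\<close>.\<close>
  have dist\<gamma>: "cmod (\<gamma> t - \<gamma> s) \<le> C1 / \<kappa> * exp (- \<kappa> * s)" if st: "0 \<le> s" "s < t" for s t
  proof -
    have dg: "(\<gamma> has_vector_derivative (- \<i>) * deriv g (p x)) (at x)" for x
    proof -
      have "(g has_field_derivative deriv g (p x)) (at (p x))"
        by (rule holomorphic_derivI[OF g_holomorphic open_U pU])
      moreover have "(p has_vector_derivative - \<i>) (at x)"
      proof -
        have "p = (\<lambda>t. Complex ((a + b) / 2) y0 + of_real t * (- \<i>))" by (simp add: p_def fun_eq_iff complex_eq_iff)
        then show ?thesis by (auto intro!: derivative_eq_intros)
      qed
      ultimately show ?thesis
        using field_vector_diff_chain_at[of p "- \<i>" x g "deriv g (p x)"] by (simp add: \<gamma>_def o_def)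
    qed
    have "norm (\<gamma> t - \<gamma> s) \<le> - (C1 / \<kappa>) * exp (- \<kappa> * t) - - (C1 / \<kappa>) * exp (- \<kappa> * s)"
    proof (rule differentiable_bound_general[OF st(2), of \<gamma> "\<lambda>t. - (C1 / \<kappa>) * exp (- \<kappa> * t)" "\<lambda>x. (- \<i>) * deriv g (p x)" "\<lambda>t. C1 * exp (- \<kappa> * t)"])
      show "continuous_on {s..t} \<gamma>"
        using dg by (intro continuous_at_imp_continuous_on ballI has_vector_derivative_continuous)
      show "continuous_on {s..t} (\<lambda>t. - (C1 / \<kappa>) * exp (- \<kappa> * t))" by (intro continuous_intros)
      fix x assume x: "s < x" "x < t"
      show "(\<gamma> has_vector_derivative (- \<i>) * deriv g (p x)) (at x)" by (rule dg)
      have "((\<lambda>t. - (C1 / \<kappa>) * exp (- \<kappa> * t)) has_real_derivative C1 * exp (- \<kappa> * x)) (at x)"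
        using kp by (auto intro!: derivative_eq_intros)
      then show "((\<lambda>t. - (C1 / \<kappa>) * exp (- \<kappa> * t)) has_vector_derivative C1 * exp (- \<kappa> * x)) (at x)"
        by (simp add: has_real_derivative_iff_has_vector_derivative)
      show "norm ((- \<i>) * deriv g (p x)) \<le> C1 * exp (- \<kappa> * x)"
        using speed[of x] x st by (simp add: norm_mult)
    qed
    also have "\<dots> \<le> C1 / \<kappa> * exp (- \<kappa> * s)" using C1 kp by simp
    finally show ?thesis .
  qed
  have elim: "(\<lambda>n. A * exp (- \<kappa> * real n)) \<longlonglongrightarrow> 0" for A
    using kp by real_asymp
  have "Cauchy (\<lambda>n. \<gamma> (real n))"
  proof (rule metric_CauchyI)
    fix e :: real assume e: "e > 0"
    obtain N where N: "\<And>n. n \<ge> N \<Longrightarrow> C1 / \<kappa> * exp (- \<kappa> * real n) < e"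
      using order_tendstoD(2)[OF elim e] unfolding eventually_sequentially by blast
    have *: "dist (\<gamma> (real m)) (\<gamma> (real n)) < e" if "N \<le> m" "m < n" for m n
      using dist\<gamma>[of "real m" "real n"] N[of m] that by (simp add: dist_norm norm_minus_commute)
    have "dist (\<gamma> (real m)) (\<gamma> (real n)) < e" if "N \<le> m" "N \<le> n" for m n
      using *[of m n] *[of n m] that e by (cases m n rule: linorder_cases) (auto simp: dist_commute)
    then show "\<exists>M. \<forall>m\<ge>M. \<forall>n\<ge>M. dist (\<gamma> (real m)) (\<gamma> (real n)) < e" by blast
  qed
  then obtain \<sigma> where \<sigma>: "(\<lambda>n. \<gamma> (real n)) \<longlonglongrightarrow> \<sigma>" using Cauchy_convergent convergent_def by blast
  have near: "cmod (\<sigma> - \<gamma> t) \<le> C1 / \<kappa> * exp (- \<kappa> * t)" if t: "t \<ge> 0" for t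
  proof (rule LIMSEQ_le_const2)
    show "(\<lambda>n. cmod (\<gamma> (real n) - \<gamma> t)) \<longlonglongrightarrow> cmod (\<sigma> - \<gamma> t)" by (intro tendsto_intros \<sigma>)
    obtain N where N: "t < real N" using reals_Archimedean2 by blast
    show "\<exists>N. \<forall>n\<ge>N. cmod (\<gamma> (real n) - \<gamma> t) \<le> C1 / \<kappa> * exp (- \<kappa> * t)"
      using N t by (intro exI[of _ N] allI impI dist\<gamma>) auto
  qed
  have s1: "cmod \<sigma> = 1"
  proof (rule antisym)
    have l: "(\<lambda>n. cmod (\<gamma> (real n))) \<longlonglongrightarrow> cmod \<sigma>" by (intro tendsto_intros \<sigma>)
    show "cmod \<sigma> \<le> 1"
      by (rule LIMSEQ_le_const2[OF l]) (use \<gamma>D in \<open>auto simp: less_imp_le\<close>)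
    have r: "(\<lambda>n. 1 - C1 * R / 4 * exp (- \<kappa> * real n)) \<longlonglongrightarrow> 1 - 0" by (intro tendsto_intros elim)
    have "1 - C1 * R / 4 * exp (- \<kappa> * real n) \<le> cmod (\<gamma> (real n))" for n
      using depth[of "real n"] by linarith
    then show "1 \<le> cmod \<sigma>" using LIMSEQ_le[OF r l] by simp
  qed
  have ratio: "1 - (cmod (\<gamma> t))\<^sup>2 \<le> exp (4 * s / R) * (1 - (cmod (\<gamma> (t + s)))\<^sup>2)" if s: "s \<ge> 0" for s t
  proof -
    have "1 - (cmod (g (p (t + s) + of_real s * \<i>)))\<^sup>2 \<le> exp (2 * s / (R / 2)) * (1 - (cmod (g (p (t + s))))\<^sup>2)"
    proof (rule disc_depth_growth[OF g_holomorphic open_U g_image])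
      fix x :: real
      have "p (t + s) + of_real x * \<i> = p (t + s - x)" by (simp add: p_def complex_eq_iff)
      then show "ball (p (t + s) + of_real x * \<i>) (R / 2) \<subseteq> U" using pball by simp
    qed (use s R in auto)
    then show ?thesis using p_up[of t s] by (simp add: \<gamma>_def mult.commute)
  qed
  \<comment> \<open>\<open>\<phi> s\<close> carries \<open>\<gamma> (n + s)\<close> to
    \<open>\<gamma> n\<close>; both tend to \<sigma>, and \<open>ratio\<close> compares their
    depths. This crude constant only serves to make the sharp \<open>c s\<close> positive.\<close>
  have J: "exp (- 4 * s / R) * poisson \<sigma> z \<le> poisson \<sigma> (\<phi> s z)" if s: "s \<ge> 0" and z: "z \<in> \<DD>" for s z
  proof -
    have "poisson \<sigma> z \<le> exp (4 * s / R) * poisson \<sigma> (\<phi> s z)"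
    proof (rule Julia_inequality[OF phi_holomorphic[OF s] phi_image[OF s] s1 _ _ _ _ z])
      show "\<gamma> (real n + s) \<in> \<DD>" for n by (rule \<gamma>D)
      have "(\<lambda>n. cmod (\<sigma> - \<gamma> (real n + s))) \<longlonglongrightarrow> 0"
      proof (rule tendsto_sandwich[OF _ _ tendsto_const])
        show "(\<lambda>n. C1 / \<kappa> * exp (- \<kappa> * s) * exp (- \<kappa> * real n)) \<longlonglongrightarrow> 0" by (rule elim)
        have "cmod (\<sigma> - \<gamma> (real n + s)) \<le> C1 / \<kappa> * exp (- \<kappa> * s) * exp (- \<kappa> * real n)" for n
          using near[of "real n + s"] s by (simp add: algebra_simps flip: exp_add)
        then show "\<forall>\<^sub>F n in sequentially. cmod (\<sigma> - \<gamma> (real n + s)) \<le> C1 / \<kappa> * exp (- \<kappa> * s) * exp (- \<kappa> * real n)"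
          by simp
      qed auto
      then have "(\<lambda>n. \<sigma> - \<gamma> (real n + s)) \<longlonglongrightarrow> 0" by (rule tendsto_norm_zero_cancel)
      from tendsto_diff[OF tendsto_const[of \<sigma>] this]
      show "(\<lambda>n. \<gamma> (real n + s)) \<longlonglongrightarrow> \<sigma>" by simp
      show "(\<lambda>n. \<phi> s (\<gamma> (real n + s))) \<longlonglongrightarrow> \<sigma>" using \<sigma> backward[OF s] by simp
      show "\<exists>\<^sub>F n in sequentially. 1 - (cmod (\<phi> s (\<gamma> (real n + s))))\<^sup>2 \<le> exp (4 * s / R) * (1 - (cmod (\<gamma> (real n + s)))\<^sup>2)"
        unfolding backward[OF s] by (intro eventually_frequently always_eventually allI ratio s) simp
    qed
    then show ?thesis by (simp add: exp_minus field_simps)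
  qed
  have "\<exists>c. 0 < c \<and> angular_slope (halfplane_conj \<sigma> (\<phi> s)) c \<and>
      (\<forall>z\<in>\<DD>. c * poisson \<sigma> z \<le> poisson \<sigma> (\<phi> s z)) \<and>
      nontangential_limit (\<phi> s) \<sigma> \<sigma> \<and> nontangential_limit (deriv (\<phi> s)) \<sigma> (of_real (1 / c))"
    if s: "s \<ge> 0" for s
  proof -
    obtain c where c: "exp (- 4 * s / R) \<le> c" "angular_slope (halfplane_conj \<sigma> (\<phi> s)) c"
      "\<And>z. z \<in> \<DD> \<Longrightarrow> c * poisson \<sigma> z \<le> poisson \<sigma> (\<phi> s z)"
      "nontangential_limit (\<phi> s) \<sigma> \<sigma>" "nontangential_limit (deriv (\<phi> s)) \<sigma> (of_real (1 / c))"
      by (rule Julia_Wolff_Caratheodory[OF phi_holomorphic[OF s] phi_image[OF s] s1 _ J[OF s]]) auto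
    moreover have "0 < c" using c(1) exp_gt_zero[of "- 4 * s / R"] by linarith
    ultimately show ?thesis by blast
  qed
  then obtain c where c: "\<And>s. s \<ge> 0 \<Longrightarrow> 0 < c s \<and> angular_slope (halfplane_conj \<sigma> (\<phi> s)) (c s)"
    and cP: "\<And>s z. s \<ge> 0 \<Longrightarrow> z \<in> \<DD> \<Longrightarrow> c s * poisson \<sigma> z \<le> poisson \<sigma> (\<phi> s z)"
    and cl: "\<And>s. s \<ge> 0 \<Longrightarrow> nontangential_limit (\<phi> s) \<sigma> \<sigma> \<and> nontangential_limit (deriv (\<phi> s)) \<sigma> (of_real (1 / c s))"
    by metis
  define d0 where "d0 = (1 - (cmod (\<gamma> 0))\<^sup>2) / (C1 / \<kappa>)\<^sup>2"
  have d0: "d0 > 0" using disc_depth_pos[OF \<gamma>D[of 0]] C1 kp by (simp add: d0_def)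
  \<comment> \<open>The depth is at least of order exp(-4t/R), while the squared distance to
    \<sigma> is at most of order exp(-2\<kappa>t) = exp(-5t/R).\<close>
  have grow: "d0 * exp (t / R) \<le> poisson \<sigma> (\<gamma> t)" if t: "t \<ge> 0" for t
  proof -
    have "d0 * exp (t / R) = (exp (- 4 * t / R) * (1 - (cmod (\<gamma> 0))\<^sup>2)) / (C1 / \<kappa> * exp (- \<kappa> * t))\<^sup>2"
    proof -
      have "(exp (- \<kappa> * t))\<^sup>2 = exp (- 5 * t / R)"
        using R by (simp add: \<kappa>_def power2_eq_square field_simps flip: exp_add)
      then have "(C1 / \<kappa> * exp (- \<kappa> * t))\<^sup>2 = (C1 / \<kappa>)\<^sup>2 * exp (- 5 * t / R)"
        by (simp only: power_mult_distrib)
      moreover have "exp (t / R) = exp (- 4 * t / R) / exp (- 5 * t / R)"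
        by (simp flip: exp_diff add: diff_divide_distrib[symmetric])
      ultimately show ?thesis by (simp add: d0_def mult.commute)
    qed
    also have "\<dots> \<le> (1 - (cmod (\<gamma> t))\<^sup>2) / (cmod (\<sigma> - \<gamma> t))\<^sup>2"
    proof (rule frac_le)
      show "exp (- 4 * t / R) * (1 - (cmod (\<gamma> 0))\<^sup>2) \<le> 1 - (cmod (\<gamma> t))\<^sup>2"
        using ratio[OF t, of 0] by (simp add: exp_minus field_simps)
      show "(cmod (\<sigma> - \<gamma> t))\<^sup>2 \<le> (C1 / \<kappa> * exp (- \<kappa> * t))\<^sup>2" by (intro power_mono near t) simp
      have "\<sigma> \<noteq> \<gamma> t" using s1 \<gamma>D[of t] by auto
      then show "0 < (cmod (\<sigma> - \<gamma> t))\<^sup>2" by simp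
      show "0 \<le> 1 - (cmod (\<gamma> t))\<^sup>2" using disc_depth_pos[OF \<gamma>D[of t]] by simp
    qed
    finally show ?thesis by (simp add: poisson_def)
  qed
  \<comment> \<open>Iterating Julia's inequality along the backward orbit bounds
    \<open>c s ^ n * poisson \<sigma> (\<gamma> (real n * s))\<close> by its value at n = 0. If
    \<open>c s\<close> were larger than claimed, \<open>grow\<close> would make this product
    increase geometrically.\<close>
  have cle: "c s \<le> exp (- s / R)" if s: "s \<ge> 0" for s
  proof (rule ccontr)
    assume "\<not> ?thesis"
    then have gt: "1 < c s * exp (s / R)" by (simp add: exp_minus field_simps)
    have it: "c s ^ n * poisson \<sigma> (\<gamma> (real n * s)) \<le> poisson \<sigma> (\<gamma> 0)" for n
    proof (induction n)
      case (Suc n)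
      have "c s * poisson \<sigma> (\<gamma> (real n * s + s)) \<le> poisson \<sigma> (\<gamma> (real n * s))"
        using cP[OF s \<gamma>D, of "real n * s + s"] backward[OF s] by simp
      then have "c s ^ n * (c s * poisson \<sigma> (\<gamma> (real n * s + s))) \<le> c s ^ n * poisson \<sigma> (\<gamma> (real n * s))"
        using c[OF s] by (intro mult_left_mono) auto
      then show ?case using Suc by (simp add: algebra_simps)
    qed simp
    have bd: "d0 * (c s * exp (s / R)) ^ n \<le> poisson \<sigma> (\<gamma> 0)" for n
    proof -
      have "d0 * (c s * exp (s / R)) ^ n = c s ^ n * (d0 * exp (real n * s / R))"
        by (simp add: power_mult_distrib flip: exp_of_nat_mult)
      also have "\<dots> \<le> c s ^ n * poisson \<sigma> (\<gamma> (real n * s))"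
        using c[OF s] s by (intro mult_left_mono grow) auto
      finally show ?thesis using it[of n] by linarith
    qed
    obtain n where "poisson \<sigma> (\<gamma> 0) / d0 < (c s * exp (s / R)) ^ n"
      using real_arch_pow[OF gt] by blast
    then have "poisson \<sigma> (\<gamma> 0) < d0 * (c s * exp (s / R)) ^ n" using d0 by (simp add: field_simps)
    then show False using bd[of n] by linarith
  qed
  have c1: "c s \<le> 1" if s: "s \<ge> 0" for s
    using cle[OF s] exp_le_one_iff[of "- s / R"] s R by (smt (verit) divide_nonneg_pos minus_divide_left)
  have lnc: "ln (c 1) < 0"
  proof -
    have "c 1 < 1" using cle[of 1] R by (smt (verit) divide_pos_pos minus_divide_left exp_less_one_iff)
    then show ?thesis using c[of 1] by simp
  qed
  \<comment> \<open>The multiplier of \<open>\<phi> t\<close> at \<sigma> is 1 / c t = exp(-t ln(c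
    1)), so the spectral value is \<open>ln (c 1)\<close>, negative by \<open>cle\<close>.\<close>
  have "repelling_fixed_point \<phi> \<sigma>"
    unfolding repelling_fixed_point_def
  proof (intro conjI exI[of _ "ln (c 1)"] allI impI)
    show "\<sigma> \<in> frontier \<DD>" using s1 by (simp add: frontier_ball)
    show "ln (c 1) < 0" by (rule lnc)
    fix t :: real assume t: "0 \<le> t"
    show "nontangential_limit (\<phi> t) \<sigma> \<sigma>" using cl[OF t] by blast
    have "1 / c t = exp (- ln (c 1) * t)"
      using semigroup_boundary_dilation[OF s1 c c1 t] by (simp add: exp_minus mult.commute inverse_eq_divide)
    then show "nontangential_limit (deriv (\<phi> t)) \<sigma> (of_real (exp (- ln (c 1) * t)))"
      using cl[OF t] by simp
  qed
  moreover have "\<sigma> \<in> frontier {z \<in> \<DD>. Re (h z) \<in> {a<..<b}}"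
  proof -
    have "\<gamma> t \<in> {z \<in> \<DD>. Re (h z) \<in> {a<..<b}}" for t
      using \<gamma>D[of t] h_g[OF pU[of t]] ab by (simp add: \<gamma>_def) (simp add: p_def)
    then have "\<sigma> \<in> closure {z \<in> \<DD>. Re (h z) \<in> {a<..<b}}"
      unfolding closure_sequential using \<sigma> by (intro exI[of _ "\<lambda>n. \<gamma> (real n)"]) blast
    moreover have "\<sigma> \<notin> interior {z \<in> \<DD>. Re (h z) \<in> {a<..<b}}"
      using s1 interior_subset by fastforce
    ultimately show ?thesis by (simp add: frontier_def)
  qed
  ultimately show ?thesis by blast
qed

end

section \<open>Half-planes\<close>

lemma deriv_nonneg_if_min_right:
  fixes f :: "real \<Rightarrow> real"
  assumes "(f has_real_derivative D) (at 0)" "\<And>t. t \<ge> 0 \<Longrightarrow> f 0 \<le> f t"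
  shows "D \<ge> 0"
proof (rule ccontr)
  assume "\<not> D \<ge> 0"
  then obtain d where "d > 0" "\<And>x. x > 0 \<Longrightarrow> x < d \<Longrightarrow> f (0 + x) < f 0"
    using DERIV_neg_dec_right[OF assms(1)] by auto
  from this(2)[of "d / 2"] this(1) assms(2)[of "d / 2"] show False by simp
qed

text \<open>Maximum principle for the harmonic function \<open>u\<close> in the unit disc about
  \<open>\<i> * Im z\<close>, cut off at Re \<ge> \<delta>. On the straight side u is at most
  \<open>e\<close>; on the arc the barrier is at least the bound \<open>M\<close> for u. At
  \<open>z\<close> the barrier is C ln(1 + Re z), at most C Re z, and \<open>e\<close> is
  arbitrary.\<close>

lemma linear_bound_at_boundary:
  fixes u :: "complex \<Rightarrow> real" and s a :: real
  assumes hol: "f holomorphic_on \<H>" and u: "\<And>\<zeta>. u \<zeta> = s * (Re (f \<zeta>) - a)"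
    and bd: "\<And>e. e > 0 \<Longrightarrow> \<exists>\<delta>>0. \<forall>\<zeta>. 0 < Re \<zeta> \<and> Re \<zeta> \<le> \<delta> \<and> cmod \<zeta> \<le> 3 \<longrightarrow> u \<zeta> \<le> e"
  shows "\<exists>C. \<forall>\<zeta>\<in>\<H>. cmod \<zeta> < 1 \<longrightarrow> u \<zeta> \<le> C * Re \<zeta>"
proof -
  obtain \<delta>1 where \<delta>1: "\<delta>1 > 0" "\<And>\<zeta>. 0 < Re \<zeta> \<Longrightarrow> Re \<zeta> \<le> \<delta>1 \<Longrightarrow> cmod \<zeta> \<le> 3 \<Longrightarrow> u \<zeta> \<le> 1"
    using bd[of 1] by auto
  have contu: "continuous_on \<H> u"
    unfolding u by (intro continuous_intros holomorphic_on_imp_continuous_on hol)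
  have "compact ({\<zeta>. \<delta>1 \<le> Re \<zeta>} \<inter> cball 0 3)"
    by (intro closed_Int_compact closed_halfspace_Re_ge compact_cball)
  moreover have "{\<zeta>. \<delta>1 \<le> Re \<zeta>} \<inter> cball 0 3 \<subseteq> \<H>" using \<delta>1(1) by auto
  ultimately have "compact (u ` ({\<zeta>. \<delta>1 \<le> Re \<zeta>} \<inter> cball 0 3))"
    using compact_continuous_image continuous_on_subset[OF contu] by blast
  then obtain M1 where M1: "\<And>\<zeta>. \<delta>1 \<le> Re \<zeta> \<Longrightarrow> cmod \<zeta> \<le> 3 \<Longrightarrow> u \<zeta> \<le> M1"
    using compact_imp_bounded bounded_imp_bdd_above unfolding bdd_above_def by (metis (no_types, lifting) IntI imageI mem_Collect_eq mem_cball_0)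
  define M where "M = max M1 1"
  have M: "M \<ge> 1" "\<And>\<zeta>. 0 < Re \<zeta> \<Longrightarrow> cmod \<zeta> \<le> 3 \<Longrightarrow> u \<zeta> \<le> M"
  proof -
    show "M \<ge> 1" by (simp add: M_def)
    fix \<zeta> assume "0 < Re \<zeta>" "cmod \<zeta> \<le> 3"
    then show "u \<zeta> \<le> M"
      using M1[of \<zeta>] \<delta>1(2)[of \<zeta>] by (cases "Re \<zeta> \<le> \<delta>1") (auto simp: M_def)
  qed
  \<comment> \<open>Lower bound for ln |\<zeta> - c + 1| on the arc |\<zeta> - c| = 1, Re \<zeta> >
    0, where |\<zeta> - c + 1|^2 is at least 2.\<close>
  define b0 where "b0 = ln 2 / (2::real)"
  have b0: "b0 > 0" by (simp add: b0_def)
  define C where "C = M / b0"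
  have C: "C > 0" using M b0 by (simp add: C_def)
  have "u z \<le> C * Re z" if z: "z \<in> \<H>" "cmod z < 1" for z
  proof (rule field_le_epsilon)
    fix e :: real assume e: "e > 0"
    obtain \<delta>2 where \<delta>2: "\<delta>2 > 0" "\<And>\<zeta>. 0 < Re \<zeta> \<Longrightarrow> Re \<zeta> \<le> \<delta>2 \<Longrightarrow> cmod \<zeta> \<le> 3 \<Longrightarrow> u \<zeta> \<le> e"
      using bd[OF e] by auto
    define \<delta> where "\<delta> = min \<delta>2 (Re z)"
    have \<delta>: "\<delta> > 0" "\<delta> \<le> \<delta>2" "\<delta> \<le> Re z" using \<delta>2 z by (auto simp: \<delta>_def)
    define c where "c = \<i> * of_real (Im z)"
    have cn: "cmod c \<le> 1" using abs_Im_le_cmod[of z] z by (simp add: c_def norm_mult)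
    define K where "K = {\<zeta>. \<delta> \<le> Re \<zeta>} \<inter> cball c 1"
    \<comment> \<open>The barrier \<open>ln |\<zeta> - c + 1|\<close> vanishes on the circle tangent to the imaginary axis at \<open>c\<close>.\<close>
    define F where "F = (\<lambda>\<zeta>. exp (of_real s * (f \<zeta> - of_real a) - of_real C * Ln (\<zeta> - c + 1)))"
    have KH: "K \<subseteq> \<H>" using \<delta> by (auto simp: K_def)
    have K3: "cmod \<zeta> \<le> 3" if "\<zeta> \<in> K" for \<zeta>
      using that cn norm_triangle_ineq[of "\<zeta> - c" c] by (auto simp: K_def dist_norm norm_minus_commute)
    have ge1: "1 \<le> cmod (\<zeta> - c + 1)" "\<zeta> - c + 1 \<notin> \<real>\<^sub>\<le>\<^sub>0" if "\<zeta> \<in> \<H>" for \<zeta>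
    proof -
      have "Re (\<zeta> - c + 1) > 1" using that by (simp add: c_def)
      then show "1 \<le> cmod (\<zeta> - c + 1)" "\<zeta> - c + 1 \<notin> \<real>\<^sub>\<le>\<^sub>0"
        using complex_Re_le_cmod[of "\<zeta> - c + 1"] by (auto simp: complex_nonpos_Reals_iff)
    qed
    have nF: "cmod (F \<zeta>) = exp (u \<zeta> - C * ln (cmod (\<zeta> - c + 1)))" if "\<zeta> \<in> \<H>" for \<zeta>
    proof -
      have "\<zeta> - c + 1 \<noteq> 0" using ge1(1)[OF that] by auto
      then show ?thesis by (simp add: F_def u)
    qed
    have holF: "F holomorphic_on K"
      unfolding F_def using ge1(2) KH
      by (intro holomorphic_intros holomorphic_on_subset[OF hol]) auto
    have cK: "closed K" unfolding K_def by (intro closed_Int closed_halfspace_Re_ge closed_cball)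
    have "cmod (F z) \<le> exp e"
    proof (rule maximum_modulus_frontier[of F K])
      show "F holomorphic_on interior K" using holF interior_subset by (rule holomorphic_on_subset)
      show "continuous_on (closure K) F" using cK holF by (simp add: holomorphic_on_imp_continuous_on)
      show "bounded K" unfolding K_def by (simp add: bounded_Int)
      have "z - c = of_real (Re z)" by (simp add: c_def complex_eq_iff)
      then have "dist c z = Re z" using z by (simp add: dist_norm norm_minus_commute[of c])
      then show "z \<in> K" using \<delta> z complex_Re_le_cmod[of z] by (simp add: K_def)
      fix v assume "v \<in> frontier K"
      then have vK: "v \<in> K" and nint: "v \<notin> interior K" using cK by (auto simp: frontier_def)
      have vH: "v \<in> \<H>" using vK KH by blast
      have lnn: "ln (cmod (v - c + 1)) \<ge> 0" using ge1(1)[OF vH] by simp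
      have "\<not> (v \<in> {\<zeta>. \<delta> < Re \<zeta>} \<inter> ball c 1)"
      proof
        assume "v \<in> {\<zeta>. \<delta> < Re \<zeta>} \<inter> ball c 1"
        moreover have "open ({\<zeta>. \<delta> < Re \<zeta>} \<inter> ball c 1)" by (intro open_Int open_halfspace_Re_gt open_ball)
        moreover have "{\<zeta>. \<delta> < Re \<zeta>} \<inter> ball c 1 \<subseteq> K" by (auto simp: K_def)
        ultimately show False using nint interiorI by blast
      qed
      then consider "Re v = \<delta>" | "cmod (v - c) = 1"
        using vK by (auto simp: K_def dist_norm norm_minus_commute)
      then have "u v - C * ln (cmod (v - c + 1)) \<le> e"
      proof cases
        case 1
        then have "u v \<le> e" using \<delta> \<delta>2(2)[of v] K3[OF vK] by simp
        then show ?thesis using lnn C by (smt (verit) mult_nonneg_nonneg)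
      next
        case 2
        have "(cmod (v - c + 1))\<^sup>2 = (cmod (v - c))\<^sup>2 + 2 * Re (v - c) + 1"
          unfolding cmod_power2 by (simp add: power2_eq_square algebra_simps)
        then have "2 \<le> (cmod (v - c + 1))\<^sup>2" using 2 vH by (simp add: c_def)
        then have "ln 2 \<le> ln ((cmod (v - c + 1))\<^sup>2)" by (subst ln_le_cancel_iff) auto
        then have "b0 \<le> ln (cmod (v - c + 1))" using ge1(1)[OF vH] by (simp add: b0_def ln_realpow)
        then have "C * b0 \<le> C * ln (cmod (v - c + 1))" using C by (intro mult_left_mono) auto
        moreover have "C * b0 = M" using b0 by (simp add: C_def)
        moreover have "u v \<le> M" using M(2)[of v] vH K3[OF vK] by simp
        ultimately show ?thesis using e by linarith
      qed
      then show "cmod (F v) \<le> exp e" by (simp add: nF[OF vH])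
    qed
    then have "u z - C * ln (cmod (z - c + 1)) \<le> e" by (simp add: nF[OF z(1)])
    moreover have "cmod (z - c + 1) = 1 + Re z"
    proof -
      have "z - c + 1 = of_real (1 + Re z)" by (simp add: c_def complex_eq_iff)
      then show ?thesis using z by (simp del: of_real_add)
    qed
    moreover have "ln (1 + Re z) \<le> Re z" using z by (intro ln_add_one_self_le_self) auto
    then have "C * ln (1 + Re z) \<le> C * Re z" using C by (intro mult_left_mono) auto
    ultimately show "u z \<le> C * Re z + e" by simp
  qed
  then show ?thesis by blast
qed

text \<open>The function \<open>\<i> / f'\<close> is the infinitesimal generator of the semigroup. The two hypotheses on it are
  the derivatives at \<open>t = 0\<close> of the Julia inequalities at \<open>\<infinity>\<close> and at \<open>0\<close>. In the coordinate \<open>k = 1/\<zeta>\<close>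
  both \<open>Q = -\<i>f'\<close> and \<open>\<mu>k - k\<^sup>2/Q\<close> have angular slopes, so \<open>Q/k\<close> and \<open>k/Q\<close> both have finite limits.\<close>

lemma repelling_slope_lower_bound:
  assumes hol: "f holomorphic_on \<H>" and nz: "\<And>\<zeta>. \<zeta> \<in> \<H> \<Longrightarrow> deriv f \<zeta> \<noteq> 0"
    and gen1: "\<And>\<zeta>. \<zeta> \<in> \<H> \<Longrightarrow> 0 \<le> Re (\<i> / deriv f \<zeta>)"
    and gen2: "\<And>\<zeta>. \<zeta> \<in> \<H> \<Longrightarrow> Re (\<i> / deriv f \<zeta> / \<zeta>\<^sup>2) \<le> \<mu> * Re (1 / \<zeta>)"
  obtains c where "c > 0" "\<And>\<zeta>. \<zeta> \<in> \<H> \<Longrightarrow> c * Re (1 / \<zeta>) \<le> Re (- \<i> * deriv f \<zeta>)"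
proof -
  define Q where "Q = (\<lambda>k. - \<i> * deriv f (1 / k))"
  define X where "X = (\<lambda>k. of_real \<mu> * k - k\<^sup>2 / Q k)"
  have inv: "1 / k \<in> \<H>" if "k \<in> \<H>" for k
    using that by (simp add: Re_divide) (auto intro!: divide_pos_pos add_pos_nonneg)
  have n0: "k \<noteq> 0" if "k \<in> \<H>" for k using that by auto
  have Qnz: "Q k \<noteq> 0" if "k \<in> \<H>" for k using nz[OF inv[OF that]] by (simp add: Q_def)
  have "deriv f holomorphic_on \<H>" by (rule holomorphic_deriv[OF hol open_RHP])
  moreover have "(\<lambda>k. 1 / k) holomorphic_on \<H>" using n0 by (intro holomorphic_intros) auto
  ultimately have "(\<lambda>k. deriv f (1 / k)) holomorphic_on \<H>"
    using holomorphic_on_compose_gen[of "\<lambda>k. 1 / k" \<H> "deriv f" \<H>] inv by (auto simp: o_def image_subset_iff)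
  then have holQ: "Q holomorphic_on \<H>" unfolding Q_def by (intro holomorphic_intros)
  have holX: "X holomorphic_on \<H>" unfolding X_def using Qnz by (intro holomorphic_intros holQ) auto
  have posQ: "Re (Q k) \<ge> 0" if k: "k \<in> \<H>" for k
  proof -
    have "Q k = 1 / (\<i> / deriv f (1 / k))" by (simp add: Q_def)
    moreover have "Re (1 / w) \<ge> 0" if "Re w \<ge> 0" for w using that by (simp add: Re_divide)
    ultimately show ?thesis using gen1[OF inv[OF k]] by metis
  qed
  have posX: "Re (X k) \<ge> 0" if k: "k \<in> \<H>" for k
  proof -
    have "k\<^sup>2 / Q k = \<i> / deriv f (1 / k) / (1 / k)\<^sup>2"
      using n0[OF k] nz[OF inv[OF k]] by (simp add: Q_def field_simps)
    then show ?thesis using gen2[OF inv[OF k]] by (simp add: X_def)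
  qed
  obtain c where c: "c \<ge> 0" "angular_slope Q c" by (rule angular_slope_exists[OF holQ posQ])
  obtain d where d: "d \<ge> 0" "angular_slope X d" by (rule angular_slope_exists[OF holX posX])
  \<comment> \<open>\<open>\<mu> - X k / k\<close> equals \<open>k / Q k\<close>, so the product is
    constantly 1 and the limit \<open>c\<close> of \<open>Q k / k\<close> cannot vanish.\<close>
  have "((\<lambda>x. (of_real \<mu> - X (of_real x) / of_real x) * (Q (of_real x) / of_real x)) \<longlongrightarrow>
      (of_real \<mu> - of_real d) * of_real c) at_top"
    by (intro tendsto_intros angular_slope_radial c d)
  moreover have "\<forall>\<^sub>F x in at_top. (of_real \<mu> - X (of_real x) / of_real x) * (Q (of_real x) / of_real x) = 1"
    using eventually_gt_at_top[of 0]
  proof eventually_elim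
    fix x :: real assume x: "0 < x"
    then have "Q (of_real x) \<noteq> 0" by (intro Qnz) simp
    then show "(of_real \<mu> - X (of_real x) / of_real x) * (Q (of_real x) / of_real x) = 1"
      using x by (simp add: X_def diff_divide_distrib power2_eq_square)
  qed
  ultimately have "((\<lambda>x::real. 1::complex) \<longlongrightarrow> (of_real \<mu> - of_real d) * of_real c) at_top"
    by (rule Lim_transform_eventually)
  then have "(of_real \<mu> - of_real d) * of_real c = (1::complex)"
    by (simp add: tendsto_const_iff)
  then have "c \<noteq> 0" by auto
  show ?thesis
  proof (rule that[of c])
    show "c > 0" using c \<open>c \<noteq> 0\<close> by simp
    fix \<zeta> assume z: "\<zeta> \<in> \<H>"
    have "c * Re (1 / \<zeta>) \<le> Re (Q (1 / \<zeta>))" using c(2) inv[OF z] by (auto simp: angular_slope_def)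
    then show "c * Re (1 / \<zeta>) \<le> Re (- \<i> * deriv f \<zeta>)" by (simp add: Q_def)
  qed
qed

text \<open>By \<open>low\<close>, the derivative of s (Re f - a) along the vertical line at
  distance x from the axis is at least c x / (x^2 + t^2) in the right direction. Starting near 0 at
  a positive value and running on to t = 2m gains c x / (5m), whereas \<open>lin\<close> allows at
  most C x; this fails once m is small.\<close>

lemma no_positive_values_near_jump:
  fixes s a :: real and zs :: "nat \<Rightarrow> complex"
  assumes hol: "f holomorphic_on \<H>" and s: "s = 1 \<or> s = - 1" and c: "c > 0"
    and low: "\<And>\<zeta>. \<zeta> \<in> \<H> \<Longrightarrow> c * Re (1 / \<zeta>) \<le> Re (- \<i> * deriv f \<zeta>)"
    and lin: "\<And>\<zeta>. \<zeta> \<in> \<H> \<Longrightarrow> cmod \<zeta> < 1 \<Longrightarrow> s * (Re (f \<zeta>) - a) \<le> C * Re \<zeta>"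
    and zs: "\<And>n. zs n \<in> \<H>" "zs \<longlonglongrightarrow> 0" and pos: "\<And>n. s * (Re (f (zs n)) - a) > 0"
  shows False
proof -
  \<comment> \<open>The first entry keeps the end point, of modulus at most \<open>3 * m\<close>, in
    the unit disc; the second makes \<open>c / (5 * m)\<close> exceed \<open>C\<close>.\<close>
  define e where "e = min (1 / 3) (c / (5 * (\<bar>C\<bar> + 1)))"
  have e: "e > 0" using c by (simp add: e_def)
  obtain n where n: "cmod (zs n) < e"
    using LIMSEQ_D[OF zs(2) e] by (metis diff_zero order_refl)
  define x where "x = Re (zs n)"
  \<comment> \<open>The line is run through as \<open>x - \<i> * s * t\<close>, a direction in which
    \<open>v\<close> increases for either sign \<open>s\<close>; the starting point
    \<open>zs n\<close> is at \<open>t = y\<close>.\<close>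
  define y where "y = - s * Im (zs n)"
  define m where "m = max x \<bar>y\<bar>"
  define v where "v = (\<lambda>t. s * (Re (f (of_real x - \<i> * of_real (s * t))) - a))"
  have x: "x > 0" using zs(1)[of n] by (simp add: x_def)
  have ay: "\<bar>y\<bar> = \<bar>Im (zs n)\<bar>" using s by (auto simp: y_def)
  have m: "m > 0" "x \<le> m" "y \<le> m" using x by (auto simp: m_def)
  have me: "m < e" using n abs_Re_le_cmod[of "zs n"] abs_Im_le_cmod[of "zs n"] ay by (auto simp: m_def x_def)
  have "s * s = 1" using s by auto
  have vy: "v y > 0"
  proof -
    have "of_real x - \<i> * of_real (s * y) = zs n"
      using s by (auto simp: x_def y_def complex_eq_iff)
    then show ?thesis using pos[of n] by (simp add: v_def)
  qed
  have dv: "(v has_real_derivative Re (- \<i> * deriv f (of_real x - \<i> * of_real (s * t)))) (at t)" for t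
  proof -
    let ?p = "of_real x - \<i> * of_real (s * t)"
    have "?p \<in> \<H>" using x by simp
    then have "(f has_field_derivative deriv f ?p) (at ?p)" by (rule holomorphic_derivI[OF hol open_RHP])
    moreover have "((\<lambda>t. of_real x - \<i> * of_real (s * t)) has_vector_derivative (- \<i> * of_real s)) (at t)"
      by (auto intro!: derivative_eq_intros simp: has_vector_derivative_def scaleR_conv_of_real fun_eq_iff algebra_simps)
    ultimately have "((\<lambda>t. f (of_real x - \<i> * of_real (s * t))) has_vector_derivative (- \<i> * of_real s) * deriv f ?p) (at t)"
      by (rule field_vector_diff_chain_at[unfolded o_def, rotated])
    then have "((\<lambda>t. Re (f (of_real x - \<i> * of_real (s * t)))) has_real_derivative Re ((- \<i> * of_real s) * deriv f ?p)) (at t)"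
      by (rule has_field_derivative_Re)
    then have "(v has_real_derivative s * (Re ((- \<i> * of_real s) * deriv f ?p) - 0)) (at t)"
      unfolding v_def by (intro DERIV_cmult DERIV_diff DERIV_const)
    moreover have "s * (Re ((- \<i> * of_real s) * deriv f ?p) - 0) = (s * s) * Re (- \<i> * deriv f ?p)"
      by (simp add: algebra_simps)
    ultimately show ?thesis by (simp only: \<open>s * s = 1\<close> mult_1)
  qed
  have low': "c * (x / (x\<^sup>2 + t\<^sup>2)) \<le> Re (- \<i> * deriv f (of_real x - \<i> * of_real (s * t)))" for t
  proof -
    have "(s * t)\<^sup>2 = t\<^sup>2" using s by (auto simp: power2_eq_square)
    then have "Re (1 / (of_real x - \<i> * of_real (s * t))) = x / (x\<^sup>2 + t\<^sup>2)" by (simp add: Re_divide)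
    then show ?thesis using low[of "of_real x - \<i> * of_real (s * t)"] x by simp
  qed
  have "v y \<le> v m"
  proof (rule DERIV_nonneg_imp_nondecreasing[OF m(3)])
    fix t
    have "0 \<le> c * (x / (x\<^sup>2 + t\<^sup>2))" using c x by simp
    then show "\<exists>d. (v has_real_derivative d) (at t) \<and> 0 \<le> d" using dv[of t] low'[of t] by (meson order_trans)
  qed
  \<comment> \<open>On \<open>[m, 2 * m]\<close> one has
    \<open>x\<^sup>2 + t\<^sup>2 \<le> 5 * m\<^sup>2\<close>, so \<open>k\<close> is a lower bound
    for the slope of \<open>v\<close>.\<close>
  define k where "k = c * (x / (5 * m\<^sup>2))"
  have "v m - k * m \<le> v (2 * m) - k * (2 * m)"
  proof (rule DERIV_nonneg_imp_nondecreasing[of m "2 * m" "\<lambda>t. v t - k * t"])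
    fix t assume t: "m \<le> t" "t \<le> 2 * m"
    have "x\<^sup>2 \<le> m\<^sup>2" "t\<^sup>2 \<le> (2 * m)\<^sup>2" using t m x by (intro power_mono; simp)+
    then have "x\<^sup>2 + t\<^sup>2 \<le> 5 * m\<^sup>2" by (simp add: power_mult_distrib)
    moreover have "x\<^sup>2 + t\<^sup>2 > 0" using x by (simp add: add_pos_nonneg)
    ultimately have "k \<le> c * (x / (x\<^sup>2 + t\<^sup>2))"
      unfolding k_def using c x m by (intro mult_left_mono divide_left_mono mult_pos_pos) auto
    then have "0 \<le> Re (- \<i> * deriv f (of_real x - \<i> * of_real (s * t))) - k" using low'[of t] by linarith
    moreover have "((\<lambda>t. v t - k * t) has_real_derivative Re (- \<i> * deriv f (of_real x - \<i> * of_real (s * t))) - k) (at t)"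
      by (rule derivative_eq_intros dv refl)+ simp
    ultimately show "\<exists>d. ((\<lambda>t. v t - k * t) has_real_derivative d) (at t) \<and> 0 \<le> d" by blast
  qed (use m in simp)
  then have "k * m < v (2 * m)" using vy \<open>v y \<le> v m\<close> by (simp add: algebra_simps)
  also have "v (2 * m) \<le> C * x"
  proof -
    let ?p = "of_real x - \<i> * of_real (s * (2 * m))"
    have "cmod ?p \<le> x + \<bar>s\<bar> * (2 * m)"
      using norm_triangle_ineq4[of "of_real x" "\<i> * of_real (s * (2 * m))"] x m by (simp add: norm_mult abs_mult)
    also have "\<dots> \<le> 3 * m" using s m by auto
    also have "\<dots> < 1" using me by (simp add: e_def)
    finally show ?thesis using lin[of ?p] x by (simp add: v_def)
  qed
  finally have "k * m < C * x" .
  moreover have "k * m = c / (5 * m) * x" using m by (simp add: k_def power2_eq_square field_simps)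
  ultimately have "c / (5 * m) < C" using x by (metis mult_less_cancel_right_pos)
  then have "c < C * (5 * m)" using m by (simp add: pos_divide_less_eq)
  also have "\<dots> \<le> (\<bar>C\<bar> + 1) * (5 * e)"
    using m me by (intro mult_mono) auto
  also have "\<dots> \<le> (\<bar>C\<bar> + 1) * (5 * (c / (5 * (\<bar>C\<bar> + 1))))"
    by (intro mult_left_mono) (auto simp: e_def)
  also have "\<dots> = c" by (simp add: field_simps)
  finally show False by simp
qed

context koenigs_model
begin

section \<open>Boundary behaviour at the Denjoy-Wolff point\<close>

lemma denjoy_wolff_orbit:
  assumes "denjoy_wolff_point \<phi> \<tau>" "z \<in> \<DD>"
  shows "((\<lambda>t. \<phi> t z) \<longlongrightarrow> \<tau>) at_top"
proof -
  have "uniform_limit {z} \<phi> (\<lambda>_. \<tau>) at_top" using assms(1)[unfolded denjoy_wolff_point_def] compact_sing[of z] assms(2) by blast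
  then show ?thesis by (rule tendsto_uniform_limitI) simp
qed

text \<open>The orbit of 0 under the iterates of \<open>\<phi> t\<close> tends to \<tau>, so its
  positive depths tend to 0 and cannot increase from some index on. The steps that do not increase
  the depth give Julia's inequality with constant 1.\<close>

lemma denjoy_wolff_Julia:
  assumes dw: "denjoy_wolff_point \<phi> \<tau>" and s: "cmod \<tau> = 1" and t: "t \<ge> 0" and z: "z \<in> \<DD>"
  shows "poisson \<tau> z \<le> poisson \<tau> (\<phi> t z)"
proof (cases "t = 0")
  case True then show ?thesis using phi_0[OF z] by simp
next
  case False
  then have t0: "t > 0" using t by simp
  define zs where "zs = (\<lambda>n. \<phi> (real n * t) 0)"
  have zD: "zs n \<in> \<DD>" for n unfolding zs_def using t by (intro phi_in_disc) auto
  have step: "\<phi> t (zs n) = zs (Suc n)" for n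
    using phi_add[of t "real n * t" 0] t by (simp add: zs_def algebra_simps)
  have "filterlim (\<lambda>n. real n * t) at_top sequentially"
    using t0 by real_asymp
  then have lim: "zs \<longlonglongrightarrow> \<tau>"
    unfolding zs_def using denjoy_wolff_orbit[OF dw, of 0] by (rule_tac filterlim_compose[of "\<lambda>t. \<phi> t 0"]) auto
  define d where "d = (\<lambda>n. 1 - (cmod (zs n))\<^sup>2)"
  have dpos: "d n > 0" for n using disc_depth_pos[OF zD] by (simp add: d_def)
  have "d \<longlonglongrightarrow> 1 - (cmod \<tau>)\<^sup>2" unfolding d_def by (intro tendsto_intros lim)
  then have d0: "d \<longlonglongrightarrow> 0" using s by simp
  have freq: "\<exists>\<^sub>F n in sequentially. d (Suc n) \<le> d n"
  proof (rule ccontr)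
    assume "\<not> ?thesis"
    then have "\<forall>\<^sub>F n in sequentially. d n < d (Suc n)" by (simp add: not_frequently not_le)
    then obtain N where N: "\<And>n. n \<ge> N \<Longrightarrow> d n < d (Suc n)"
      unfolding eventually_sequentially by blast
    have "d N \<le> d n" if "n \<ge> N" for n
      using that by (induction n rule: dec_induct) (auto intro: order_trans less_imp_le[OF N])
    then have "d N \<le> 0" using LIMSEQ_le_const[OF d0] by blast
    then show False using dpos[of N] by simp
  qed
  have "poisson \<tau> z \<le> 1 * poisson \<tau> (\<phi> t z)"
  proof (rule Julia_inequality[OF phi_holomorphic[OF t] phi_image[OF t] s zD lim _ _ z])
    show "(\<lambda>n. \<phi> t (zs n)) \<longlonglongrightarrow> \<tau>" unfolding step using lim by (rule LIMSEQ_Suc)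
    show "\<exists>\<^sub>F n in sequentially. 1 - (cmod (\<phi> t (zs n)))\<^sup>2 \<le> 1 * (1 - (cmod (zs n))\<^sup>2)"
      using freq by (simp add: step d_def)
  qed
  then show ?thesis by simp
qed

text \<open>The sign \<open>s\<close> covers right and left half-planes at once. Pushing
  \<open>ws\<close> deeper by X keeps the limit \<sigma>, and a time-one step there has hyperbolic
  size of order 1/X, so Julia's inequality at \<sigma> holds with exp(2/X) and, as X grows, with 1.
  The Poisson kernel at \<sigma> thus stays at least 1 along the orbit of 0, but it would tend to 0
  if \<tau> were another point.\<close>

lemma half_plane_limit_is_denjoy_wolff:
  fixes s a e :: real and ws :: "nat \<Rightarrow> complex"
  assumes dw: "denjoy_wolff_point \<phi> \<tau>" and t1: "cmod \<tau> = 1"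
    and s: "s = 1 \<or> s = - 1" and H: "{w. s * (Re w - a) > 0} \<subseteq> U"
    and e: "e > 0" and ws: "\<And>n. e \<le> s * (Re (ws n) - a)"
    and lim: "(\<lambda>n. g (ws n)) \<longlonglongrightarrow> \<sigma>" and s1: "cmod \<sigma> = 1"
  shows "\<sigma> = \<tau>"
proof -
  have sn: "cmod (of_real s) = 1" "s * s = 1" using s by auto
  have balls: "ball w r \<subseteq> U" if "r \<le> s * (Re w - a)" for w r
  proof
    fix v assume "v \<in> ball w r"
    then have "\<bar>Re (v - w)\<bar> < r" using abs_Re_le_cmod[of "v - w"] by (simp add: dist_norm norm_minus_commute)
    then have "s * (Re w - a) - r < s * (Re v - a)" using s by (auto simp: abs_less_iff)
    then show "v \<in> U" using H that by force
  qed
  have depth0: "(\<lambda>n. 1 - (cmod (q n))\<^sup>2) \<longlonglongrightarrow> 0" if "q \<longlonglongrightarrow> \<sigma>" for q :: "nat \<Rightarrow> complex"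
  proof -
    have "(\<lambda>n. 1 - (cmod (q n))\<^sup>2) \<longlonglongrightarrow> 1 - (cmod \<sigma>)\<^sup>2" by (intro tendsto_intros that)
    then show ?thesis using s1 by simp
  qed
  \<comment> \<open>Displacements of the order of the depth vanish as the sequence reaches the
    circle.\<close>
  have move: "q' \<longlonglongrightarrow> \<sigma>" if q: "q \<longlonglongrightarrow> \<sigma>" and le: "\<And>n. cmod (q' n - q n) \<le> A * (1 - (cmod (q n))\<^sup>2)"
    for q q' :: "nat \<Rightarrow> complex" and A
  proof -
    have "(\<lambda>n. A * (1 - (cmod (q n))\<^sup>2)) \<longlonglongrightarrow> A * 0" by (intro tendsto_intros depth0 q)
    then have "(\<lambda>n. q' n - q n) \<longlonglongrightarrow> 0"
      using le by (intro Lim_null_comparison[of "\<lambda>n. q' n - q n"]) auto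
    from tendsto_add[OF this q] show ?thesis by simp
  qed
  have J: "poisson \<sigma> z \<le> exp (2 / X) * poisson \<sigma> (\<phi> 1 z)" if X: "X > 0" and z: "z \<in> \<DD>" for X z
  proof -
    define p where "p = (\<lambda>n. ws n + of_real X * of_real s)"
    have ps: "s * (Re (p n) - a) = s * (Re (ws n) - a) + X" for n
      using sn(2) by (simp add: p_def algebra_simps)
    have pX: "X \<le> s * (Re (p n) - a)" for n using ws[of n] e by (simp add: ps)
    have pU: "p n \<in> U" for n using balls[OF pX[of n]] X centre_in_ball by blast
    have lim1: "(\<lambda>n. g (p n)) \<longlonglongrightarrow> \<sigma>"
    proof (rule move[OF lim])
      fix n
      show "cmod (g (p n) - g (ws n)) \<le> X / e * exp (2 * X / e) * (1 - (cmod (g (ws n)))\<^sup>2)"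
        unfolding p_def
      proof (rule disc_displacement[OF g_holomorphic open_U g_image e sn(1)])
        fix t :: real assume t: "0 \<le> t"
        have "s * (Re (ws n + of_real t * of_real s) - a) = s * (Re (ws n) - a) + t * (s * s)" by (simp add: algebra_simps)
        then show "ball (ws n + of_real t * of_real s) e \<subseteq> U" using ws[of n] t sn(2) by (intro balls) simp
      qed (use X in auto)
    qed
    have b2: "ball (p n + of_real t * \<i>) X \<subseteq> U" for n t using pX[of n] by (intro balls) simp
    have d2: "cmod (g (p n + of_real 1 * \<i>) - g (p n)) \<le> 1 / X * exp (2 * 1 / X) * (1 - (cmod (g (p n)))\<^sup>2)" for n
      by (rule disc_displacement[OF g_holomorphic open_U g_image X _ _ b2]) auto
    have r2: "1 - (cmod (g (p n + of_real 1 * \<i>)))\<^sup>2 \<le> exp (2 * 1 / X) * (1 - (cmod (g (p n)))\<^sup>2)" for n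
      by (rule disc_depth_growth[OF g_holomorphic open_U g_image X _ _ b2]) auto
    have ph: "\<phi> 1 (g (p n)) = g (p n + of_real 1 * \<i>)" for n using phi_g[OF pU, of 1] by (simp add: mult.commute)
    show ?thesis
    proof (rule Julia_inequality[OF phi_holomorphic phi_image s1 _ lim1 _ _ z])
      show "g (p n) \<in> \<DD>" for n by (rule g_in_disc[OF pU])
      show "(\<lambda>n. \<phi> 1 (g (p n))) \<longlonglongrightarrow> \<sigma>" unfolding ph by (rule move[OF lim1 d2])
      show "\<exists>\<^sub>F n in sequentially. 1 - (cmod (\<phi> 1 (g (p n))))\<^sup>2 \<le> exp (2 / X) * (1 - (cmod (g (p n)))\<^sup>2)"
        unfolding ph using r2 by (intro eventually_frequently) auto
    qed auto
  qed
  have J1: "poisson \<sigma> z \<le> poisson \<sigma> (\<phi> 1 z)" if z: "z \<in> \<DD>" for z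
  proof (rule LIMSEQ_le_const)
    have "(\<lambda>n. exp (2 / (real n + 1))) \<longlonglongrightarrow> 1" by real_asymp
    from tendsto_mult[OF this tendsto_const]
    show "(\<lambda>n. exp (2 / (real n + 1)) * poisson \<sigma> (\<phi> 1 z)) \<longlonglongrightarrow> poisson \<sigma> (\<phi> 1 z)" by simp
    show "\<exists>N. \<forall>n\<ge>N. poisson \<sigma> z \<le> exp (2 / (real n + 1)) * poisson \<sigma> (\<phi> 1 z)"
      using J[OF _ z] by simp
  qed
  have it: "1 \<le> poisson \<sigma> (\<phi> (real n) 0)" for n
  proof (induction n)
    case 0 then show ?case using s1 phi_0[of 0] by (simp add: poisson_def)
  next
    case (Suc n)
    have "poisson \<sigma> (\<phi> (real n) 0) \<le> poisson \<sigma> (\<phi> 1 (\<phi> (real n) 0))" by (intro J1 phi_in_disc) auto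
    also have "\<phi> 1 (\<phi> (real n) 0) = \<phi> (real (Suc n)) 0" using phi_add[of 1 "real n" 0] by (simp add: add.commute)
    finally show ?case using Suc by simp
  qed
  show ?thesis
  proof (rule ccontr)
    assume ne: "\<sigma> \<noteq> \<tau>"
    have l: "(\<lambda>n. \<phi> (real n) 0) \<longlonglongrightarrow> \<tau>"
      using denjoy_wolff_orbit[OF dw, of 0] filterlim_real_sequentially by (rule_tac filterlim_compose[of "\<lambda>t. \<phi> t 0"]) auto
    have "(\<lambda>n. poisson \<sigma> (\<phi> (real n) 0)) \<longlonglongrightarrow> (1 - (cmod \<tau>)\<^sup>2) / (cmod (\<sigma> - \<tau>))\<^sup>2"
      unfolding poisson_def using ne by (intro tendsto_intros l) auto
    then have "1 \<le> (1 - (cmod \<tau>)\<^sup>2) / (cmod (\<sigma> - \<tau>))\<^sup>2"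
      using LIMSEQ_le_const it by blast
    then show False using t1 by simp
  qed
qed

lemma cayley_diff:
  assumes "cmod \<tau> = 1" "\<sigma> \<noteq> \<tau>" "z \<noteq> \<tau>"
  shows "cayley \<tau> z - cayley \<tau> \<sigma> = 2 * \<tau> * (z - \<sigma>) / ((\<tau> - z) * (\<tau> - \<sigma>))"
  using assms by (simp add: cayley_def divide_simps) (simp add: algebra_simps)

text \<open>With \<tau> at infinity and \<sigma> at 0, the real part of 1/\<zeta> is a multiple of
  the Poisson kernel at \<sigma>. Julia's inequalities at both points can therefore be read in one
  coordinate.\<close>

lemma Re_inverse_cayley_diff:
  assumes t: "cmod \<tau> = 1" and s: "cmod \<sigma> = 1" and ne: "\<sigma> \<noteq> \<tau>" and z: "z \<in> \<DD>"
  shows "Re (1 / (cayley \<tau> z - cayley \<tau> \<sigma>)) = (cmod (\<tau> - \<sigma>))\<^sup>2 / 4 * poisson \<sigma> z"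
proof -
  let ?d = "cayley \<tau> z - cayley \<tau> \<sigma>"
  have zt: "z \<noteq> \<tau>" "z \<noteq> \<sigma>" using z s t by auto
  have "Re ?d = poisson \<tau> z" using s by (simp add: Re_cayley[OF t]) (simp add: poisson_def)
  moreover have "(cmod ?d)\<^sup>2 = 4 * (cmod (z - \<sigma>))\<^sup>2 / ((cmod (\<tau> - z))\<^sup>2 * (cmod (\<tau> - \<sigma>))\<^sup>2)"
    unfolding cayley_diff[OF t ne zt(1)] using t by (simp add: norm_divide norm_mult power_divide power_mult_distrib)
  moreover have "Re (1 / ?d) = Re ?d / (cmod ?d)\<^sup>2" by (simp add: Re_divide cmod_power2)
  ultimately show ?thesis
    using zt ne by (simp add: poisson_def norm_minus_commute[of \<sigma> z])
qed

section \<open>No repelling fixed point on the boundary of a half-plane petal\<close>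

lemma half_plane_no_repelling:
  fixes s a :: real
  assumes par: "parabolic_semigroup \<phi> \<tau>" and s: "s = 1 \<or> s = - 1"
    and H: "{w. s * (Re w - a) > 0} \<subseteq> U"
    and rep: "repelling_fixed_point \<phi> \<sigma>"
    and fr: "\<sigma> \<in> frontier {z \<in> \<DD>. s * (Re (h z) - a) > 0}"
  shows False
proof -
  have dw: "denjoy_wolff_point \<phi> \<tau>" and t1: "cmod \<tau> = 1"
    and par1: "nontangential_limit (deriv (\<phi> 1)) \<tau> 1"
    using par by (auto simp: parabolic_semigroup_def frontier_ball)
  obtain \<mu> where s1: "cmod \<sigma> = 1" and \<mu>: "\<mu> < 0"
    and rl: "\<And>t. t \<ge> 0 \<Longrightarrow> nontangential_limit (\<phi> t) \<sigma> \<sigma>"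
    and rd: "\<And>t. t \<ge> 0 \<Longrightarrow> nontangential_limit (deriv (\<phi> t)) \<sigma> (of_real (exp (- \<mu> * t)))"
    using rep by (auto simp: repelling_fixed_point_def frontier_ball)
  \<comment> \<open>The multiplier of \<open>\<phi> 1\<close> is 1 at \<tau> but exp(-\<mu>), which
    exceeds 1, at \<sigma>.\<close>
  have ne: "\<sigma> \<noteq> \<tau>"
  proof
    assume "\<sigma> = \<tau>"
    then have "complex_of_real (exp (- \<mu>)) = of_real 1"
      using nontangential_limit_unique[OF s1 rd[of 1], of 1] par1 by simp
    then have "exp (- \<mu>) = 1" by (simp only: of_real_eq_iff)
    then show False using \<mu> by simp
  qed
  have t0: "\<tau> \<noteq> 0" using t1 by auto
  have zt: "z \<noteq> \<tau>" if "z \<in> \<DD>" for z using that t1 by auto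
  \<comment> \<open>\<open>b\<close> is purely imaginary, so subtracting it preserves the half-plane
    and puts \<sigma> at 0. Then \<open>f\<close> is \<open>h\<close> in the new coordinate and
    \<open>Y\<close> is its inverse.\<close>
  define b where "b = cayley \<tau> \<sigma>"
  have Reb: "Re b = 0" using s1 by (simp add: b_def Re_cayley[OF t1]) (simp add: poisson_def)
  define Z where "Z = (\<lambda>\<zeta>. inv_cayley \<tau> (\<zeta> + b))"
  define f where "f = (\<lambda>\<zeta>. h (Z \<zeta>))"
  define Y where "Y = (\<lambda>w. cayley \<tau> (g w) - b)"
  have bH: "\<zeta> + b \<in> \<H>" if "\<zeta> \<in> \<H>" for \<zeta> using that Reb by simp
  have ZD: "Z \<zeta> \<in> \<DD>" if "\<zeta> \<in> \<H>" for \<zeta> unfolding Z_def by (rule inv_cayley_in_disc[OF t1 bH[OF that]])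
  have cZ: "cayley \<tau> (Z \<zeta>) - b = \<zeta>" if "\<zeta> \<in> \<H>" for \<zeta>
    unfolding Z_def using cayley_inv_cayley[OF t0 RHP_plus_1_nonzero[OF bH[OF that]]] by simp
  have Zc: "Z (cayley \<tau> z - b) = z" if "z \<in> \<DD>" for z
    unfolding Z_def using inv_cayley_cayley[OF t0 zt[OF that]] by simp
  have cH: "cayley \<tau> z - b \<in> \<H>" if "z \<in> \<DD>" for z using cayley_in_RHP[OF t1 that] Reb by simp
  have fU: "f \<zeta> \<in> U" if "\<zeta> \<in> \<H>" for \<zeta> unfolding f_def by (rule h_in_U[OF ZD[OF that]])
  have gf: "g (f \<zeta>) = Z \<zeta>" if "\<zeta> \<in> \<H>" for \<zeta> unfolding f_def by (rule g_h[OF ZD[OF that]])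
  have Yf: "Y (f \<zeta>) = \<zeta>" if "\<zeta> \<in> \<H>" for \<zeta> unfolding Y_def gf[OF that] by (rule cZ[OF that])
  have "(\<lambda>\<zeta>. \<zeta> + b) holomorphic_on \<H>" by (intro holomorphic_intros)
  then have "(\<lambda>\<zeta>. inv_cayley \<tau> (\<zeta> + b)) holomorphic_on \<H>"
    by (rule holomorphic_on_compose_gen[OF _ inv_cayley_holomorphic, unfolded o_def]) (use bH in blast)
  then have holf: "f holomorphic_on \<H>"
    unfolding f_def using holomorphic_on_compose_gen[of Z \<H> h \<DD>] ZD h_holomorphic
    by (auto simp: o_def image_subset_iff Z_def)
  have holY: "Y holomorphic_on U"
    unfolding Y_def cayley_def using zt[OF g_in_disc]
    by (intro holomorphic_intros g_holomorphic) (metis right_minus_eq)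
  have dY: "deriv Y (f \<zeta>) * deriv f \<zeta> = 1" if z: "\<zeta> \<in> \<H>" for \<zeta>
  proof -
    have "((\<lambda>x. Y (f x)) has_field_derivative deriv Y (f \<zeta>) * deriv f \<zeta>) (at \<zeta>)"
      by (rule DERIV_chain2[OF holomorphic_derivI[OF holY open_U fU[OF z]] holomorphic_derivI[OF holf open_RHP z]])
    then have "((\<lambda>x. x) has_field_derivative deriv Y (f \<zeta>) * deriv f \<zeta>) (at \<zeta>)"
      by (rule has_field_derivative_transform_within_open[OF _ open_RHP z]) (rule Yf)
    then show ?thesis using DERIV_ident DERIV_unique by metis
  qed
  have nz: "deriv f \<zeta> \<noteq> 0" if "\<zeta> \<in> \<H>" for \<zeta> using dY[OF that] by auto
  have dYt: "((\<lambda>t. Y (f \<zeta> + \<i> * of_real t)) has_vector_derivative \<i> / deriv f \<zeta>) (at 0)" if z: "\<zeta> \<in> \<H>" for \<zeta>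
  proof -
    have "((\<lambda>t. f \<zeta> + \<i> * of_real t) has_vector_derivative \<i>) (at 0)"
      by (auto intro!: derivative_eq_intros simp: has_vector_derivative_def scaleR_conv_of_real mult.commute)
    moreover have "(Y has_field_derivative deriv Y (f \<zeta>)) (at (f \<zeta> + \<i> * of_real 0))"
      using holomorphic_derivI[OF holY open_U fU[OF z]] by simp
    ultimately have "((\<lambda>t. Y (f \<zeta> + \<i> * of_real t)) has_vector_derivative \<i> * deriv Y (f \<zeta>)) (at 0)"
      by (rule field_vector_diff_chain_at[unfolded o_def])
    moreover have "deriv Y (f \<zeta>) = 1 / deriv f \<zeta>" using dY[OF z] nz[OF z] by (simp add: field_simps)
    ultimately show ?thesis by simp
  qed
  have gphi: "g (f \<zeta> + \<i> * of_real t) = \<phi> t (Z \<zeta>)" if "\<zeta> \<in> \<H>" "t \<ge> 0" for \<zeta> t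
    using phi_g[OF fU[OF that(1)] that(2)] gf[OF that(1)] by simp
  have ReY: "Re (Y w) = poisson \<tau> (g w)" for w using Reb by (simp add: Y_def Re_cayley[OF t1])
  \<comment> \<open>\<open>\<i> / deriv f \<zeta>\<close> is the velocity of the flow in this
    coordinate; by Julia's inequality at \<tau>, \<open>Re (Y _)\<close> along the flow is least at
    t = 0.\<close>
  have gen1: "0 \<le> Re (\<i> / deriv f \<zeta>)" if z: "\<zeta> \<in> \<H>" for \<zeta>
  proof (rule deriv_nonneg_if_min_right)
    show "((\<lambda>t. Re (Y (f \<zeta> + \<i> * of_real t))) has_real_derivative Re (\<i> / deriv f \<zeta>)) (at 0)"
      by (rule has_field_derivative_Re[OF dYt[OF z]])
    fix t :: real assume t: "0 \<le> t"
    show "Re (Y (f \<zeta> + \<i> * of_real 0)) \<le> Re (Y (f \<zeta> + \<i> * of_real t))"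
      using denjoy_wolff_Julia[OF dw t1 t ZD[OF z]] by (simp add: ReY gphi[OF z t] gf[OF z])
  qed
  have ReY1: "Re (1 / Y w) = (cmod (\<tau> - \<sigma>))\<^sup>2 / 4 * poisson \<sigma> (g w)" if "w \<in> U" for w
    unfolding Y_def b_def by (rule Re_inverse_cayley_diff[OF t1 s1 ne g_in_disc[OF that]])
  \<comment> \<open>The analogue at \<sigma>: along the flow \<open>Re (1 / Y _)\<close> is at least
    \<open>exp (\<mu> * t)\<close> times its initial value, with equality at t = 0.\<close>
  have gen2: "Re (\<i> / deriv f \<zeta> / \<zeta>\<^sup>2) \<le> - \<mu> * Re (1 / \<zeta>)" if z: "\<zeta> \<in> \<H>" for \<zeta>
  proof -
    have z0: "\<zeta> \<noteq> 0" using z by auto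
    have v: "((\<lambda>t. 1 / Y (f \<zeta> + \<i> * of_real t)) has_vector_derivative - (\<i> / deriv f \<zeta>) / \<zeta>\<^sup>2) (at 0)"
    proof -
      have "((\<lambda>y. 1 / y) has_field_derivative - 1 / \<zeta>\<^sup>2) (at (Y (f \<zeta> + \<i> * of_real 0)))"
        using z0 Yf[OF z] by (auto intro!: derivative_eq_intros simp: power2_eq_square)
      from field_vector_diff_chain_at[OF dYt[OF z] this, unfolded o_def]
      show ?thesis by simp
    qed
    have "0 \<le> Re (- (\<i> / deriv f \<zeta>) / \<zeta>\<^sup>2) - \<mu> * Re (1 / \<zeta>)"
    proof (rule deriv_nonneg_if_min_right)
      have "((\<lambda>t. exp (\<mu> * t) * Re (1 / \<zeta>)) has_real_derivative \<mu> * Re (1 / \<zeta>)) (at 0)"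
        by (auto intro!: derivative_eq_intros)
      then show "((\<lambda>t. Re (1 / Y (f \<zeta> + \<i> * of_real t)) - exp (\<mu> * t) * Re (1 / \<zeta>)) has_real_derivative
          Re (- (\<i> / deriv f \<zeta>) / \<zeta>\<^sup>2) - \<mu> * Re (1 / \<zeta>)) (at 0)"
        by (intro DERIV_diff has_field_derivative_Re[OF v])
      fix t :: real assume t: "0 \<le> t"
      let ?k = "(cmod (\<tau> - \<sigma>))\<^sup>2 / 4"
      have "poisson \<sigma> (Z \<zeta>) \<le> exp (- \<mu> * t) * poisson \<sigma> (\<phi> t (Z \<zeta>))"
        by (rule Julia_from_angular_derivative[OF phi_holomorphic[OF t] phi_image[OF t] s1 rl[OF t] rd[OF t] exp_gt_zero ZD[OF z]])
      then have "exp (\<mu> * t) * poisson \<sigma> (Z \<zeta>) \<le> poisson \<sigma> (\<phi> t (Z \<zeta>))"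
        by (simp add: exp_minus field_simps)
      then have le: "?k * (exp (\<mu> * t) * poisson \<sigma> (Z \<zeta>)) \<le> ?k * poisson \<sigma> (\<phi> t (Z \<zeta>))"
        by (intro mult_left_mono) auto
      have e1: "Re (1 / \<zeta>) = ?k * poisson \<sigma> (Z \<zeta>)"
        using ReY1[OF fU[OF z]] Yf[OF z] gf[OF z] by simp
      have e2: "Re (1 / Y (f \<zeta> + \<i> * of_real t)) = ?k * poisson \<sigma> (\<phi> t (Z \<zeta>))"
        using ReY1[OF U_shift[OF fU[OF z] t]] gphi[OF z t] by simp
      have "exp (\<mu> * t) * Re (1 / \<zeta>) \<le> Re (1 / Y (f \<zeta> + \<i> * of_real t))"
        unfolding e1 e2 using le by (simp only: mult.left_commute)
      then show "Re (1 / Y (f \<zeta> + \<i> * of_real 0)) - exp (\<mu> * 0) * Re (1 / \<zeta>)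
          \<le> Re (1 / Y (f \<zeta> + \<i> * of_real t)) - exp (\<mu> * t) * Re (1 / \<zeta>)"
        using Yf[OF z] by simp
    qed
    then show ?thesis by simp
  qed
  obtain c where c: "c > 0" "\<And>\<zeta>. \<zeta> \<in> \<H> \<Longrightarrow> c * Re (1 / \<zeta>) \<le> Re (- \<i> * deriv f \<zeta>)"
    using repelling_slope_lower_bound[OF holf nz gen1 gen2] by blast
  define u where "u = (\<lambda>\<zeta>. s * (Re (f \<zeta>) - a))"
  \<comment> \<open>Otherwise points with u > e would accumulate at a finite point of the imaginary
    axis. It corresponds to a point of the circle other than \<tau>, contradicting
    \<open>half_plane_limit_is_denjoy_wolff\<close>.\<close>
  have small: "\<exists>\<delta>>0. \<forall>\<zeta>. 0 < Re \<zeta> \<and> Re \<zeta> \<le> \<delta> \<and> cmod \<zeta> \<le> 3 \<longrightarrow> u \<zeta> \<le> e" if e: "e > 0" for e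
  proof (rule ccontr)
    assume "\<not> ?thesis"
    then have "\<exists>\<zeta>. 0 < Re \<zeta> \<and> Re \<zeta> \<le> 1 / (real n + 1) \<and> cmod \<zeta> \<le> 3 \<and> u \<zeta> > e" for n
      by (auto simp: not_le dest: spec[of _ "1 / (real n + 1)"])
    then obtain \<zeta>s where \<zeta>s: "\<And>n. 0 < Re (\<zeta>s n)" "\<And>n. Re (\<zeta>s n) \<le> 1 / (real n + 1)"
      "\<And>n. cmod (\<zeta>s n) \<le> 3" "\<And>n. u (\<zeta>s n) > e" by metis
    have "compact (cball (0::complex) 3)" by simp
    moreover have "\<forall>n. \<zeta>s n \<in> cball 0 3" using \<zeta>s(3) by simp
    ultimately obtain l r where r: "strict_mono r" and l: "(\<lambda>n. \<zeta>s (r n)) \<longlonglongrightarrow> l"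
      unfolding compact_def o_def by blast
    have "(\<lambda>n. Re (\<zeta>s n)) \<longlonglongrightarrow> 0"
    proof (rule tendsto_sandwich[OF _ _ tendsto_const])
      show "(\<lambda>n. 1 / (real n + 1)) \<longlonglongrightarrow> 0" by real_asymp
    qed (use \<zeta>s(1,2) in \<open>auto simp: less_imp_le\<close>)
    then have "(\<lambda>n. Re (\<zeta>s (r n))) \<longlonglongrightarrow> 0" using LIMSEQ_subseq_LIMSEQ[OF _ r] by (simp add: o_def)
    then have Rel: "Re l = 0" using tendsto_Re[OF l] LIMSEQ_unique by blast
    define k where "k = l + b"
    have Rek: "Re k = 0" using Rel Reb by (simp add: k_def)
    have k1: "k + 1 \<noteq> 0" using Rek by (auto simp: complex_eq_iff)
    have lim: "(\<lambda>n. Z (\<zeta>s (r n))) \<longlonglongrightarrow> inv_cayley \<tau> k"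
      unfolding Z_def inv_cayley_def k_def using k1 by (intro tendsto_intros l) (simp add: k_def)
    have "cmod (k - 1) = cmod (k + 1)" using Rek by (simp add: cmod_def)
    then have n1: "cmod (inv_cayley \<tau> k) = 1" using t1 k1 by (simp add: inv_cayley_def norm_divide norm_mult)
    have "inv_cayley \<tau> k \<noteq> \<tau>"
    proof
      assume "inv_cayley \<tau> k = \<tau>"
      then have "k - 1 = k + 1" using k1 t0 by (simp add: inv_cayley_def field_simps)
      then show False by (simp add: complex_eq_iff)
    qed
    moreover have "inv_cayley \<tau> k = \<tau>"
    proof (rule half_plane_limit_is_denjoy_wolff[OF dw t1 s H e _ _ n1])
      show "e \<le> s * (Re (f (\<zeta>s (r n))) - a)" for n using \<zeta>s(4)[of "r n"] by (simp add: u_def)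
      show "(\<lambda>n. g (f (\<zeta>s (r n)))) \<longlonglongrightarrow> inv_cayley \<tau> k" using lim gf \<zeta>s(1) by simp
    qed
    ultimately show False by simp
  qed
  obtain C where C: "\<And>\<zeta>. \<zeta> \<in> \<H> \<Longrightarrow> cmod \<zeta> < 1 \<Longrightarrow> u \<zeta> \<le> C * Re \<zeta>"
    using linear_bound_at_boundary[OF holf, of u s a] small u_def by blast
  have "\<sigma> \<in> closure {z \<in> \<DD>. s * (Re (h z) - a) > 0}" using fr by (simp add: frontier_def)
  then obtain xs where xs: "\<And>n. xs n \<in> \<DD>" "\<And>n. s * (Re (h (xs n)) - a) > 0" "xs \<longlonglongrightarrow> \<sigma>"
    unfolding closure_sequential by blast
  show False
  proof (rule no_positive_values_near_jump[OF holf s c, of a C "\<lambda>n. cayley \<tau> (xs n) - b"])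
    show "s * (Re (f \<zeta>) - a) \<le> C * Re \<zeta>" if "\<zeta> \<in> \<H>" "cmod \<zeta> < 1" for \<zeta>
      using C[OF that] by (simp add: u_def)
    show "cayley \<tau> (xs n) - b \<in> \<H>" for n by (rule cH[OF xs(1)])
    have "(\<lambda>n. cayley \<tau> (xs n) - b) \<longlonglongrightarrow> cayley \<tau> \<sigma> - b"
      unfolding cayley_def using ne by (intro tendsto_intros xs) auto
    then show "(\<lambda>n. cayley \<tau> (xs n) - b) \<longlonglongrightarrow> 0" by (simp add: b_def)
    show "0 < s * (Re (f (cayley \<tau> (xs n) - b)) - a)" for n
      using xs(2)[of n] Zc[OF xs(1)] by (simp add: f_def)
  qed
qed

text \<open>By \<open>petal_iff\<close> and \<open>component_cases\<close> a petal lies over a ray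
  or a bounded interval. \<open>strip_petal_is_hyperbolic\<close> discards the intervals, and over a
  ray \<open>half_plane_no_repelling\<close> excludes repelling points.\<close>

lemma parabolic_petal_iff:
  assumes par: "parabolic_semigroup \<phi> \<tau>"
  shows "parabolic_petal \<phi> \<Delta> \<longleftrightarrow>
    (\<exists>a. {a<..} \<in> components (interior full_lines) \<and> \<Delta> = {z \<in> \<DD>. Re (h z) > a}) \<or>
    (\<exists>a. {..<a} \<in> components (interior full_lines) \<and> \<Delta> = {z \<in> \<DD>. Re (h z) < a})"
proof
  assume P: "parabolic_petal \<phi> \<Delta>"
  then have pet: "petal \<phi> \<Delta>" and nr: "\<not> (\<exists>\<sigma>\<in>frontier \<Delta>. repelling_fixed_point \<phi> \<sigma>)"
    by (auto simp: parabolic_petal_def hyperbolic_petal_def)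
  obtain J where J: "J \<in> components (interior full_lines)" "\<Delta> = {z \<in> \<DD>. Re (h z) \<in> J}"
    using pet petal_iff by blast
  from J(1) show "(\<exists>a. {a<..} \<in> components (interior full_lines) \<and> \<Delta> = {z \<in> \<DD>. Re (h z) > a}) \<or>
    (\<exists>a. {..<a} \<in> components (interior full_lines) \<and> \<Delta> = {z \<in> \<DD>. Re (h z) < a})"
  proof (cases rule: component_cases)
    case (3 a b)
    then show ?thesis using strip_petal_is_hyperbolic[of a b] J nr by blast
  qed (use J in auto)
next
  have no: "parabolic_petal \<phi> \<Delta>"
    if J: "J \<in> components (interior full_lines)" and \<Delta>: "\<Delta> = {z \<in> \<DD>. Re (h z) \<in> J}"
      and s: "s = 1 \<or> s = - 1" and sJ: "\<And>x. x \<in> J \<longleftrightarrow> s * (x - a) > 0" for J s a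
  proof -
    have "J \<subseteq> full_lines" using in_components_subset[OF J] interior_subset by blast
    then have H: "{w. s * (Re w - a) > 0} \<subseteq> U" using full_lines_iff[of J] by (simp add: sJ)
    have "petal \<phi> \<Delta>" using J \<Delta> petal_iff by blast
    moreover have "\<not> repelling_fixed_point \<phi> \<sigma>" if "\<sigma> \<in> frontier \<Delta>" for \<sigma>
      using half_plane_no_repelling[OF par s H, of \<sigma>] that \<Delta> by (auto simp: sJ)
    ultimately show ?thesis by (auto simp: parabolic_petal_def hyperbolic_petal_def)
  qed
  assume "(\<exists>a. {a<..} \<in> components (interior full_lines) \<and> \<Delta> = {z \<in> \<DD>. Re (h z) > a}) \<or>
    (\<exists>a. {..<a} \<in> components (interior full_lines) \<and> \<Delta> = {z \<in> \<DD>. Re (h z) < a})"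
  then show "parabolic_petal \<phi> \<Delta>"
  proof (elim disjE exE conjE)
    fix a assume "{a<..} \<in> components (interior full_lines)" "\<Delta> = {z \<in> \<DD>. Re (h z) > a}"
    then show ?thesis by (intro no[of "{a<..}" 1 a]) auto
  next
    fix a assume "{..<a} \<in> components (interior full_lines)" "\<Delta> = {z \<in> \<DD>. Re (h z) < a}"
    then show ?thesis by (intro no[of "{..<a}" "- 1" a]) auto
  qed
qed

section \<open>The correspondence with half-planes and the count of petals\<close>

lemma maximal_half_plane_iff:
  "maximal_half_plane U H \<longleftrightarrow>
    (\<exists>a. {a<..} \<in> components (interior full_lines) \<and> H = {w. Re w > a}) \<or>
    (\<exists>a. {..<a} \<in> components (interior full_lines) \<and> H = {w. Re w < a})"
  unfolding maximal_half_plane_def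
    right_half_plane_maximal_iff[symmetric] left_half_plane_maximal_iff[symmetric] by blast

lemma h_image_vimage:
  assumes "{w. P (Re w)} \<subseteq> U"
  shows "h ` {z \<in> \<DD>. P (Re (h z))} = {w. P (Re w)}"
proof (intro equalityI subsetI)
  fix w assume w: "w \<in> {w. P (Re w)}"
  then have wU: "w \<in> U" using assms by blast
  show "w \<in> h ` {z \<in> \<DD>. P (Re (h z))}"
    using w g_in_disc[OF wU] h_g[OF wU] by (intro image_eqI[of _ h "g w"]) auto
qed auto

end

theorem theorem5p8:
  fixes \<phi> :: "real \<Rightarrow> complex \<Rightarrow> complex" and \<tau> :: complex and h :: "complex \<Rightarrow> complex"
  assumes "holomorphic_semigroup \<phi>"
    and "\<not> is_holomorphic_group \<phi>"
    and "parabolic_semigroup \<phi> \<tau>"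
    and "koenigs_function \<phi> h"
  shows "(\<forall>\<Delta>. parabolic_petal \<phi> \<Delta> \<longrightarrow> maximal_half_plane (h ` \<DD>) (h ` \<Delta>)) \<and>
    (\<forall>H. maximal_half_plane (h ` \<DD>) H \<longrightarrow> parabolic_petal \<phi> (h -` H \<inter> \<DD>)) \<and>
    (finite {\<Delta>. parabolic_petal \<phi> \<Delta>} \<and> card {\<Delta>. parabolic_petal \<phi> \<Delta>} \<le> 2) \<and>
    (card {\<Delta>. parabolic_petal \<phi> \<Delta>} = 2 \<longrightarrow> zero_hyperbolic_step \<phi>)"
proof -
  obtain \<Omega> where \<Omega>: "if zero_hyperbolic_step \<phi> then \<Omega> = UNIV
      else \<Omega> = {\<zeta>. Re \<zeta> > 0} \<or> \<Omega> = {\<zeta>. Re \<zeta> < 0}"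
    and hol: "h holomorphic_on \<DD>" and inj: "inj_on h \<DD>"
    and shift: "\<And>t z. t \<ge> 0 \<Longrightarrow> z \<in> \<DD> \<Longrightarrow> h (\<phi> t z) = h z + \<i> * of_real t"
    and un: "(\<Union>t\<in>{0..}. (\<lambda>w. w - \<i> * of_real t) ` h ` \<DD>) = \<Omega>"
    using assms(4) unfolding koenigs_function_def parabolic_canonical_model_def by blast
  interpret koenigs_model \<phi> h
    by unfold_locales (use assms(1) hol inj shift in auto)
  let ?S = "interior full_lines"
  note pp = parabolic_petal_iff[OF assms(3)]
  have right: "{w. Re w > a} \<subseteq> U" if "{a<..} \<in> components ?S" for a
    using that right_half_plane_maximal_iff by blast
  have left: "{w. Re w < a} \<subseteq> U" if "{..<a} \<in> components ?S" for a
    using that left_half_plane_maximal_iff by blast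
  have 1: "maximal_half_plane U (h ` \<Delta>)" if "parabolic_petal \<phi> \<Delta>" for \<Delta>
    using that h_image_vimage[OF right] h_image_vimage[OF left]
    unfolding pp maximal_half_plane_iff by blast
  have 2: "parabolic_petal \<phi> (h -` H \<inter> \<DD>)" if "maximal_half_plane U H" for H
  proof -
    have "h -` {w. P (Re w)} \<inter> \<DD> = {z \<in> \<DD>. P (Re (h z))}" for P by auto
    then show ?thesis using that unfolding pp maximal_half_plane_iff by auto
  qed
  \<comment> \<open>Two ray components with the same direction have the same endpoint, so each of
    \<open>PR\<close> and \<open>PL\<close> has at most one element.\<close>
  define PR where "PR = {\<Delta>. \<exists>a. {a<..} \<in> components ?S \<and> \<Delta> = {z \<in> \<DD>. Re (h z) > a}}"
  define PL where "PL = {\<Delta>. \<exists>a. {..<a} \<in> components ?S \<and> \<Delta> = {z \<in> \<DD>. Re (h z) < a}}"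
  have P: "{\<Delta>. parabolic_petal \<phi> \<Delta>} = PR \<union> PL" unfolding pp PR_def PL_def by blast
  have uR: "a = b" if "{a<..} \<in> components ?S" "{b<..} \<in> components ?S" for a b
    using that unfolding right_ray_component_iff by (metis greaterThan_iff linorder_less_linear subsetD)
  have uL: "a = b" if "{..<a} \<in> components ?S" "{..<b} \<in> components ?S" for a b
    using that unfolding left_ray_component_iff by (metis lessThan_iff linorder_less_linear subsetD)
  have eqR: "A = B" if "A \<in> PR" "B \<in> PR" for A B using that uR unfolding PR_def by auto
  have eqL: "A = B" if "A \<in> PL" "B \<in> PL" for A B using that uL unfolding PL_def by auto
  have "\<exists>\<Delta>. PR \<subseteq> {\<Delta>}" "\<exists>\<Delta>. PL \<subseteq> {\<Delta>}" using eqR eqL by blast+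
  then have fin: "finite PR" "finite PL" "card PR \<le> 1" "card PL \<le> 1"
    by (auto simp: subset_singleton_iff)
  have card: "card (PR \<union> PL) \<le> card PR + card PL" by (rule card_Un_le)
  have 4: "zero_hyperbolic_step \<phi>" if "card {\<Delta>. parabolic_petal \<phi> \<Delta>} = 2"
  proof (rule ccontr)
    assume nz: "\<not> zero_hyperbolic_step \<phi>"
    \<comment> \<open>With two petals both directions occur, so \<open>U\<close> contains a right
      and a left half-plane. Their real test points have opposite signs and cannot both lie in the
      half-plane \<Omega>.\<close>
    have "PR \<noteq> {}" "PL \<noteq> {}" using that card fin unfolding P by force+
    then obtain a b where ab: "{w. Re w > a} \<subseteq> U" "{w. Re w < b} \<subseteq> U"
      using right left unfolding PR_def PL_def by blast
    have "U \<subseteq> \<Omega>" unfolding un[symmetric] U_def by (intro subsetI UN_I[of 0]) auto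
    then have "of_real (\<bar>a\<bar> + 1) \<in> \<Omega>" "of_real (- \<bar>b\<bar> - 1) \<in> \<Omega>"
      using ab by (auto simp: subset_iff)
    then show False using \<Omega> nz by auto
  qed
  show ?thesis using 1 2 4 fin card P unfolding U_def by auto
qed

end
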